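(* Let $\xi=(\xi_1\ge\dots\ge\xi_r\ge0)$ be a partition, $n=|\xi|$, and let $\rho=(1^{\xi^t_1}2^{\xi^t_2}\cdots)$ be the partition in which each $j\ge1$ appears exactly $\xi^t_j$ times, where $\xi^t$ is the transposed partition of $\xi$. Then there is an isomorphism of $\mathfrak{gl}_r$-modules $$V(\xi)\cong\left(V_r^{\otimes n}\otimes\mathbb{C}\mathrm{PF}_n(\rho)\otimes\mathrm{Sign}\right)^{\Sigma_n},$$ where $\mathfrak{gl}_r$ acts on the left-hand side through $\mathfrak{gl}_r\otimes1\subset\mathfrak{gl}_r\otimes\mathbb{C}[x,y]$ and on the right-hand side through $V_r^{\otimes n}$, and $\mathrm{Sign}$ is the sign representation of the symmetric group $\Sigma_n$.
   Context: Parking functions: for a partition $\rho=(\rho_1\ge\dots\ge\rho_k\ge0)$, a function $f:\{1,\dots,n\}\to\{1,\dots,n\}$ is a $\rho$-parking function if $|f^{-1}(\{1,\dots,\rho_{k-s+1}\})|\ge s$ for $s=1,\dots,k$. $\mathrm{PF}_n(\rho)$ is the set of these; $\Sigma_n$ acts on it by permuting the domain, and $\mathbb{C}\mathrm{PF}_n(\rho)$ is the corresponding complex permutation representation. $\Sigma_n$ acts on $V_r^{\otimes n}$ by permuting tensor factors. $|\xi|=\sum_j\xi_j$ and $\xi^t_i=\#\{j:\xi_j\ge i\}$. Module $V(\xi)$: $\mathbb{C}\langle\mathcal{X},\mathcal{Y}\rangle$ is the associative algebra generated by $\mathcal{X},\mathcal{Y}$ with $\mathcal{Y}\mathcal{X}-\mathcal{X}\mathcal{Y}=\mathcal{X}$;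 it acts on $\mathbb{C}[x,x^{-1}]$ by $\mathcal{X}=x$, $\mathcal{Y}=x\,\partial/\partial x$, preserving each $x^N\mathbb{C}[x]$. $\mathcal{G}_r=\mathfrak{gl}_r\otimes\mathbb{C}\langle\mathcal{X},\mathcal{Y}\rangle$ (Lie algebra of matrices with the commutator). $V_r=\mathbb{C}^r$ is the vector representation with basis $u_1,\dots,u_r$; $V_r^{(N)}=V_r\otimes(\mathbb{C}[x,x^{-1}]/x^N\mathbb{C}[x])$ is a $\mathcal{G}_r$-module with basis $u_j^i=u_j\otimes x^i$, $i<N$. $v_\xi^{(N)}=\bigwedge_{j=1}^r\bigwedge_{i=N-\xi_j}^{N-1}u_j^i\in\bigwedge^{|\xi|}V_r^{(N)}$, $\mathcal{V}(\xi,N)=U(\mathcal{G}_r)v_\xi^{(N)}$. $F^n\mathcal{G}_r$ is the span of $g\otimes\mathcal{X}^i\mathcal{Y}^j$ with $g\in\mathfrak{gl}_r$, $j\le n$, so $\operatorname{gr}\mathcal{G}_r=\mathfrak{gl}_r\otimes\mathbb{C}[x,y]$; $U^{\le m}(\mathcal{G}_r)$ is the span of products $a_1\cdots a_k$ with $a_i\in F^{m_i}\mathcal{G}_r$, $\sum m_i\le m$; $F^m\mathcal{V}(\xi,N)=U^{\le m}(\mathcal{G}_r)v_\xi^{(N)}$. Then $V(\xi)=\bigoplus_mF^m\mathcal{V}(\xi,N)/F^{m-1}\mathcal{V}(\xi,N)$, a $\mathfrak{gl}_r\otimes\mathbb{C}[x,y]$-module which up to isomorphism does not depend on the integer $N$.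 *)

theory Defs
  imports "Jordan_Normal_Form.VS_Connect" "HOL-Algebra.AbelCoset" "HOL-Library.Poly_Mapping" "HOL-Combinatorics.Permutations"
begin

section \<open>Free complex vector spaces\<close>

text \<open>The free vector space on \<open>B\<close> consists of the finitely supported functions whose support is
  contained in \<open>B\<close>; the basis vector at \<open>b\<close> is \<open>bvec b\<close>.\<close>

definition scale :: "complex \<Rightarrow> ('b \<Rightarrow>\<^sub>0 complex) \<Rightarrow> ('b \<Rightarrow>\<^sub>0 complex)" where
  "scale c = Poly_Mapping.map ((*) c)"

abbreviation bvec :: "'b \<Rightarrow> ('b \<Rightarrow>\<^sub>0 complex)" where
  "bvec b \<equiv> Poly_Mapping.single b 1"

definition lin_ext :: "('b \<Rightarrow> ('c \<Rightarrow>\<^sub>0 complex)) \<Rightarrow> ('b \<Rightarrow>\<^sub>0 complex) \<Rightarrow> ('c \<Rightarrow>\<^sub>0 complex)" where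
  "lin_ext g t = (\<Sum>b\<in>Poly_Mapping.keys t. scale (Poly_Mapping.lookup t b) (g b))"

lemma lookup_scale [simp]: "Poly_Mapping.lookup (scale c t) b = c * Poly_Mapping.lookup t b"
  by (simp add: scale_def Poly_Mapping.map.rep_eq when_def)

lemma scale_add_right: "scale c (s + t) = scale c s + scale c t"
  by (rule poly_mapping_eqI) (simp add: lookup_add algebra_simps)

lemma scale_add_left: "scale (c + d) t = scale c t + scale d t"
  by (rule poly_mapping_eqI) (simp add: lookup_add algebra_simps)

lemma scale_scale: "scale c (scale d t) = scale (c * d) t"
  by (rule poly_mapping_eqI) simp

lemma scale_zero_left [simp]: "scale 0 t = 0"
  by (rule poly_mapping_eqI) simp

lemma scale_zero_right [simp]: "scale c 0 = 0"
  by (rule poly_mapping_eqI) simp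

lemma scale_one [simp]: "scale 1 t = t"
  by (rule poly_mapping_eqI) simp

lemma scale_sum: "scale c (\<Sum>a\<in>A. g a) = (\<Sum>a\<in>A. scale c (g a))"
  by (induction A rule: infinite_finite_induct) (auto simp: scale_add_right)

lemma scale_single: "scale c (Poly_Mapping.single b d) = Poly_Mapping.single b (c * d)"
  by (rule poly_mapping_eqI) (simp add: lookup_single when_def)

lemma lin_ext_superset:
  assumes "finite S" "Poly_Mapping.keys t \<subseteq> S"
  shows "lin_ext g t = (\<Sum>b\<in>S. scale (Poly_Mapping.lookup t b) (g b))"
  unfolding lin_ext_def
  by (rule sum.mono_neutral_left) (use assms in \<open>auto simp: in_keys_iff\<close>)

lemma lin_ext_add: "lin_ext g (s + t) = lin_ext g s + lin_ext g t"
proof -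
  let ?S = "Poly_Mapping.keys s \<union> Poly_Mapping.keys t"
  have "Poly_Mapping.keys (s + t) \<subseteq> ?S" by (rule keys_add)
  then show ?thesis
    by (simp add: lin_ext_superset[where S = ?S] lookup_add scale_add_left sum.distrib)
qed

lemma lin_ext_zero [simp]: "lin_ext g 0 = 0"
  by (simp add: lin_ext_def)

lemma lin_ext_scale: "lin_ext g (scale c t) = scale c (lin_ext g t)"
proof -
  have "Poly_Mapping.keys (scale c t) \<subseteq> Poly_Mapping.keys t" by (auto simp: in_keys_iff)
  then show ?thesis
    by (simp add: lin_ext_superset[where S = "Poly_Mapping.keys t"] scale_sum scale_scale)
qed

lemma lin_ext_single [simp]: "lin_ext g (Poly_Mapping.single b c) = scale c (g b)"
  by (simp add: lin_ext_def)

lemma lin_ext_uminus: "lin_ext g (- t) = - lin_ext g t"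
  using lin_ext_add[of g t "- t"] by (simp add: add_eq_0_iff)

lemma lin_ext_diff: "lin_ext g (s - t) = lin_ext g s - lin_ext g t"
  using lin_ext_add[of g s "- t"] by (simp add: lin_ext_uminus)

lemma poly_mapping_bvec_induct [case_names single add]:
  fixes t :: "'b \<Rightarrow>\<^sub>0 complex"
  assumes "\<And>b c. P (Poly_Mapping.single b c)" "\<And>s t. P s \<Longrightarrow> P t \<Longrightarrow> P (s + t)"
  shows "P t"
proof -
  have "finite A \<Longrightarrow> P (\<Sum>b\<in>A. Poly_Mapping.single b (Poly_Mapping.lookup t b))" for A
  proof (induction A rule: finite_induct)
    case empty
    show ?case using assms(1)[of undefined 0] by simp
  qed (simp add: assms)
  then have "P (\<Sum>b\<in>Poly_Mapping.keys t. Poly_Mapping.single b (Poly_Mapping.lookup t b))" by simp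
  moreover have "(\<Sum>b\<in>Poly_Mapping.keys t. Poly_Mapping.single b (Poly_Mapping.lookup t b)) = t"
    by (rule poly_mapping_eqI) (simp add: lookup_sum lookup_single when_def in_keys_iff)
  ultimately show ?thesis by simp
qed

section \<open>The algebra generated by \<open>\<X>\<close> and \<open>\<Y>\<close> with \<open>\<Y>\<X> - \<X>\<Y> = \<X>\<close>\<close>

datatype letter = LX | LY

datatype word = Word "letter list"

instantiation word :: monoid_add
begin

definition zero_word :: word where "0 = Word []"

fun plus_word :: "word \<Rightarrow> word \<Rightarrow> word" where
  "Word u + Word v = Word (u @ v)"

instance
proof
  fix a b c :: word
  show "a + b + c = a + (b + c)" by (cases a; cases b; cases c) simp
  show "0 + a = a" by (cases a) (simp add: zero_word_def)
  show "a + 0 = a" by (cases a) (simp add: zero_word_def)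
qed

end

text \<open>The multiplication of \<open>word \<Rightarrow>\<^sub>0 complex\<close> is convolution, so this type is the free
  associative algebra on the two letters.\<close>

text \<open>Laurent polynomials form the type \<open>int \<Rightarrow>\<^sub>0 complex\<close>, with \<open>x ^ i\<close> represented by \<open>bvec i\<close>.
  \<open>free_act\<close> is the action of the free algebra given by \<open>\<X> \<mapsto> x\<close>, \<open>\<Y> \<mapsto> x \<partial>/\<partial>x\<close>.\<close>

definition laurent_deriv :: "(int \<Rightarrow>\<^sub>0 complex) \<Rightarrow> (int \<Rightarrow>\<^sub>0 complex)" where
  "laurent_deriv = lin_ext (\<lambda>i. Poly_Mapping.single (i - 1) (of_int i))"

fun letter_act :: "letter \<Rightarrow> (int \<Rightarrow>\<^sub>0 complex) \<Rightarrow> (int \<Rightarrow>\<^sub>0 complex)" where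
  "letter_act LX f = bvec 1 * f"
| "letter_act LY f = bvec 1 * laurent_deriv f"

fun word_act :: "word \<Rightarrow> (int \<Rightarrow>\<^sub>0 complex) \<Rightarrow> (int \<Rightarrow>\<^sub>0 complex)" where
  "word_act (Word ls) f = foldr letter_act ls f"

definition free_act :: "(word \<Rightarrow>\<^sub>0 complex) \<Rightarrow> (int \<Rightarrow>\<^sub>0 complex) \<Rightarrow> (int \<Rightarrow>\<^sub>0 complex)" where
  "free_act p f = lin_ext (\<lambda>w. word_act w f) p"

lemma scale_mult_right: "g * scale c f = scale c (g * f)" for f g :: "int \<Rightarrow>\<^sub>0 complex"
proof -
  have sc: "scale c h = Poly_Mapping.single 0 c * h" for h :: "int \<Rightarrow>\<^sub>0 complex"
    by (induction h rule: poly_mapping_bvec_induct)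
      (simp_all add: scale_add_right distrib_left scale_scale scale_single mult_single)
  show ?thesis by (simp add: sc mult.left_commute)
qed

lemma letter_act_add: "letter_act l (f + g) = letter_act l f + letter_act l g"
  by (cases l) (simp_all add: laurent_deriv_def lin_ext_add distrib_left)

lemma letter_act_scale: "letter_act l (scale c f) = scale c (letter_act l f)"
  by (cases l) (simp_all add: laurent_deriv_def lin_ext_scale scale_mult_right)

lemma word_act_add: "word_act w (f + g) = word_act w f + word_act w g"
proof (cases w)
  case (Word ls)
  have "foldr letter_act ls (f + g) = foldr letter_act ls f + foldr letter_act ls g"
    by (induction ls) (simp_all add: letter_act_add)
  then show ?thesis using Word by simp
qed

lemma word_act_scale: "word_act w (scale c f) = scale c (word_act w f)"
proof (cases w)
  case (Word ls)
  have "foldr letter_act ls (scale c f) = scale c (foldr letter_act ls f)"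
    by (induction ls) (simp_all add: letter_act_scale)
  then show ?thesis using Word by simp
qed

lemma word_act_plus: "word_act (v + w) f = word_act v (word_act w f)"
  by (cases v; cases w) simp

lemma free_act_add_left: "free_act (p + q) f = free_act p f + free_act q f"
  by (simp add: free_act_def lin_ext_add)

lemma free_act_diff_left: "free_act (p - q) f = free_act p f - free_act q f"
  by (simp add: free_act_def lin_ext_diff)

lemma free_act_add_right: "free_act p (f + g) = free_act p f + free_act p g"
  by (simp add: free_act_def lin_ext_def word_act_add scale_add_right sum.distrib)

lemma free_act_scale_right: "free_act p (scale c f) = scale c (free_act p f)"
  by (simp add: free_act_def lin_ext_def word_act_scale scale_sum scale_scale mult.commute)

lemma free_act_single: "free_act (Poly_Mapping.single w c) f = scale c (word_act w f)"
  by (simp add: free_act_def)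

lemma free_act_mult: "free_act (p * q) f = free_act p (free_act q f)"
proof (induction p rule: poly_mapping_bvec_induct)
  case (single v c)
  show ?case
  proof (induction q rule: poly_mapping_bvec_induct)
    case (single w d)
    show ?case
      by (simp add: mult_single free_act_single word_act_plus word_act_scale scale_scale)
  qed (simp_all add: distrib_left free_act_add_left free_act_add_right)
qed (simp add: distrib_right free_act_add_left)

lemma free_act_relator:
  "free_act (bvec (Word [LY]) * bvec (Word [LX]) - bvec (Word [LX]) * bvec (Word [LY])
     - bvec (Word [LX])) f = 0"
proof (induction f rule: poly_mapping_bvec_induct)
  case (single i c)
  have "Poly_Mapping.single (1 + i) (c * of_int (1 + i)) =
      Poly_Mapping.single (1 + i) c + Poly_Mapping.single (1 + i) (c * of_int i)"
    by (simp only: single_add[symmetric]) (simp add: algebra_simps)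
  then show ?case
    by (simp add: free_act_diff_left free_act_mult free_act_single laurent_deriv_def mult_single
        scale_single word_act_plus del: plus_word.simps)
qed (simp add: free_act_add_right)

inductive_set xy_ideal :: "(word \<Rightarrow>\<^sub>0 complex) set" where
  zero: "0 \<in> xy_ideal"
| relator: "p * (bvec (Word [LY]) * bvec (Word [LX]) - bvec (Word [LX]) * bvec (Word [LY])
      - bvec (Word [LX])) * q \<in> xy_ideal"
| add: "a \<in> xy_ideal \<Longrightarrow> b \<in> xy_ideal \<Longrightarrow> a + b \<in> xy_ideal"

lemma xy_ideal_mult_left: "a \<in> xy_ideal \<Longrightarrow> s * a \<in> xy_ideal"
proof (induction rule: xy_ideal.induct)
  case (relator p q)
  show ?case using xy_ideal.relator[of "s * p" q] by (simp add: mult.assoc)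
qed (auto simp: distrib_left intro: xy_ideal.intros)

lemma xy_ideal_mult_right: "a \<in> xy_ideal \<Longrightarrow> a * s \<in> xy_ideal"
proof (induction rule: xy_ideal.induct)
  case (relator p q)
  show ?case using xy_ideal.relator[of p "q * s"] by (simp add: mult.assoc)
qed (auto simp: distrib_right intro: xy_ideal.intros)

lemma xy_ideal_uminus: "a \<in> xy_ideal \<Longrightarrow> - a \<in> xy_ideal"
  using xy_ideal_mult_left[of a "- 1"] by simp

lemma xy_ideal_diff: "a \<in> xy_ideal \<Longrightarrow> b \<in> xy_ideal \<Longrightarrow> a - b \<in> xy_ideal"
  using xy_ideal.add[of a "- b"] xy_ideal_uminus[of b] by simp

lemma free_act_xy_ideal: "a \<in> xy_ideal \<Longrightarrow> free_act a f = 0"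
proof (induction arbitrary: f rule: xy_ideal.induct)
  case zero
  show ?case by (simp add: free_act_def)
next
  case (relator p q)
  have "free_act p 0 = 0" using free_act_scale_right[of p 0 0] by simp
  then show ?case by (simp only: free_act_mult free_act_relator)
next
  case (add a b)
  then show ?case by (simp add: free_act_add_left)
qed

definition xy_rel :: "(word \<Rightarrow>\<^sub>0 complex) \<Rightarrow> (word \<Rightarrow>\<^sub>0 complex) \<Rightarrow> bool" where
  "xy_rel p q \<longleftrightarrow> p - q \<in> xy_ideal"

quotient_type xy_alg = "word \<Rightarrow>\<^sub>0 complex" / xy_rel
proof (rule equivpI)
  show "reflp xy_rel" by (auto simp: reflp_def xy_rel_def xy_ideal.zero)
  show "symp xy_rel"
    by (rule sympI) (metis xy_rel_def minus_diff_eq xy_ideal_uminus)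
  show "transp xy_rel"
  proof (rule transpI)
    fix a b c assume "xy_rel a b" "xy_rel b c"
    then show "xy_rel a c"
      using xy_ideal.add[of "a - b" "b - c"] by (simp add: xy_rel_def)
  qed
qed

instantiation xy_alg :: ring_1
begin

lift_definition zero_xy_alg :: xy_alg is 0 .
lift_definition one_xy_alg :: xy_alg is 1 .

lift_definition plus_xy_alg :: "xy_alg \<Rightarrow> xy_alg \<Rightarrow> xy_alg" is "(+)"
proof -
  fix a b c d assume "xy_rel a b" "xy_rel c d"
  then show "xy_rel (a + c) (b + d)"
    using xy_ideal.add[of "a - b" "c - d"] by (simp add: xy_rel_def algebra_simps)
qed

lift_definition uminus_xy_alg :: "xy_alg \<Rightarrow> xy_alg" is uminus
proof -
  fix a b assume "xy_rel a b"
  then show "xy_rel (- a) (- b)"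
    using xy_ideal_uminus[of "a - b"] by (simp add: xy_rel_def)
qed

lift_definition minus_xy_alg :: "xy_alg \<Rightarrow> xy_alg \<Rightarrow> xy_alg" is "(-)"
proof -
  fix a b c d assume "xy_rel a b" "xy_rel c d"
  then show "xy_rel (a - c) (b - d)"
    using xy_ideal_diff[of "a - b" "c - d"] by (simp add: xy_rel_def algebra_simps)
qed

lift_definition times_xy_alg :: "xy_alg \<Rightarrow> xy_alg \<Rightarrow> xy_alg" is "(*)"
proof -
  fix a b c d assume "xy_rel a b" "xy_rel c d"
  then have "(a - b) * c + b * (c - d) \<in> xy_ideal"
    by (intro xy_ideal.add xy_ideal_mult_left xy_ideal_mult_right) (simp_all add: xy_rel_def)
  then show "xy_rel (a * c) (b * d)"
    by (simp add: xy_rel_def algebra_simps)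
qed

instance
proof
  fix a b c :: xy_alg
  show "a + b + c = a + (b + c)" by transfer (simp add: xy_rel_def xy_ideal.zero add.assoc)
  show "a + b = b + a" by transfer (simp add: xy_rel_def xy_ideal.zero add.commute)
  show "0 + a = a" by transfer (simp add: xy_rel_def xy_ideal.zero)
  show "- a + a = 0" by transfer (simp add: xy_rel_def xy_ideal.zero)
  show "a - b = a + - b" by transfer (simp add: xy_rel_def xy_ideal.zero)
  show "a * b * c = a * (b * c)" by transfer (simp add: xy_rel_def xy_ideal.zero mult.assoc)
  show "1 * a = a" by transfer (simp add: xy_rel_def xy_ideal.zero)
  show "a * 1 = a" by transfer (simp add: xy_rel_def xy_ideal.zero)
  show "(a + b) * c = a * c + b * c"
    by transfer (simp add: xy_rel_def xy_ideal.zero distrib_right)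
  show "a * (b + c) = a * b + a * c"
    by transfer (simp add: xy_rel_def xy_ideal.zero distrib_left)
  show "(0::xy_alg) \<noteq> 1"
  proof
    assume "(0::xy_alg) = 1"
    then have "- 1 \<in> xy_ideal" by transfer (simp add: xy_rel_def)
    then have "free_act 1 (bvec 0) = 0"
      using free_act_xy_ideal[OF xy_ideal_uminus] by fastforce
    then show False
      by (simp add: free_act_single zero_word_def flip: single_one)
         (metis lookup_single_eq lookup_zero zero_neq_one)
  qed
qed

end

lift_definition xy_const :: "complex \<Rightarrow> xy_alg" is "\<lambda>c. Poly_Mapping.single 0 c" .
lift_definition xy_X :: xy_alg is "bvec (Word [LX])" .
lift_definition xy_Y :: xy_alg is "bvec (Word [LY])" .

lemma xy_relation: "xy_Y * xy_X - xy_X * xy_Y = xy_X"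
proof transfer
  show "xy_rel (bvec (Word [LY]) * bvec (Word [LX]) - bvec (Word [LX]) * bvec (Word [LY]))
     (bvec (Word [LX]))"
    using xy_ideal.relator[of 1 1] by (simp add: xy_rel_def)
qed

lift_definition xy_act :: "xy_alg \<Rightarrow> (int \<Rightarrow>\<^sub>0 complex) \<Rightarrow> (int \<Rightarrow>\<^sub>0 complex)" is free_act
proof
  fix p q f assume "xy_rel p q"
  then show "free_act p f = free_act q f"
    using free_act_xy_ideal[of "p - q" f] by (simp add: xy_rel_def free_act_diff_left)
qed

lemma xy_act_X: "xy_act xy_X f = bvec 1 * f"
  by transfer (simp add: free_act_single)

lemma xy_act_Y: "xy_act xy_Y f = bvec 1 * laurent_deriv f"
  by transfer (simp add: free_act_single)

lemma xy_act_mult: "xy_act (a * b) f = xy_act a (xy_act b f)"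
  by transfer (rule free_act_mult)

section \<open>Vector spaces with a set of operators\<close>

text \<open>Complex vector spaces are HOL-Algebra modules over \<open>class_ring\<close>; the ring operations
  \<open>mult\<close> and \<open>one\<close> contained in the record play no role.\<close>

record ('g, 'v) rep = "(complex, 'v) module" +
  act :: "'g \<Rightarrow> 'v \<Rightarrow> 'v"

locale gl_module = Module.module "class_ring :: complex ring" M
  for r :: nat and M :: "(complex mat, 'v) rep" (structure) +
  assumes act_closed:
      "\<lbrakk>A \<in> carrier_mat r r; x \<in> carrier M\<rbrakk> \<Longrightarrow> act M A x \<in> carrier M"
    and act_add:
      "\<lbrakk>A \<in> carrier_mat r r; x \<in> carrier M; y \<in> carrier M\<rbrakk> \<Longrightarrow>
        act M A (x \<oplus> y) = act M A x \<oplus> act M A y"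
    and act_smult:
      "\<lbrakk>A \<in> carrier_mat r r; x \<in> carrier M\<rbrakk> \<Longrightarrow> act M A (c \<odot> x) = c \<odot> act M A x"
    and add_act:
      "\<lbrakk>A \<in> carrier_mat r r; B \<in> carrier_mat r r; x \<in> carrier M\<rbrakk> \<Longrightarrow>
        act M (A + B) x = act M A x \<oplus> act M B x"
    and smult_act:
      "\<lbrakk>A \<in> carrier_mat r r; x \<in> carrier M\<rbrakk> \<Longrightarrow> act M (c \<cdot>\<^sub>m A) x = c \<odot> act M A x"
    and bracket_act:
      "\<lbrakk>A \<in> carrier_mat r r; B \<in> carrier_mat r r; x \<in> carrier M\<rbrakk> \<Longrightarrow>
        act M (A * B - B * A) x = act M A (act M B x) \<ominus> act M B (act M A x)"

definition gl_isomorphic ::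
    "nat \<Rightarrow> (complex mat, 'v) rep \<Rightarrow> (complex mat, 'w) rep \<Rightarrow> bool" where
  "gl_isomorphic r M M' \<longleftrightarrow> gl_module r M \<and> gl_module r M' \<and>
    (\<exists>\<phi> \<in> LinearCombinations.module_hom class_ring M M'. bij_betw \<phi> (carrier M) (carrier M') \<and>
      (\<forall>A \<in> carrier_mat r r. \<forall>x \<in> carrier M. \<phi> (act M A x) = act M' A (\<phi> x)))"

definition free_rep ::
    "'b set \<Rightarrow> ('g \<Rightarrow> ('b \<Rightarrow>\<^sub>0 complex) \<Rightarrow> ('b \<Rightarrow>\<^sub>0 complex)) \<Rightarrow> ('g, 'b \<Rightarrow>\<^sub>0 complex) rep" where
  "free_rep B \<alpha> = \<lparr>carrier = {t. Poly_Mapping.keys t \<subseteq> B}, mult = undefined, one = undefined,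
    zero = 0, add = (+), smult = scale, act = \<alpha>\<rparr>"

definition sub_rep :: "('g, 'v) rep \<Rightarrow> 'v set \<Rightarrow> ('g, 'v) rep" where
  "sub_rep M U = M\<lparr>carrier := U\<rparr>"

text \<open>The operations on cosets follow the pattern of \<open>rcoset_mult\<close>.\<close>

definition quot_rep :: "('g, 'v) rep \<Rightarrow> 'v set \<Rightarrow> ('g, 'v set) rep" where
  "quot_rep M U = \<lparr>carrier = {U +>\<^bsub>M\<^esub> x |x. x \<in> carrier M}, mult = undefined, one = undefined,
    zero = U, add = (\<lambda>C D. C <+>\<^bsub>M\<^esub> D),
    smult = (\<lambda>c C. \<Union>x\<in>C. U +>\<^bsub>M\<^esub> (c \<odot>\<^bsub>M\<^esub> x)),
    act = (\<lambda>g C. \<Union>x\<in>C. U +>\<^bsub>M\<^esub> act M g x)\<rparr>"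

definition direct_sum_rep :: "(nat \<Rightarrow> ('g, 'v) rep) \<Rightarrow> ('g, nat \<Rightarrow> 'v) rep" where
  "direct_sum_rep M = \<lparr>
    carrier = {x. (\<forall>m. x m \<in> carrier (M m)) \<and> finite {m. x m \<noteq> \<zero>\<^bsub>M m\<^esub>}},
    mult = undefined, one = undefined,
    zero = (\<lambda>m. \<zero>\<^bsub>M m\<^esub>), add = (\<lambda>x y m. x m \<oplus>\<^bsub>M m\<^esub> y m),
    smult = (\<lambda>c x m. c \<odot>\<^bsub>M m\<^esub> x m), act = (\<lambda>g x m. act (M m) g (x m))\<rparr>"

definition pullback_rep :: "('h \<Rightarrow> 'g) \<Rightarrow> ('g, 'v) rep \<Rightarrow> ('h, 'v) rep" where
  "pullback_rep h M = \<lparr>carrier = carrier M, mult = mult M, one = one M, zero = zero M,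
    add = add M, smult = smult M, act = (\<lambda>g. act M (h g))\<rparr>"

abbreviation span_rep :: "('g, 'v) rep \<Rightarrow> 'v set \<Rightarrow> 'v set" where
  "span_rep M \<equiv> LinearCombinations.module.span class_ring M"

section \<open>Tensor and exterior powers\<close>

text \<open>Let \<open>W\<close> be the free vector space on \<open>B\<close>. Its \<open>n\<close>-th tensor power is the free vector space
  on the functions \<open>w : {1..n} \<rightarrow> B\<close>, where \<open>w\<close> stands for \<open>w 1 \<otimes> \<dots> \<otimes> w n\<close>. An operator on
  \<open>W\<close> acts on it by the Leibniz rule.\<close>

definition tensor_act ::
    "nat \<Rightarrow> ('g \<Rightarrow> ('b \<Rightarrow>\<^sub>0 complex) \<Rightarrow> ('b \<Rightarrow>\<^sub>0 complex)) \<Rightarrow>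
      'g \<Rightarrow> ((nat \<Rightarrow> 'b) \<Rightarrow>\<^sub>0 complex) \<Rightarrow> ((nat \<Rightarrow> 'b) \<Rightarrow>\<^sub>0 complex)" where
  "tensor_act n \<alpha> g =
    lin_ext (\<lambda>w. \<Sum>i\<in>{1..n}. lin_ext (\<lambda>b. bvec (w(i := b))) (\<alpha> g (bvec (w i))))"

definition tensor_power ::
    "nat \<Rightarrow> 'b set \<Rightarrow> ('g \<Rightarrow> ('b \<Rightarrow>\<^sub>0 complex) \<Rightarrow> ('b \<Rightarrow>\<^sub>0 complex)) \<Rightarrow>
      ('g, (nat \<Rightarrow> 'b) \<Rightarrow>\<^sub>0 complex) rep" where
  "tensor_power n B \<alpha> = free_rep ({1..n} \<rightarrow>\<^sub>E B) (tensor_act n \<alpha>)"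

text \<open>\<open>pure_tensor n v\<close> is the multilinear expansion of \<open>v 1 \<otimes> \<dots> \<otimes> v n\<close>.\<close>

definition pure_tensor :: "nat \<Rightarrow> (nat \<Rightarrow> ('b \<Rightarrow>\<^sub>0 complex)) \<Rightarrow> ((nat \<Rightarrow> 'b) \<Rightarrow>\<^sub>0 complex)" where
  "pure_tensor n v = (\<Sum>w \<in> (\<Pi>\<^sub>E i\<in>{1..n}. Poly_Mapping.keys (v i)).
    Poly_Mapping.single w (\<Prod>i\<in>{1..n}. Poly_Mapping.lookup (v i) (w i)))"

definition alt_relations ::
    "nat \<Rightarrow> 'b set \<Rightarrow> ('g \<Rightarrow> ('b \<Rightarrow>\<^sub>0 complex) \<Rightarrow> ('b \<Rightarrow>\<^sub>0 complex)) \<Rightarrow> ((nat \<Rightarrow> 'b) \<Rightarrow>\<^sub>0 complex) set" where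
  "alt_relations n B \<alpha> = span_rep (tensor_power n B \<alpha>)
    {pure_tensor n v |v. (\<forall>i\<in>{1..n}. Poly_Mapping.keys (v i) \<subseteq> B) \<and>
      (\<exists>i\<in>{1..n}. \<exists>j\<in>{1..n}. i \<noteq> j \<and> v i = v j)}"

definition exterior_power ::
    "nat \<Rightarrow> 'b set \<Rightarrow> ('g \<Rightarrow> ('b \<Rightarrow>\<^sub>0 complex) \<Rightarrow> ('b \<Rightarrow>\<^sub>0 complex)) \<Rightarrow>
      ('g, ((nat \<Rightarrow> 'b) \<Rightarrow>\<^sub>0 complex) set) rep" where
  "exterior_power n B \<alpha> = quot_rep (tensor_power n B \<alpha>) (alt_relations n B \<alpha>)"

definition wedge ::
    "nat \<Rightarrow> 'b set \<Rightarrow> ('g \<Rightarrow> ('b \<Rightarrow>\<^sub>0 complex) \<Rightarrow> ('b \<Rightarrow>\<^sub>0 complex)) \<Rightarrow>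
      (nat \<Rightarrow> ('b \<Rightarrow>\<^sub>0 complex)) \<Rightarrow> ((nat \<Rightarrow> 'b) \<Rightarrow>\<^sub>0 complex) set" where
  "wedge n B \<alpha> v = alt_relations n B \<alpha> +>\<^bsub>tensor_power n B \<alpha>\<^esub> pure_tensor n v"

section \<open>The module \<open>V(\<xi>)\<close>\<close>

text \<open>A partition \<open>\<xi>\<^sub>1 \<ge> \<dots> \<ge> \<xi>\<^sub>r \<ge> 0\<close> is a list of length \<open>r\<close>, so \<open>\<xi>\<^sub>j\<close> is \<open>\<xi> ! (j - 1)\<close>.
  Vectors \<open>u\<^sub>1, \<dots>, u\<^sub>r\<close> and rows and columns of matrices are likewise numbered from \<open>0\<close>.\<close>

definition transposed_part :: "nat list \<Rightarrow> nat \<Rightarrow> nat" where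
  "transposed_part \<xi> i = card {j. j < length \<xi> \<and> i \<le> \<xi> ! j}"

text \<open>\<open>\<G>\<^sub>r\<close> is \<open>carrier_mat r r :: xy_alg mat set\<close>, and \<open>gl_tensor g a\<close> is \<open>g \<otimes> a\<close>.\<close>

definition gl_tensor :: "complex mat \<Rightarrow> xy_alg \<Rightarrow> xy_alg mat" where
  "gl_tensor g a = map_mat (\<lambda>c. xy_const c * a) g"

text \<open>\<open>F\<^sup>n\<G>\<^sub>r\<close>. No closure under scalars is needed, as these are absorbed by \<open>g\<close>.\<close>

inductive_set G_filt :: "nat \<Rightarrow> nat \<Rightarrow> xy_alg mat set" for r n where
  zero: "0\<^sub>m r r \<in> G_filt r n"
| add: "\<lbrakk>A \<in> G_filt r n; g \<in> carrier_mat r r; j \<le> n\<rbrakk> \<Longrightarrow>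
    A + gl_tensor g (xy_X ^ i * xy_Y ^ j) \<in> G_filt r n"

text \<open>The quotient of \<open>\<complex>[x,x\<^sup>-\<^sup>1]\<close> by \<open>x\<^sup>N\<complex>[x]\<close> is identified with the span of the \<open>x\<^sup>i\<close>, \<open>i < N\<close>, and
  \<open>laurent_trunc N k f\<close> is \<open>u\<^sub>k\<close> tensor the class of \<open>f\<close>. The pair \<open>(j, i)\<close> stands for \<open>u\<^sub>j \<otimes> x\<^sup>i\<close>.\<close>

definition laurent_trunc :: "int \<Rightarrow> nat \<Rightarrow> (int \<Rightarrow>\<^sub>0 complex) \<Rightarrow> (nat \<times> int \<Rightarrow>\<^sub>0 complex)" where
  "laurent_trunc N k = lin_ext (\<lambda>i. if i < N then bvec (k, i) else 0)"

definition VN_basis :: "nat \<Rightarrow> int \<Rightarrow> (nat \<times> int) set" where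
  "VN_basis r N = {..<r} \<times> {..<N}"

definition VN_act ::
    "nat \<Rightarrow> int \<Rightarrow> xy_alg mat \<Rightarrow> (nat \<times> int \<Rightarrow>\<^sub>0 complex) \<Rightarrow> (nat \<times> int \<Rightarrow>\<^sub>0 complex)" where
  "VN_act r N A =
    lin_ext (\<lambda>(j, i). \<Sum>k<r. laurent_trunc N k (xy_act (A $$ (k, j)) (bvec i)))"

definition Lambda_VN ::
    "nat \<Rightarrow> int \<Rightarrow> nat \<Rightarrow> (xy_alg mat, ((nat \<Rightarrow> nat \<times> int) \<Rightarrow>\<^sub>0 complex) set) rep" where
  "Lambda_VN r N n = exterior_power n (VN_basis r N) (VN_act r N)"

definition v_factors :: "nat list \<Rightarrow> int \<Rightarrow> (nat \<times> int) list" where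
  "v_factors \<xi> N =
    concat (map (\<lambda>j. map (\<lambda>i. (j, i)) [N - int (\<xi> ! j)..N - 1]) [0..<length \<xi>])"

definition v_vec :: "nat list \<Rightarrow> int \<Rightarrow> ((nat \<Rightarrow> nat \<times> int) \<Rightarrow>\<^sub>0 complex) set" where
  "v_vec \<xi> N = wedge (sum_list \<xi>) (VN_basis (length \<xi>) N) (VN_act (length \<xi>) N)
    (\<lambda>i. bvec (v_factors \<xi> N ! (i - 1)))"

text \<open>\<open>F_span r M v m\<close> is \<open>U\<^sup>\<le>\<^sup>m(\<G>\<^sub>r) v\<close>, a product \<open>a\<^sub>1 \<cdots> a\<^sub>k\<close> in the enveloping algebra acting
  by the composition of the \<open>a\<^sub>i\<close>.\<close>

definition F_span :: "nat \<Rightarrow> (xy_alg mat, 'v) rep \<Rightarrow> 'v \<Rightarrow> nat \<Rightarrow> 'v set" where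
  "F_span r M v m = span_rep M {foldr (act M) as v |as ms.
    list_all2 (\<lambda>a k. a \<in> G_filt r k) as ms \<and> sum_list ms \<le> m}"

definition assoc_graded ::
    "nat \<Rightarrow> (xy_alg mat, 'v) rep \<Rightarrow> 'v \<Rightarrow> (xy_alg mat, nat \<Rightarrow> 'v set) rep" where
  "assoc_graded r M v = direct_sum_rep (\<lambda>m. quot_rep (sub_rep M (F_span r M v m))
    (if m = 0 then {\<zero>\<^bsub>M\<^esub>} else F_span r M v (m - 1)))"

text \<open>Only the action of \<open>\<gg>\<ll>\<^sub>r \<otimes> 1 \<subseteq> F\<^sup>0\<G>\<^sub>r\<close>, which preserves each \<open>F\<^sup>m\<close>, is retained.\<close>

definition V_mod ::
    "nat list \<Rightarrow> int \<Rightarrow> (complex mat, nat \<Rightarrow> ((nat \<Rightarrow> nat \<times> int) \<Rightarrow>\<^sub>0 complex) set set) rep" where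
  "V_mod \<xi> N = pullback_rep (\<lambda>g. gl_tensor g 1)
    (assoc_graded (length \<xi>) (Lambda_VN (length \<xi>) N (sum_list \<xi>)) (v_vec \<xi> N))"

section \<open>Parking functions\<close>

definition parking_functions :: "nat \<Rightarrow> nat list \<Rightarrow> (nat \<Rightarrow> nat) set" where
  "parking_functions n \<rho> = {f \<in> {1..n} \<rightarrow>\<^sub>E {1..n}.
    \<forall>s\<in>{1..length \<rho>}. s \<le> card {i \<in> {1..n}. f i \<in> {1..\<rho> ! (length \<rho> - s)}}}"

definition gl_act :: "nat \<Rightarrow> complex mat \<Rightarrow> (nat \<Rightarrow>\<^sub>0 complex) \<Rightarrow> (nat \<Rightarrow>\<^sub>0 complex)" where
  "gl_act r A = lin_ext (\<lambda>j. \<Sum>k<r. Poly_Mapping.single k (A $$ (k, j)))"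

text \<open>A pair \<open>(w, f)\<close> stands for the basis vector \<open>w \<otimes> f \<otimes> 1\<close> of
  \<open>V\<^sub>r\<^sup>\<otimes>\<^sup>n \<otimes> \<complex>PF\<^sub>n(\<rho>) \<otimes> Sign\<close>.\<close>

definition tensor_PF_gl_act ::
    "nat \<Rightarrow> nat \<Rightarrow> complex mat \<Rightarrow>
      ((nat \<Rightarrow> nat) \<times> (nat \<Rightarrow> nat) \<Rightarrow>\<^sub>0 complex) \<Rightarrow> ((nat \<Rightarrow> nat) \<times> (nat \<Rightarrow> nat) \<Rightarrow>\<^sub>0 complex)" where
  "tensor_PF_gl_act r n A =
    lin_ext (\<lambda>(w, f). lin_ext (\<lambda>w'. bvec (w', f)) (tensor_act n (gl_act r) A (bvec w)))"

definition tensor_PF_perm_act ::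
    "(nat \<Rightarrow> nat) \<Rightarrow>
      ((nat \<Rightarrow> nat) \<times> (nat \<Rightarrow> nat) \<Rightarrow>\<^sub>0 complex) \<Rightarrow> ((nat \<Rightarrow> nat) \<times> (nat \<Rightarrow> nat) \<Rightarrow>\<^sub>0 complex)" where
  "tensor_PF_perm_act \<sigma> =
    lin_ext (\<lambda>(w, f). Poly_Mapping.single (w \<circ> inv_into UNIV \<sigma>, f \<circ> inv_into UNIV \<sigma>) (of_int (sign \<sigma>)))"

definition tensor_PF ::
    "nat \<Rightarrow> nat \<Rightarrow> nat list \<Rightarrow> (complex mat, (nat \<Rightarrow> nat) \<times> (nat \<Rightarrow> nat) \<Rightarrow>\<^sub>0 complex) rep" where
  "tensor_PF r n \<rho> =
    free_rep (({1..n} \<rightarrow>\<^sub>E {..<r}) \<times> parking_functions n \<rho>) (tensor_PF_gl_act r n)"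

definition tensor_PF_invariants ::
    "nat \<Rightarrow> nat \<Rightarrow> nat list \<Rightarrow> (complex mat, (nat \<Rightarrow> nat) \<times> (nat \<Rightarrow> nat) \<Rightarrow>\<^sub>0 complex) rep" where
  "tensor_PF_invariants r n \<rho> = sub_rep (tensor_PF r n \<rho>)
    {t \<in> carrier (tensor_PF r n \<rho>). \<forall>\<sigma>. \<sigma> permutes {1..n} \<longrightarrow> tensor_PF_perm_act \<sigma> t = t}"

end

theory Submission
  imports Defs
begin

text \<open>
  Both sides can be realised as one and the same space of antisymmetric tensors.

  The antisymmetriser identifies \<open>\<Lambda>\<^sup>n V\<^sub>r\<^bsup>(N)\<^esup>\<close> with the antisymmetric tensors, its kernel being the
  span of the alternating relations (\<open>Alt_eq_zero_iff\<close>). Under this identification \<open>v\<^sub>\<xi>\<close> is the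
  antisymmetrisation of a basis tensor in which exactly \<open>\<Sum>\<^sub>j min \<xi>\<^sub>j s\<close> factors have \<open>x\<close>-degree at least
  \<open>N - s\<close>, for each \<open>s\<close>. The operators \<open>g \<otimes> \<X>\<^sup>p\<Y>\<^sup>q\<close> never lower a degree. Conversely, \<open>\<Y>\<close> has distinct
  eigenvalues on factors of distinct degrees, so a Vandermonde argument isolates the effect on a
  single factor, which can thus be replaced by any basis vector of at least the same degree
  (\<open>move_one_factor\<close>). An exchange argument on sets then shows that the module generated by \<open>v\<^sub>\<xi>\<close> is
  spanned by the antisymmetrisations of all basis tensors with at least \<open>\<Sum>\<^sub>j min \<xi>\<^sub>j s\<close> factors of degree
  at least \<open>N - s\<close>, for each \<open>s\<close> (\<open>filt_span_Union\<close>).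

  Write the degrees of the factors of such a tensor as \<open>N - f 1, \<dots>, N - f n\<close>. Since
  \<open>\<Sum>\<^sub>j min \<xi>\<^sub>j s = \<xi>\<^sup>t\<^sub>1 + \<dots> + \<xi>\<^sup>t\<^sub>s\<close> is the number of parts of \<open>\<rho>\<close> that are at most \<open>s\<close>, the condition on the
  degrees says that \<open>f\<close> is a \<open>\<rho>\<close>-parking function (\<open>parking_functions_iff\<close>), and antisymmetry of the
  tensor becomes invariance under \<open>\<Sigma>\<^sub>n\<close> after the twist by \<open>Sign\<close> (\<open>bij_betw_relabel\<close>).

  It remains to compare \<open>\<V>(\<xi>,N)\<close> with its associated graded module. For the Hermitian form in which
  the basis tensors are orthonormal, the adjoint of \<open>g \<in> \<gg>\<ll>\<^sub>r\<close> acts as the conjugate transpose of \<open>g\<close>.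
  Hence the orthogonal complement of \<open>F\<^sup>m\<^sup>-\<^sup>1\<close> in \<open>F\<^sup>m\<close> is stable under \<open>\<gg>\<ll>\<^sub>r\<close>, and it is isomorphic to the
  \<open>m\<close>-th graded piece. The sum of these complements over all \<open>m\<close> is \<open>\<V>(\<xi>,N)\<close>
  (\<open>graded_linear_model\<close>).
\<close>

section \<open>Free complex vector spaces\<close>

global_interpretation pm: vector_space "scale :: complex \<Rightarrow> ('b \<Rightarrow>\<^sub>0 complex) \<Rightarrow> _"
  by unfold_locales (simp_all add: scale_add_right scale_add_left scale_scale)

definition pm_linear :: "(('b \<Rightarrow>\<^sub>0 complex) \<Rightarrow> ('c \<Rightarrow>\<^sub>0 complex)) \<Rightarrow> bool" where
  "pm_linear f \<longleftrightarrow> (\<forall>x y. f (x + y) = f x + f y) \<and> (\<forall>c x. f (scale c x) = scale c (f x))"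

lemma pm_linearI:
  "\<lbrakk>\<And>x y. f (x + y) = f x + f y; \<And>c x. f (scale c x) = scale c (f x)\<rbrakk> \<Longrightarrow> pm_linear f"
  by (simp add: pm_linear_def)

lemma pm_linear_add: "pm_linear f \<Longrightarrow> f (x + y) = f x + f y"
  and pm_linear_scale: "pm_linear f \<Longrightarrow> f (scale c x) = scale c (f x)"
  by (simp_all add: pm_linear_def)

lemma pm_linear_zero: "pm_linear f \<Longrightarrow> f 0 = 0"
  using pm_linear_scale[of f 0 0] by simp

lemma pm_linear_uminus: "pm_linear f \<Longrightarrow> f (- x) = - f x"
  using pm_linear_add[of f x "- x"] by (simp add: pm_linear_zero add_eq_0_iff)

lemma pm_linear_diff: "pm_linear f \<Longrightarrow> f (x - y) = f x - f y"
  using pm_linear_add[of f x "- y"] by (simp add: pm_linear_uminus)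

lemma pm_linear_sum: "pm_linear f \<Longrightarrow> f (\<Sum>a\<in>A. g a) = (\<Sum>a\<in>A. f (g a))"
  by (induction A rule: infinite_finite_induct) (auto simp: pm_linear_add pm_linear_zero)

lemma pm_linear_lin_ext [simp]: "pm_linear (lin_ext g)"
  by (intro pm_linearI lin_ext_add lin_ext_scale)

lemma pm_linear_compose: "pm_linear f \<Longrightarrow> pm_linear g \<Longrightarrow> pm_linear (\<lambda>x. f (g x))"
  by (simp add: pm_linear_def)

lemma pm_linear_sum_fun: "(\<And>a. a \<in> A \<Longrightarrow> pm_linear (f a)) \<Longrightarrow> pm_linear (\<lambda>x. \<Sum>a\<in>A. f a x)"
  by (rule pm_linearI) (simp_all add: pm_linear_add pm_linear_scale sum.distrib scale_sum)

lemma pm_linear_minus_fun: "pm_linear f \<Longrightarrow> pm_linear g \<Longrightarrow> pm_linear (\<lambda>x. f x - g x)"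
  by (rule pm_linearI) (simp_all add: pm_linear_def algebra_simps pm.scale_right_diff_distrib)

lemma pm_linear_scale_fun: "pm_linear f \<Longrightarrow> pm_linear (\<lambda>x. scale c (f x))"
  by (rule pm_linearI) (simp_all add: pm_linear_def scale_add_right scale_scale mult.commute)

lemma pm_linear_id: "pm_linear (\<lambda>x. x)"
  by (simp add: pm_linear_def)

lemma poly_mapping_sum_bvec:
  assumes "finite S" "Poly_Mapping.keys t \<subseteq> S"
  shows "t = (\<Sum>b\<in>S. scale (Poly_Mapping.lookup t b) (bvec b))"
proof -
  have "t = lin_ext bvec t"
    by (induction t rule: poly_mapping_bvec_induct) (simp_all add: lin_ext_add scale_single)
  then show ?thesis using assms by (simp add: lin_ext_superset)
qed

lemma pm_linear_lin_ext_eq: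
  assumes "pm_linear f" shows "f t = lin_ext (\<lambda>b. f (bvec b)) t"
proof -
  have "f t = (\<Sum>b\<in>Poly_Mapping.keys t. f (scale (Poly_Mapping.lookup t b) (bvec b)))"
    by (subst (1) poly_mapping_sum_bvec[of "Poly_Mapping.keys t"]) (simp_all add: pm_linear_sum assms)
  then show ?thesis by (simp add: lin_ext_def pm_linear_scale assms)
qed

text \<open>Equality is asked for on the support only, because the formulas for the operators below hold on
  basis vectors whose indices lie in the right range.\<close>

lemma pm_linear_eqI:
  assumes "pm_linear f" "pm_linear g" "\<And>b. b \<in> B \<Longrightarrow> f (bvec b) = g (bvec b)"
    and "Poly_Mapping.keys t \<subseteq> B"
  shows "f t = g t"
  using assms(3,4)
  by (auto simp: pm_linear_lin_ext_eq[OF assms(1), of t] pm_linear_lin_ext_eq[OF assms(2), of t]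
      lin_ext_def intro!: sum.cong)

definition supported :: "'b set \<Rightarrow> ('b \<Rightarrow>\<^sub>0 complex) set" where
  "supported B = {t. Poly_Mapping.keys t \<subseteq> B}"

lemma supported_subspace: "pm.subspace (supported B)"
  by (auto simp: pm.subspace_def supported_def in_keys_iff lookup_add subset_iff)
    (metis add.right_neutral)

lemma bvec_supported [simp]: "bvec b \<in> supported B \<longleftrightarrow> b \<in> B"
  by (simp add: supported_def)

lemma supported_span: "supported B = pm.span (bvec ` B)"
proof
  show "supported B \<subseteq> pm.span (bvec ` B)"
  proof
    fix t assume "t \<in> supported B"
    then have "Poly_Mapping.keys t \<subseteq> B" by (simp add: supported_def)
    then show "t \<in> pm.span (bvec ` B)"
      by (subst poly_mapping_sum_bvec[OF finite_keys subset_refl])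
        (intro pm.span_sum pm.span_scale pm.span_base, auto)
  qed
  show "pm.span (bvec ` B) \<subseteq> supported B"
    by (rule pm.span_minimal) (auto simp: supported_subspace)
qed

lemma lin_ext_in_subspace:
  assumes "pm.subspace U" "\<And>b. b \<in> Poly_Mapping.keys t \<Longrightarrow> g b \<in> U"
  shows "lin_ext g t \<in> U"
  unfolding lin_ext_def
  by (rule pm.subspace_sum[OF assms(1)]) (simp add: pm.subspace_scale[OF assms(1)] assms(2))

lemma pm_linear_image_subspace:
  assumes "pm_linear f" "pm.subspace U" shows "pm.subspace (f ` U)"
  unfolding pm.subspace_def
proof (intro conjI ballI allI)
  show "0 \<in> f ` U" using pm_linear_zero[OF assms(1)] pm.subspace_0[OF assms(2)] by force
next
  fix x y assume "x \<in> f ` U" "y \<in> f ` U"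
  then obtain a b where "a \<in> U" "b \<in> U" "x = f a" "y = f b" by auto
  then show "x + y \<in> f ` U"
    using pm_linear_add[OF assms(1), of a b] pm.subspace_add[OF assms(2)] by force
next
  fix c x assume "x \<in> f ` U"
  then obtain a where "a \<in> U" "x = f a" by auto
  then show "scale c x \<in> f ` U"
    using pm_linear_scale[OF assms(1), of c a] pm.subspace_scale[OF assms(2), of a c]
    by (metis imageI)
qed

lemma pm_linear_span:
  assumes "pm_linear f" "pm.subspace U" "\<And>x. x \<in> S \<Longrightarrow> f x \<in> U" "x \<in> pm.span S"
  shows "f x \<in> U"
proof -
  have "pm.subspace {x. f x \<in> U}"
    unfolding pm.subspace_def using assms(1,2)
    by (auto simp: pm_linear_add pm_linear_scale pm_linear_zero pm.subspace_0 pm.subspace_add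
        pm.subspace_scale)
  then show ?thesis using pm.span_minimal[of S "{x. f x \<in> U}"] assms(3,4) by auto
qed

lemma pm_linear_image_span:
  assumes "pm_linear f" shows "f ` pm.span S = pm.span (f ` S)"
proof
  show "f ` pm.span S \<subseteq> pm.span (f ` S)"
    using pm_linear_span[OF assms pm.subspace_span[of "f ` S"], of S] by (auto intro: pm.span_base)
  show "pm.span (f ` S) \<subseteq> f ` pm.span S"
    by (rule pm.span_minimal)
      (auto intro: pm.span_base pm_linear_image_subspace[OF assms pm.subspace_span])
qed

lemma subspace_chain_Union:
  fixes W :: "nat \<Rightarrow> ('b \<Rightarrow>\<^sub>0 complex) set"
  assumes W: "\<And>m. pm.subspace (W m)" and mono: "\<And>m. W m \<subseteq> W (Suc m)"
  shows "pm.subspace (\<Union>m. W m)"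
  unfolding pm.subspace_def
proof (intro conjI ballI allI)
  show "0 \<in> (\<Union>m. W m)" using pm.subspace_0[OF W] by auto
next
  have mono': "W m \<subseteq> W m'" if "m \<le> m'" for m m' by (rule lift_Suc_mono_le[of W, OF mono that])
  fix x y assume "x \<in> (\<Union>m. W m)" "y \<in> (\<Union>m. W m)"
  then obtain a b where ab: "x \<in> W a" "y \<in> W b" by auto
  then have "x \<in> W (max a b)" "y \<in> W (max a b)" using mono'[of a "max a b"] mono'[of b "max a b"] by auto
  then show "x + y \<in> (\<Union>m. W m)" using pm.subspace_add[OF W] by blast
next
  fix c x assume "x \<in> (\<Union>m. W m)"
  then show "scale c x \<in> (\<Union>m. W m)" using pm.subspace_scale[OF W] by blast
qed

section \<open>Representations in coordinates\<close>

text \<open>The modules of the theorem consist of cosets, or of families of cosets. All computations are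
  transferred to a space of finitely supported functions: \<open>linear_model M \<Phi> W\<close> states that \<open>\<Phi>\<close> is a
  linear isomorphism from \<open>M\<close> onto the subspace \<open>W\<close>. Closure of the carrier under the operations is
  part of the statement, so that a linear model turns \<open>M\<close> into a module.\<close>

definition linear_model :: "('g, 'v) rep \<Rightarrow> ('v \<Rightarrow> ('k \<Rightarrow>\<^sub>0 complex)) \<Rightarrow> ('k \<Rightarrow>\<^sub>0 complex) set \<Rightarrow> bool" where
  "linear_model M \<Phi> W \<longleftrightarrow> pm.subspace W \<and> bij_betw \<Phi> (carrier M) W \<and>
     zero M \<in> carrier M \<and> \<Phi> (zero M) = 0 \<and>
     (\<forall>x\<in>carrier M. \<forall>y\<in>carrier M. x \<oplus>\<^bsub>M\<^esub> y \<in> carrier M \<and> \<Phi> (x \<oplus>\<^bsub>M\<^esub> y) = \<Phi> x + \<Phi> y) \<and>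
     (\<forall>c. \<forall>x\<in>carrier M. c \<odot>\<^bsub>M\<^esub> x \<in> carrier M \<and> \<Phi> (c \<odot>\<^bsub>M\<^esub> x) = scale c (\<Phi> x))"

lemma linear_modelD:
  assumes "linear_model M \<Phi> W"
  shows "pm.subspace W" "bij_betw \<Phi> (carrier M) W" "zero M \<in> carrier M" "\<Phi> (zero M) = 0"
    "x \<in> carrier M \<Longrightarrow> y \<in> carrier M \<Longrightarrow> x \<oplus>\<^bsub>M\<^esub> y \<in> carrier M"
    "x \<in> carrier M \<Longrightarrow> y \<in> carrier M \<Longrightarrow> \<Phi> (x \<oplus>\<^bsub>M\<^esub> y) = \<Phi> x + \<Phi> y"
    "x \<in> carrier M \<Longrightarrow> c \<odot>\<^bsub>M\<^esub> x \<in> carrier M"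
    "x \<in> carrier M \<Longrightarrow> \<Phi> (c \<odot>\<^bsub>M\<^esub> x) = scale c (\<Phi> x)"
    "x \<in> carrier M \<Longrightarrow> \<Phi> x \<in> W"
    "w \<in> W \<Longrightarrow> \<exists>x\<in>carrier M. \<Phi> x = w"
    "x \<in> carrier M \<Longrightarrow> y \<in> carrier M \<Longrightarrow> \<Phi> x = \<Phi> y \<longleftrightarrow> x = y"
  using assms unfolding linear_model_def bij_betw_def inj_on_def by (auto simp: image_def)

lemma linear_model_free_rep:
  "linear_model (free_rep B \<alpha>) (\<lambda>t. t) (supported B)"
  using supported_subspace[of B]
  by (auto simp: linear_model_def free_rep_def supported_def pm.subspace_def bij_betw_def)

lemma linear_model_free_sub_rep:
  "pm.subspace U \<Longrightarrow> linear_model (sub_rep (free_rep B \<alpha>) U) (\<lambda>t. t) U"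
  by (auto simp: linear_model_def free_rep_def sub_rep_def pm.subspace_def bij_betw_def)

lemma linear_model_module:
  assumes "linear_model M \<Phi> W" shows "Module.module (class_ring :: complex ring) M"
proof (rule module_criteria)
  note D = linear_modelD[OF assms]
  have eqI: "\<Phi> x = \<Phi> y \<Longrightarrow> x \<in> carrier M \<Longrightarrow> y \<in> carrier M \<Longrightarrow> x = y" for x y
    using D(11) by blast
  show "cring (class_ring :: complex ring)" using class_field unfolding field_def domain_def by blast
  show "\<forall>v\<in>carrier M. \<exists>neg_v\<in>carrier M. v \<oplus>\<^bsub>M\<^esub> neg_v = \<zero>\<^bsub>M\<^esub>"
  proof
    fix v assume v: "v \<in> carrier M"
    have "v \<oplus>\<^bsub>M\<^esub> ((-1) \<odot>\<^bsub>M\<^esub> v) = \<zero>\<^bsub>M\<^esub>"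
      by (rule eqI) (use v D in \<open>auto simp: pm.scale_minus_left\<close>)
    then show "\<exists>neg_v\<in>carrier M. v \<oplus>\<^bsub>M\<^esub> neg_v = \<zero>\<^bsub>M\<^esub>" using v D(7) by blast
  qed
  show "\<forall>v w x. v \<in> carrier M \<and> w \<in> carrier M \<and> x \<in> carrier M \<longrightarrow>
      v \<oplus>\<^bsub>M\<^esub> w \<oplus>\<^bsub>M\<^esub> x = v \<oplus>\<^bsub>M\<^esub> (w \<oplus>\<^bsub>M\<^esub> x)"
    by (intro allI impI eqI) (simp_all add: D add_ac)
  show "\<forall>v w. v \<in> carrier M \<and> w \<in> carrier M \<longrightarrow> v \<oplus>\<^bsub>M\<^esub> w = w \<oplus>\<^bsub>M\<^esub> v"
    by (intro allI impI eqI) (simp_all add: D add_ac)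
  show "\<forall>v\<in>carrier M. v \<oplus>\<^bsub>M\<^esub> \<zero>\<^bsub>M\<^esub> = v"
    by (intro ballI eqI) (simp_all add: D)
  show "\<forall>a b v. a \<in> carrier class_ring \<and> b \<in> carrier class_ring \<and> v \<in> carrier M \<longrightarrow>
      (a \<otimes>\<^bsub>class_ring\<^esub> b) \<odot>\<^bsub>M\<^esub> v = a \<odot>\<^bsub>M\<^esub> (b \<odot>\<^bsub>M\<^esub> v)"
    by (intro allI impI eqI) (simp_all add: D class_ring_simps scale_scale)
  show "\<forall>v\<in>carrier M. \<one>\<^bsub>class_ring\<^esub> \<odot>\<^bsub>M\<^esub> v = v"
    by (intro ballI eqI) (simp_all add: D class_ring_simps)
  show "\<forall>a b v. a \<in> carrier class_ring \<and> b \<in> carrier class_ring \<and> v \<in> carrier M \<longrightarrow>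
      (a \<oplus>\<^bsub>class_ring\<^esub> b) \<odot>\<^bsub>M\<^esub> v = a \<odot>\<^bsub>M\<^esub> v \<oplus>\<^bsub>M\<^esub> b \<odot>\<^bsub>M\<^esub> v"
    by (intro allI impI eqI) (simp_all add: D class_ring_simps scale_add_left)
  show "\<forall>a v w. a \<in> carrier class_ring \<and> v \<in> carrier M \<and> w \<in> carrier M \<longrightarrow>
      a \<odot>\<^bsub>M\<^esub> (v \<oplus>\<^bsub>M\<^esub> w) = a \<odot>\<^bsub>M\<^esub> v \<oplus>\<^bsub>M\<^esub> a \<odot>\<^bsub>M\<^esub> w"
    by (intro allI impI eqI) (simp_all add: D class_ring_simps scale_add_right)
qed (use linear_modelD(3,5,7)[OF assms] in auto)

lemma linear_model_span:
  assumes M: "linear_model M \<Phi> W" and S: "S \<subseteq> carrier M"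
  shows "span_rep M S \<subseteq> carrier M" "\<Phi> ` span_rep M S = pm.span (\<Phi> ` S)"
proof -
  note D = linear_modelD[OF M]
  note m = linear_model_module[OF M]
  have sub: "LinearCombinations.submodule class_ring (span_rep M S) M"
    by (rule LinearCombinations.module.span_is_submodule[OF m S])
  then show car: "span_rep M S \<subseteq> carrier M" by (simp add: submodule_def)
  let ?N = "{x \<in> carrier M. \<Phi> x \<in> pm.span (\<Phi> ` S)}"
  have "LinearCombinations.submodule class_ring ?N M"
    using D m by (auto simp: submodule_def intro: pm.span_add pm.span_scale pm.span_zero)
  then have "span_rep M S \<subseteq> ?N"
    by (rule LinearCombinations.module.span_is_subset[OF m, rotated]) (use S in \<open>auto intro: pm.span_base\<close>)
  moreover have "pm.span (\<Phi> ` S) \<subseteq> \<Phi> ` span_rep M S"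
  proof (rule pm.span_minimal)
    show "\<Phi> ` S \<subseteq> \<Phi> ` span_rep M S"
      using LinearCombinations.module.in_own_span[OF m S] by auto
    show "pm.subspace (\<Phi> ` span_rep M S)"
      unfolding pm.subspace_def
    proof (intro conjI ballI allI)
      show "0 \<in> \<Phi> ` span_rep M S" using sub D(4) by (force simp: submodule_def)
    next
      fix x y assume "x \<in> \<Phi> ` span_rep M S" "y \<in> \<Phi> ` span_rep M S"
      then obtain a b where ab: "a \<in> span_rep M S" "b \<in> span_rep M S" "x = \<Phi> a" "y = \<Phi> b" by auto
      then have "a \<oplus>\<^bsub>M\<^esub> b \<in> span_rep M S" using sub unfolding submodule_def by blast
      moreover have "x + y = \<Phi> (a \<oplus>\<^bsub>M\<^esub> b)" using ab car D(6)[of a b] by (simp add: subset_iff)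
      ultimately show "x + y \<in> \<Phi> ` span_rep M S" by blast
    next
      fix c x assume "x \<in> \<Phi> ` span_rep M S"
      then obtain a where a: "a \<in> span_rep M S" "x = \<Phi> a" by auto
      then have "c \<odot>\<^bsub>M\<^esub> a \<in> span_rep M S" using sub by (simp add: submodule_def)
      moreover have "scale c x = \<Phi> (c \<odot>\<^bsub>M\<^esub> a)" using a car D(8)[of a c] by (simp add: subset_iff)
      ultimately show "scale c x \<in> \<Phi> ` span_rep M S" by blast
    qed
  qed
  ultimately show "\<Phi> ` span_rep M S = pm.span (\<Phi> ` S)" by auto
qed

lemma linear_model_sub_rep:
  assumes "linear_model M \<Phi> W" "U \<subseteq> carrier M" "\<Phi> ` U = W'" "pm.subspace W'"
  shows "linear_model (sub_rep M U) \<Phi> W'"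
proof -
  note D = linear_modelD[OF assms(1)]
  have inj: "inj_on \<Phi> (carrier M)" using D(2) by (simp add: bij_betw_def)
  have mem: "x \<in> U \<longleftrightarrow> \<Phi> x \<in> W'" if "x \<in> carrier M" for x
    using that assms(2,3) inj by (auto simp: inj_on_def)
  show ?thesis
    unfolding linear_model_def sub_rep_def
    using D mem assms(2-4) inj
    by (auto simp: bij_betw_def pm.subspace_0 subset_iff inj_on_subset[OF inj assms(2)]
        pm.subspace_add pm.subspace_scale)
qed

definition intertwines ::
    "('g, 'v) rep \<Rightarrow> ('v \<Rightarrow> ('k \<Rightarrow>\<^sub>0 complex)) \<Rightarrow> 'g \<Rightarrow> (('k \<Rightarrow>\<^sub>0 complex) \<Rightarrow> ('k \<Rightarrow>\<^sub>0 complex)) \<Rightarrow> bool" where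
  "intertwines M \<Phi> g T \<longleftrightarrow> (\<forall>x\<in>carrier M. act M g x \<in> carrier M \<and> \<Phi> (act M g x) = T (\<Phi> x))"

text \<open>A subspace that is the kernel of a linear map \<open>q\<close> has the fibres of \<open>q\<close> as its cosets. This replaces
  calculations with cosets by calculations with \<open>q\<close>.\<close>

lemma quot_coset_eq_fibre:
  assumes M: "linear_model M \<Phi> W" and q: "pm_linear q"
    and U: "U \<subseteq> carrier M" and ker: "\<And>x. x \<in> carrier M \<Longrightarrow> q (\<Phi> x) = 0 \<longleftrightarrow> x \<in> U"
    and x: "x \<in> carrier M"
  shows "U +>\<^bsub>M\<^esub> x = {y \<in> carrier M. q (\<Phi> y) = q (\<Phi> x)}"
proof
  note D = linear_modelD[OF M]
  show "U +>\<^bsub>M\<^esub> x \<subseteq> {y \<in> carrier M. q (\<Phi> y) = q (\<Phi> x)}"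
  proof
    fix y assume "y \<in> U +>\<^bsub>M\<^esub> x"
    then obtain u where u: "u \<in> U" "y = u \<oplus>\<^bsub>M\<^esub> x" by (auto simp: a_r_coset_def')
    then have "u \<in> carrier M" "q (\<Phi> u) = 0" using U ker by auto
    then show "y \<in> {y \<in> carrier M. q (\<Phi> y) = q (\<Phi> x)}"
      using u x D(5)[of u x] D(6)[of u x] pm_linear_add[OF q] by simp
  qed
  show "{y \<in> carrier M. q (\<Phi> y) = q (\<Phi> x)} \<subseteq> U +>\<^bsub>M\<^esub> x"
  proof
    fix y assume "y \<in> {y \<in> carrier M. q (\<Phi> y) = q (\<Phi> x)}"
    then have y: "y \<in> carrier M" "q (\<Phi> y) = q (\<Phi> x)" by auto
    define u where "u = y \<oplus>\<^bsub>M\<^esub> ((-1) \<odot>\<^bsub>M\<^esub> x)"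
    have uc: "u \<in> carrier M" unfolding u_def using x y D(5,7) by auto
    have \<Phi>u: "\<Phi> u = \<Phi> y - \<Phi> x" unfolding u_def
      using x y D(6)[of y "(-1) \<odot>\<^bsub>M\<^esub> x"] D(7,8)[of x "-1"] by (simp add: pm.scale_minus_left)
    then have "q (\<Phi> u) = 0" using y pm_linear_diff[OF q] by simp
    then have "u \<in> U" using ker uc by auto
    moreover have "\<Phi> (u \<oplus>\<^bsub>M\<^esub> x) = \<Phi> y" using D(6)[OF uc x] \<Phi>u by simp
    then have "u \<oplus>\<^bsub>M\<^esub> x = y" using D(5)[OF uc x] D(11) y by blast
    ultimately show "y \<in> U +>\<^bsub>M\<^esub> x" by (auto simp: a_r_coset_def')
  qed
qed

lemma carrier_quot_rep: "carrier (quot_rep M U) = {U +>\<^bsub>M\<^esub> x |x. x \<in> carrier M}"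
  and act_quot_rep: "act (quot_rep M U) g C = (\<Union>x\<in>C. U +>\<^bsub>M\<^esub> act M g x)"
  and add_quot_rep: "C \<oplus>\<^bsub>quot_rep M U\<^esub> D = C <+>\<^bsub>M\<^esub> D"
  and smult_quot_rep: "c \<odot>\<^bsub>quot_rep M U\<^esub> C = (\<Union>x\<in>C. U +>\<^bsub>M\<^esub> (c \<odot>\<^bsub>M\<^esub> x))"
  and zero_quot_rep: "\<zero>\<^bsub>quot_rep M U\<^esub> = U"
  by (simp_all add: quot_rep_def)

text \<open>The value is the same at all elements of a coset of the kernel of \<open>q\<close>, so the choice does not matter.\<close>

definition quot_coord ::
    "(('k \<Rightarrow>\<^sub>0 complex) \<Rightarrow> ('k \<Rightarrow>\<^sub>0 complex)) \<Rightarrow> ('v \<Rightarrow> ('k \<Rightarrow>\<^sub>0 complex)) \<Rightarrow> 'v set \<Rightarrow> ('k \<Rightarrow>\<^sub>0 complex)" where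
  "quot_coord q \<Phi> C = q (\<Phi> (SOME x. x \<in> C))"

text \<open>If \<open>q\<close> has kernel \<open>U\<close>, then \<open>q\<close> induces coordinates on the quotient by \<open>U\<close>. The lemma serves twice: with
  the antisymmetriser for the exterior power, and with an orthogonal projection for the graded pieces.\<close>

lemma linear_model_quot_rep:
  fixes q :: "('k \<Rightarrow>\<^sub>0 complex) \<Rightarrow> ('k \<Rightarrow>\<^sub>0 complex)"
  assumes M: "linear_model M \<Phi> W" and q: "pm_linear q"
    and U: "U \<subseteq> carrier M" and ker: "\<And>x. x \<in> carrier M \<Longrightarrow> q (\<Phi> x) = 0 \<longleftrightarrow> x \<in> U"
  shows "linear_model (quot_rep M U) (quot_coord q \<Phi>) (q ` W)" (is "linear_model ?Q ?\<Psi> _")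
    and "x \<in> carrier M \<Longrightarrow> U +>\<^bsub>M\<^esub> x \<in> carrier (quot_rep M U)"
    and "x \<in> carrier M \<Longrightarrow> quot_coord q \<Phi> (U +>\<^bsub>M\<^esub> x) = q (\<Phi> x)"
    and "\<lbrakk>\<And>x. x \<in> carrier M \<Longrightarrow> act M g x \<in> carrier M \<and> q (\<Phi> (act M g x)) = T (q (\<Phi> x));
        C \<in> carrier (quot_rep M U)\<rbrakk> \<Longrightarrow>
        act (quot_rep M U) g C \<in> carrier (quot_rep M U) \<and>
        quot_coord q \<Phi> (act (quot_rep M U) g C) = T (quot_coord q \<Phi> C)"
proof -
  note D = linear_modelD[OF M]
  have fibre: "U +>\<^bsub>M\<^esub> x = {y \<in> carrier M. q (\<Phi> y) = q (\<Phi> x)}" if "x \<in> carrier M" for x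
    by (rule quot_coset_eq_fibre[OF M q U _ that]) (rule ker)
  have self: "x \<in> U +>\<^bsub>M\<^esub> x" if "x \<in> carrier M" for x using fibre that by auto
  show car: "U +>\<^bsub>M\<^esub> x \<in> carrier ?Q" if "x \<in> carrier M" for x
    using that by (auto simp: carrier_quot_rep)
  show val: "?\<Psi> (U +>\<^bsub>M\<^esub> x) = q (\<Phi> x)" if "x \<in> carrier M" for x
  proof -
    have "(SOME y. y \<in> U +>\<^bsub>M\<^esub> x) \<in> U +>\<^bsub>M\<^esub> x" using self[OF that] by (rule someI)
    then show ?thesis using fibre[OF that] by (auto simp: quot_coord_def)
  qed
  have carE: "\<exists>x. x \<in> carrier M \<and> C = U +>\<^bsub>M\<^esub> x" if "C \<in> carrier ?Q" for C
    using that by (auto simp: carrier_quot_rep)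
  have eq: "U +>\<^bsub>M\<^esub> x = U +>\<^bsub>M\<^esub> y \<longleftrightarrow> q (\<Phi> x) = q (\<Phi> y)" if "x \<in> carrier M" "y \<in> carrier M" for x y
  proof
    assume "U +>\<^bsub>M\<^esub> x = U +>\<^bsub>M\<^esub> y"
    then have "?\<Psi> (U +>\<^bsub>M\<^esub> x) = ?\<Psi> (U +>\<^bsub>M\<^esub> y)" by simp
    then show "q (\<Phi> x) = q (\<Phi> y)" by (simp only: val that)
  qed (simp only: fibre that)
  \<comment> \<open>an operation applied to all elements of a coset gives a single coset\<close>
  have collapse: "(\<Union>y\<in>U +>\<^bsub>M\<^esub> x. U +>\<^bsub>M\<^esub> h y) = U +>\<^bsub>M\<^esub> h x"
    if x: "x \<in> carrier M" and h: "\<And>y. y \<in> carrier M \<Longrightarrow> h y \<in> carrier M"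
      and qh: "\<And>y. y \<in> carrier M \<Longrightarrow> q (\<Phi> y) = q (\<Phi> x) \<Longrightarrow> q (\<Phi> (h y)) = q (\<Phi> (h x))" for h x
  proof -
    have "U +>\<^bsub>M\<^esub> h y = U +>\<^bsub>M\<^esub> h x" if "y \<in> U +>\<^bsub>M\<^esub> x" for y
      using that eq[of "h y" "h x"] h[of y] h[OF x] qh[of y] fibre[OF x] by auto
    then show ?thesis by (intro UN_constant_eq[OF self[OF x]]) blast
  qed
  have add: "(U +>\<^bsub>M\<^esub> x) \<oplus>\<^bsub>?Q\<^esub> (U +>\<^bsub>M\<^esub> y) = U +>\<^bsub>M\<^esub> (x \<oplus>\<^bsub>M\<^esub> y)"
    if x: "x \<in> carrier M" and y: "y \<in> carrier M" for x y
  proof -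
    have "(U +>\<^bsub>M\<^esub> x) <+>\<^bsub>M\<^esub> (U +>\<^bsub>M\<^esub> y) = U +>\<^bsub>M\<^esub> (x \<oplus>\<^bsub>M\<^esub> y)"
    proof
      show "(U +>\<^bsub>M\<^esub> x) <+>\<^bsub>M\<^esub> (U +>\<^bsub>M\<^esub> y) \<subseteq> U +>\<^bsub>M\<^esub> (x \<oplus>\<^bsub>M\<^esub> y)"
        using D(5,6) x y by (auto simp: fibre set_add_def' pm_linear_add[OF q])
      show "U +>\<^bsub>M\<^esub> (x \<oplus>\<^bsub>M\<^esub> y) \<subseteq> (U +>\<^bsub>M\<^esub> x) <+>\<^bsub>M\<^esub> (U +>\<^bsub>M\<^esub> y)"
      proof
        fix z assume z: "z \<in> U +>\<^bsub>M\<^esub> (x \<oplus>\<^bsub>M\<^esub> y)"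
        then have zc: "z \<in> carrier M" "q (\<Phi> z) = q (\<Phi> x) + q (\<Phi> y)"
          using x y fibre[OF D(5)[OF x y]] D(6)[OF x y] by (auto simp: pm_linear_add[OF q])
        define v where "v = z \<oplus>\<^bsub>M\<^esub> ((-1) \<odot>\<^bsub>M\<^esub> y)"
        have vc: "v \<in> carrier M" unfolding v_def using zc y D(5,7) by auto
        have \<Phi>v: "\<Phi> v = \<Phi> z - \<Phi> y" unfolding v_def
          using zc y D(6)[of z "(-1) \<odot>\<^bsub>M\<^esub> y"] D(7,8)[of y "-1"] by (simp add: pm.scale_minus_left)
        then have "q (\<Phi> v) = q (\<Phi> x)" using zc by (simp add: pm_linear_diff[OF q])
        then have "v \<in> U +>\<^bsub>M\<^esub> x" using fibre[OF x] vc by auto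
        moreover have "v \<oplus>\<^bsub>M\<^esub> y = z" using D(5)[OF vc y] D(6)[OF vc y] \<Phi>v D(11) zc by auto
        ultimately show "z \<in> (U +>\<^bsub>M\<^esub> x) <+>\<^bsub>M\<^esub> (U +>\<^bsub>M\<^esub> y)"
          using self[OF y] by (auto simp: set_add_def')
      qed
    qed
    then show ?thesis by (simp add: add_quot_rep)
  qed
  have smult: "c \<odot>\<^bsub>?Q\<^esub> (U +>\<^bsub>M\<^esub> x) = U +>\<^bsub>M\<^esub> (c \<odot>\<^bsub>M\<^esub> x)" if x: "x \<in> carrier M" for c x
    unfolding smult_quot_rep
    by (rule collapse[OF x]) (use x D(7,8) in \<open>auto simp: pm_linear_scale[OF q]\<close>)
  have zeroQ: "\<zero>\<^bsub>?Q\<^esub> = U +>\<^bsub>M\<^esub> \<zero>\<^bsub>M\<^esub>"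
    using fibre[OF D(3)] D(4) ker U by (auto simp: zero_quot_rep pm_linear_zero[OF q])
  show "linear_model ?Q ?\<Psi> (q ` W)"
    unfolding linear_model_def
  proof (intro conjI ballI allI)
    show "pm.subspace (q ` W)" by (rule pm_linear_image_subspace[OF q D(1)])
    show "bij_betw ?\<Psi> (carrier ?Q) (q ` W)"
      unfolding bij_betw_def
    proof
      show "inj_on ?\<Psi> (carrier ?Q)"
        by (rule inj_onI) (metis carE val eq)
      show "?\<Psi> ` carrier ?Q = q ` W"
        using D(9,10) by (auto simp: carrier_quot_rep image_def val) (metis val)
    qed
    show "\<zero>\<^bsub>?Q\<^esub> \<in> carrier ?Q" "?\<Psi> \<zero>\<^bsub>?Q\<^esub> = 0"
      using zeroQ car[OF D(3)] val[OF D(3)] D(4) by (simp_all add: pm_linear_zero[OF q])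
  next
    fix C C' assume "C \<in> carrier ?Q" "C' \<in> carrier ?Q"
    then obtain x y where xy: "x \<in> carrier M" "C = U +>\<^bsub>M\<^esub> x" "y \<in> carrier M" "C' = U +>\<^bsub>M\<^esub> y"
      using carE by metis
    show "C \<oplus>\<^bsub>?Q\<^esub> C' \<in> carrier ?Q" "?\<Psi> (C \<oplus>\<^bsub>?Q\<^esub> C') = ?\<Psi> C + ?\<Psi> C'"
      using xy add car val D(5,6) by (auto simp: pm_linear_add[OF q])
  next
    fix c C assume "C \<in> carrier ?Q"
    then obtain x where xy: "x \<in> carrier M" "C = U +>\<^bsub>M\<^esub> x" using carE by metis
    show "c \<odot>\<^bsub>?Q\<^esub> C \<in> carrier ?Q" "?\<Psi> (c \<odot>\<^bsub>?Q\<^esub> C) = scale c (?\<Psi> C)"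
      using xy smult car val D(7,8) by (auto simp: pm_linear_scale[OF q])
  qed
  show "act ?Q g C \<in> carrier ?Q \<and> ?\<Psi> (act ?Q g C) = T (?\<Psi> C)"
    if T: "\<And>x. x \<in> carrier M \<Longrightarrow> act M g x \<in> carrier M \<and> q (\<Phi> (act M g x)) = T (q (\<Phi> x))"
      and C: "C \<in> carrier ?Q"
  proof -
    obtain x where x: "x \<in> carrier M" "C = U +>\<^bsub>M\<^esub> x" using carE[OF C] by auto
    have "act ?Q g C = U +>\<^bsub>M\<^esub> act M g x"
      unfolding act_quot_rep x(2) by (rule collapse[OF x(1)]) (use T x in auto)
    then show ?thesis using x car val T by simp
  qed
qed

text \<open>The sum of the components is a bijection onto the union of the chain \<open>W\<close>, because \<open>Q m\<close> is a complement
  of \<open>W m\<close> in \<open>W (Suc m)\<close>: injectivity follows by comparing the highest component first, surjectivity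
  by splitting off one complement at a time.\<close>

lemma linear_model_direct_sum_rep:
  fixes M :: "nat \<Rightarrow> ('g, 'v) rep" and \<Phi> :: "nat \<Rightarrow> 'v \<Rightarrow> ('k \<Rightarrow>\<^sub>0 complex)"
    and W Q :: "nat \<Rightarrow> ('k \<Rightarrow>\<^sub>0 complex) set"
  assumes M: "\<And>m. linear_model (M m) (\<Phi> m) (Q m)"
    and W: "\<And>m. pm.subspace (W m)" "W 0 = {0}"
    and QW: "\<And>m. Q m \<subseteq> W (Suc m)" and WW: "\<And>m. W m \<subseteq> W (Suc m)"
    and dec: "\<And>m w. w \<in> W (Suc m) \<Longrightarrow> \<exists>u\<in>W m. \<exists>v\<in>Q m. w = u + v"
    and ind: "\<And>m. W m \<inter> Q m \<subseteq> {0}"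
  shows "linear_model (direct_sum_rep M) (\<lambda>x. \<Sum>m | x m \<noteq> \<zero>\<^bsub>M m\<^esub>. \<Phi> m (x m)) (\<Union>m. W m)"
    (is "linear_model ?S ?\<Psi> _")
proof -
  note D = linear_modelD[OF M]
  have carS: "x \<in> carrier ?S \<longleftrightarrow> (\<forall>m. x m \<in> carrier (M m)) \<and> finite {m. x m \<noteq> \<zero>\<^bsub>M m\<^esub>}" for x
    by (simp add: direct_sum_rep_def)
  \<comment> \<open>the sum can be taken over any initial segment of the degrees containing the support\<close>
  have \<Psi>: "?\<Psi> x = (\<Sum>m<k. \<Phi> m (x m))" if "{m. x m \<noteq> \<zero>\<^bsub>M m\<^esub>} \<subseteq> {..<k}" for x k
    using that by (intro sum.mono_neutral_left) (auto simp: D(4))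
  have bound: "\<exists>k. {m. x m \<noteq> \<zero>\<^bsub>M m\<^esub>} \<subseteq> {..<k}" if "x \<in> carrier ?S" for x
    using that finite_nat_bounded by (auto simp: carS)
  have partial: "(\<Sum>m<k. \<Phi> m (x m)) \<in> W k" if "\<And>m. x m \<in> carrier (M m)" for x k
  proof (induction k)
    case 0
    show ?case using pm.subspace_0[OF W(1)] by simp
  next
    case (Suc k)
    then show ?case
      using WW[of k] QW[of k] D(9)[OF that, of k] by (auto intro!: pm.subspace_add[OF W(1)])
  qed
  have subU: "pm.subspace (\<Union>m. W m)" by (rule subspace_chain_Union) (rule W(1) WW)+
  have zeroS: "\<zero>\<^bsub>?S\<^esub> = (\<lambda>m. \<zero>\<^bsub>M m\<^esub>)" by (simp add: direct_sum_rep_def)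
  have addS: "x \<oplus>\<^bsub>?S\<^esub> y = (\<lambda>m. x m \<oplus>\<^bsub>M m\<^esub> y m)" for x y by (simp add: direct_sum_rep_def)
  have smultS: "c \<odot>\<^bsub>?S\<^esub> x = (\<lambda>m. c \<odot>\<^bsub>M m\<^esub> x m)" for c x by (simp add: direct_sum_rep_def)
  have eqI: "x = y" if "\<Phi> m x = \<Phi> m y" "x \<in> carrier (M m)" "y \<in> carrier (M m)" for m x y
    using that D(11) by blast
  have zz1: "\<zero>\<^bsub>M m\<^esub> \<oplus>\<^bsub>M m\<^esub> \<zero>\<^bsub>M m\<^esub> = \<zero>\<^bsub>M m\<^esub>" for m
    by (rule eqI[of m]) (simp_all add: D)
  have zz2: "c \<odot>\<^bsub>M m\<^esub> \<zero>\<^bsub>M m\<^esub> = \<zero>\<^bsub>M m\<^esub>" for m c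
    by (rule eqI[of m]) (simp_all add: D)
  have inj: "\<And>m. m < k \<Longrightarrow> x m = y m"
    if "\<And>m. x m \<in> carrier (M m)" "\<And>m. y m \<in> carrier (M m)"
      "(\<Sum>m<k. \<Phi> m (x m)) = (\<Sum>m<k. \<Phi> m (y m))" for x y k
    using that
  proof (induction k)
    case (Suc k)
    let ?d = "\<Phi> k (x k) - \<Phi> k (y k)"
    have "?d = (\<Sum>m<k. \<Phi> m (y m)) - (\<Sum>m<k. \<Phi> m (x m))"
      using Suc.prems(4) by (simp add: algebra_simps)
    then have "?d \<in> W k" using partial Suc.prems(2,3) by (auto intro!: pm.subspace_diff[OF W(1)])
    moreover have "?d \<in> Q k"
      using D(9) Suc.prems(2,3) by (auto intro!: pm.subspace_diff[OF D(1)])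
    ultimately have "\<Phi> k (x k) = \<Phi> k (y k)" using ind[of k] by auto
    then have k: "x k = y k" using D(11) Suc.prems(2,3) by blast
    then have "(\<Sum>m<k. \<Phi> m (x m)) = (\<Sum>m<k. \<Phi> m (y m))" using Suc.prems(4) by simp
    then show ?case using Suc k by (metis less_SucE)
  qed simp
  have surj: "\<exists>x\<in>carrier ?S. {m. x m \<noteq> \<zero>\<^bsub>M m\<^esub>} \<subseteq> {..<k} \<and> w = (\<Sum>m<k. \<Phi> m (x m))" if "w \<in> W k" for k w
    using that
  proof (induction k arbitrary: w)
    case 0
    then show ?case using W(2) D(3) by (intro bexI[of _ "\<lambda>m. \<zero>\<^bsub>M m\<^esub>"]) (auto simp: carS)
  next
    case (Suc k)
    obtain u v where uv: "u \<in> W k" "v \<in> Q k" "w = u + v" using dec Suc.prems by blast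
    obtain x where x: "x \<in> carrier ?S" "{m. x m \<noteq> \<zero>\<^bsub>M m\<^esub>} \<subseteq> {..<k}" "u = (\<Sum>m<k. \<Phi> m (x m))"
      using Suc.IH uv(1) by blast
    obtain e where e: "e \<in> carrier (M k)" "\<Phi> k e = v" using D(10)[OF uv(2)] by auto
    have sub: "{m. (x(k := e)) m \<noteq> \<zero>\<^bsub>M m\<^esub>} \<subseteq> {..<Suc k}" using x(2) by (auto split: if_splits)
    have "x(k := e) \<in> carrier ?S"
      using x(1) e(1) finite_subset[OF sub] unfolding carS by simp
    then show ?case using x e sub uv by (intro bexI[of _ "x(k := e)"]) auto
  qed
  show ?thesis
    unfolding linear_model_def
  proof (intro conjI ballI allI)
    show "bij_betw ?\<Psi> (carrier ?S) (\<Union>m. W m)"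
      unfolding bij_betw_def
    proof
      show "inj_on ?\<Psi> (carrier ?S)"
      proof (rule inj_onI)
        fix x y assume xy: "x \<in> carrier ?S" "y \<in> carrier ?S" "?\<Psi> x = ?\<Psi> y"
        obtain a b where ab: "{m. x m \<noteq> \<zero>\<^bsub>M m\<^esub>} \<subseteq> {..<a}" "{m. y m \<noteq> \<zero>\<^bsub>M m\<^esub>} \<subseteq> {..<b}"
          using bound xy by meson
        show "x = y"
        proof
          fix m
          let ?k = "Suc m + a + b"
          have "?\<Psi> x = (\<Sum>m<?k. \<Phi> m (x m))" by (rule \<Psi>) (use ab in force)
          moreover have "?\<Psi> y = (\<Sum>m<?k. \<Phi> m (y m))" by (rule \<Psi>) (use ab in force)
          ultimately show "x m = y m"
            using xy by (intro inj[of x y ?k m]) (auto simp: carS)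
        qed
      qed
      show "?\<Psi> ` carrier ?S = (\<Union>m. W m)"
      proof
        show "?\<Psi> ` carrier ?S \<subseteq> (\<Union>m. W m)"
        proof
          fix w assume "w \<in> ?\<Psi> ` carrier ?S"
          then obtain x where x: "x \<in> carrier ?S" "w = ?\<Psi> x" by auto
          then obtain k where "{m. x m \<noteq> \<zero>\<^bsub>M m\<^esub>} \<subseteq> {..<k}" using bound by blast
          then have "w \<in> W k" using x partial[of x k] \<Psi>[of x k] by (simp add: carS)
          then show "w \<in> (\<Union>m. W m)" by blast
        qed
        show "(\<Union>m. W m) \<subseteq> ?\<Psi> ` carrier ?S"
        proof
          fix w assume "w \<in> (\<Union>m. W m)"
          then obtain k where "w \<in> W k" by auto
          then obtain x where "x \<in> carrier ?S" "{m. x m \<noteq> \<zero>\<^bsub>M m\<^esub>} \<subseteq> {..<k}" "w = (\<Sum>m<k. \<Phi> m (x m))"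
            using surj by blast
          then show "w \<in> ?\<Psi> ` carrier ?S" by (intro image_eqI[of _ _ x]) (simp_all add: \<Psi>)
        qed
      qed
    qed
    show "\<zero>\<^bsub>?S\<^esub> \<in> carrier ?S" "?\<Psi> \<zero>\<^bsub>?S\<^esub> = 0" using D(3) by (simp_all add: carS zeroS)
  next
    fix x y assume xy: "x \<in> carrier ?S" "y \<in> carrier ?S"
    obtain a b where ab: "{m. x m \<noteq> \<zero>\<^bsub>M m\<^esub>} \<subseteq> {..<a}" "{m. y m \<noteq> \<zero>\<^bsub>M m\<^esub>} \<subseteq> {..<b}"
      using bound xy by meson
    let ?k = "max a b"
    have sub: "{m. x m \<oplus>\<^bsub>M m\<^esub> y m \<noteq> \<zero>\<^bsub>M m\<^esub>} \<subseteq> {..<?k}"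
    proof
      fix m assume m: "m \<in> {m. x m \<oplus>\<^bsub>M m\<^esub> y m \<noteq> \<zero>\<^bsub>M m\<^esub>}"
      then have "x m \<noteq> \<zero>\<^bsub>M m\<^esub> \<or> y m \<noteq> \<zero>\<^bsub>M m\<^esub>" using zz1[of m] by auto
      then show "m \<in> {..<?k}" using ab by (auto simp: subset_iff less_max_iff_disj)
    qed
    show "x \<oplus>\<^bsub>?S\<^esub> y \<in> carrier ?S"
      using xy finite_subset[OF sub] D(5) by (auto simp: carS addS)
    have "?\<Psi> (x \<oplus>\<^bsub>?S\<^esub> y) = (\<Sum>m<?k. \<Phi> m (x m \<oplus>\<^bsub>M m\<^esub> y m))"
      using \<Psi>[of "x \<oplus>\<^bsub>?S\<^esub> y" ?k] sub by (simp add: addS)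
    also have "\<dots> = (\<Sum>m<?k. \<Phi> m (x m)) + (\<Sum>m<?k. \<Phi> m (y m))"
      using xy D(6) by (simp add: carS sum.distrib)
    also have "\<dots> = ?\<Psi> x + ?\<Psi> y"
      using \<Psi>[of x ?k] \<Psi>[of y ?k] ab by (simp add: subset_iff less_max_iff_disj)
    finally show "?\<Psi> (x \<oplus>\<^bsub>?S\<^esub> y) = ?\<Psi> x + ?\<Psi> y" .
  next
    fix c x assume x: "x \<in> carrier ?S"
    obtain k where k: "{m. x m \<noteq> \<zero>\<^bsub>M m\<^esub>} \<subseteq> {..<k}" using bound x by meson
    have sub: "{m. c \<odot>\<^bsub>M m\<^esub> x m \<noteq> \<zero>\<^bsub>M m\<^esub>} \<subseteq> {..<k}" 
    proof
      fix m assume m: "m \<in> {m. c \<odot>\<^bsub>M m\<^esub> x m \<noteq> \<zero>\<^bsub>M m\<^esub>}"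
      then have "x m \<noteq> \<zero>\<^bsub>M m\<^esub>" using zz2[of m c] by auto
      then show "m \<in> {..<k}" using k by auto
    qed
    show "c \<odot>\<^bsub>?S\<^esub> x \<in> carrier ?S" using x finite_subset[OF sub] D(7) by (auto simp: carS smultS)
    have "?\<Psi> (c \<odot>\<^bsub>?S\<^esub> x) = (\<Sum>m<k. \<Phi> m (c \<odot>\<^bsub>M m\<^esub> x m))"
      using \<Psi>[of "c \<odot>\<^bsub>?S\<^esub> x" k] sub by (simp add: smultS)
    also have "\<dots> = scale c (?\<Psi> x)"
      using x D(8) \<Psi>[OF k] by (simp add: carS scale_sum)
    finally show "?\<Psi> (c \<odot>\<^bsub>?S\<^esub> x) = scale c (?\<Psi> x)" .
  qed (rule subU)
qed

lemma direct_sum_rep_act: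
  fixes M :: "nat \<Rightarrow> ('g, 'v) rep" and \<Phi> :: "nat \<Rightarrow> 'v \<Rightarrow> ('k \<Rightarrow>\<^sub>0 complex)"
  assumes M: "\<And>m. linear_model (M m) (\<Phi> m) (Q m)" and T: "pm_linear T"
    and act: "\<And>m x. x \<in> carrier (M m) \<Longrightarrow> act (M m) g x \<in> carrier (M m) \<and> \<Phi> m (act (M m) g x) = T (\<Phi> m x)"
    and x: "x \<in> carrier (direct_sum_rep M)"
  shows "act (direct_sum_rep M) g x \<in> carrier (direct_sum_rep M)"
    and "(\<Sum>m | act (direct_sum_rep M) g x m \<noteq> \<zero>\<^bsub>M m\<^esub>. \<Phi> m (act (direct_sum_rep M) g x m)) =
      T (\<Sum>m | x m \<noteq> \<zero>\<^bsub>M m\<^esub>. \<Phi> m (x m))"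
proof -
  note D = linear_modelD[OF M]
  have car: "x m \<in> carrier (M m)" for m using x by (simp add: direct_sum_rep_def)
  have fin: "finite {m. x m \<noteq> \<zero>\<^bsub>M m\<^esub>}" using x by (simp add: direct_sum_rep_def)
  let ?y = "\<lambda>m. act (M m) g (x m)"
  have y: "act (direct_sum_rep M) g x = ?y" by (simp add: direct_sum_rep_def)
  have ycar: "?y m \<in> carrier (M m)" "\<Phi> m (?y m) = T (\<Phi> m (x m))" for m using act[OF car] by auto
  have sub: "{m. ?y m \<noteq> \<zero>\<^bsub>M m\<^esub>} \<subseteq> {m. x m \<noteq> \<zero>\<^bsub>M m\<^esub>}"
  proof (intro Collect_mono impI notI)
    fix m assume ne: "?y m \<noteq> \<zero>\<^bsub>M m\<^esub>" and "x m = \<zero>\<^bsub>M m\<^esub>"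
    then have "\<Phi> m (?y m) = \<Phi> m \<zero>\<^bsub>M m\<^esub>" using ycar(2)[of m] D(4)[of m] pm_linear_zero[OF T] by simp
    then show False using ne D(11)[of "?y m" m "\<zero>\<^bsub>M m\<^esub>"] ycar(1) D(3) by blast
  qed
  show "act (direct_sum_rep M) g x \<in> carrier (direct_sum_rep M)"
    unfolding y using ycar(1) finite_subset[OF sub fin] by (simp add: direct_sum_rep_def)
  have "(\<Sum>m | ?y m \<noteq> \<zero>\<^bsub>M m\<^esub>. \<Phi> m (?y m)) = (\<Sum>m | x m \<noteq> \<zero>\<^bsub>M m\<^esub>. \<Phi> m (?y m))"
    by (rule sum.mono_neutral_left[OF fin sub]) (auto simp: D(4))
  also have "\<dots> = T (\<Sum>m | x m \<noteq> \<zero>\<^bsub>M m\<^esub>. \<Phi> m (x m))"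
    by (simp add: ycar(2) pm_linear_sum[OF T])
  finally show "(\<Sum>m | act (direct_sum_rep M) g x m \<noteq> \<zero>\<^bsub>M m\<^esub>. \<Phi> m (act (direct_sum_rep M) g x m)) =
      T (\<Sum>m | x m \<noteq> \<zero>\<^bsub>M m\<^esub>. \<Phi> m (x m))" unfolding y .
qed

lemma linear_model_minus:
  assumes "linear_model M \<Phi> W" "x \<in> carrier M" "y \<in> carrier M"
  shows "\<Phi> (x \<ominus>\<^bsub>M\<^esub> y) = \<Phi> x - \<Phi> y"
proof -
  interpret Module.module class_ring M by (rule linear_model_module[OF assms(1)])
  have "(x \<ominus>\<^bsub>M\<^esub> y) \<oplus>\<^bsub>M\<^esub> y = x" using assms(2,3) by (simp add: a_minus_def a_assoc l_neg)
  then have "\<Phi> (x \<ominus>\<^bsub>M\<^esub> y) + \<Phi> y = \<Phi> x"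
    using linear_modelD(6)[OF assms(1), of "x \<ominus>\<^bsub>M\<^esub> y" y] assms(2,3) by auto
  then show ?thesis by (simp add: algebra_simps)
qed

lemma linear_model_compose:
  assumes M: "linear_model M \<Phi> W" and G: "pm_linear G" "bij_betw G W W'"
  shows "linear_model M (\<lambda>x. G (\<Phi> x)) W'"
proof -
  note D = linear_modelD[OF M]
  have "W' = G ` W" using G(2) by (simp add: bij_betw_def)
  then have "pm.subspace W'" using pm_linear_image_subspace[OF G(1) D(1)] by simp
  moreover have "bij_betw (\<lambda>x. G (\<Phi> x)) (carrier M) W'"
    using bij_betw_trans[OF D(2) G(2)] by (simp add: comp_def)
  ultimately show ?thesis
    using D unfolding linear_model_def
    by (simp add: pm_linear_zero[OF G(1)] pm_linear_add[OF G(1)] pm_linear_scale[OF G(1)])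
qed

text \<open>The laws of a \<open>\<gg>\<ll>\<^sub>r\<close>-module are equations, so \<open>M\<close> inherits them from \<open>M'\<close> through the injective map \<open>\<Phi>\<close>.\<close>

lemma gl_isomorphicI:
  fixes M :: "(complex mat, 'v) rep" and M' :: "(complex mat, 'b \<Rightarrow>\<^sub>0 complex) rep"
  assumes M: "linear_model M \<Phi> W" and M': "linear_model M' (\<lambda>t. t) W" and gl: "gl_module r M'"
    and intertwines: "\<And>A. A \<in> carrier_mat r r \<Longrightarrow> intertwines M \<Phi> A (act M' A)"
  shows "gl_isomorphic r M M'"
proof -
  note D = linear_modelD[OF M] and D' = linear_modelD[OF M']
  interpret gl': gl_module r M' by (rule gl)
  have car': "carrier M' = W" using D'(2) by (simp add: bij_betw_def)
  have mem: "\<Phi> x \<in> carrier M'" if "x \<in> carrier M" for x using car' D(9) that by simp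
  have add: "\<Phi> (x \<oplus>\<^bsub>M\<^esub> y) = \<Phi> x \<oplus>\<^bsub>M'\<^esub> \<Phi> y" if "x \<in> carrier M" "y \<in> carrier M" for x y
    using D(6)[OF that] D'(6)[of "\<Phi> x" "\<Phi> y"] mem that by simp
  have smult: "\<Phi> (c \<odot>\<^bsub>M\<^esub> x) = c \<odot>\<^bsub>M'\<^esub> \<Phi> x" if "x \<in> carrier M" for c x
    using D(8)[OF that] D'(8)[of "\<Phi> x" c] mem that by simp
  interpret M: Module.module class_ring M by (rule linear_model_module[OF M])
  have minus: "\<Phi> (x \<ominus>\<^bsub>M\<^esub> y) = \<Phi> x \<ominus>\<^bsub>M'\<^esub> \<Phi> y" if "x \<in> carrier M" "y \<in> carrier M" for x y
    using linear_model_minus[OF M that] linear_model_minus[OF M', of "\<Phi> x" "\<Phi> y"] mem that by simp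
  have eqI: "x = y" if "\<Phi> x = \<Phi> y" "x \<in> carrier M" "y \<in> carrier M" for x y
    using D(11) that by blast
  have a1: "act M A x \<in> carrier M" and a2: "\<Phi> (act M A x) = act M' A (\<Phi> x)"
    if "A \<in> carrier_mat r r" "x \<in> carrier M" for A x
    using intertwines that by (auto simp: intertwines_def)
  have gl_M: "gl_module r M"
  proof (unfold_locales, goal_cases)
    case (1 A x) then show ?case by (rule a1)
  next
    case (2 A x y)
    then show ?case by (intro eqI) (simp_all add: a1 a2 add mem gl'.act_add)
  next
    case (3 A x c)
    then show ?case by (intro eqI) (simp_all add: a1 a2 smult mem gl'.act_smult D(7))
  next
    case (4 A B x)
    then show ?case by (intro eqI) (simp_all add: a1 a2 add mem gl'.add_act)
  next
    case (5 A x c)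
    then show ?case by (intro eqI) (simp_all add: a1 a2 smult mem gl'.smult_act D(7))
  next
    case (6 A B x)
    then have "A * B - B * A \<in> carrier_mat r r"
      by (intro minus_carrier_mat mult_carrier_mat[of _ r r _ r])
    with 6 show ?case by (intro eqI) (simp_all add: a1 a2 minus mem gl'.bracket_act)
  qed
  moreover have "\<Phi> \<in> LinearCombinations.module_hom class_ring M M'"
    by (auto simp: LinearCombinations.module_hom_def mem add smult)
  ultimately show ?thesis
    unfolding gl_isomorphic_def using gl D(2) car' a2 by auto
qed

lemma gl_module_free_sub_rep:
  fixes \<alpha> :: "complex mat \<Rightarrow> ('b \<Rightarrow>\<^sub>0 complex) \<Rightarrow> ('b \<Rightarrow>\<^sub>0 complex)"
  assumes U: "pm.subspace U" and lin: "\<And>A. pm_linear (\<alpha> A)"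
    and closed: "\<And>A x. A \<in> carrier_mat r r \<Longrightarrow> x \<in> U \<Longrightarrow> \<alpha> A x \<in> U"
    and add: "\<And>A B x. A \<in> carrier_mat r r \<Longrightarrow> B \<in> carrier_mat r r \<Longrightarrow> x \<in> U \<Longrightarrow> \<alpha> (A + B) x = \<alpha> A x + \<alpha> B x"
    and smult: "\<And>A c x. A \<in> carrier_mat r r \<Longrightarrow> x \<in> U \<Longrightarrow> \<alpha> (c \<cdot>\<^sub>m A) x = scale c (\<alpha> A x)"
    and bracket: "\<And>A B x. A \<in> carrier_mat r r \<Longrightarrow> B \<in> carrier_mat r r \<Longrightarrow> x \<in> U \<Longrightarrow>
      \<alpha> (A * B - B * A) x = \<alpha> A (\<alpha> B x) - \<alpha> B (\<alpha> A x)"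
  shows "gl_module r (sub_rep (free_rep B \<alpha>) U)"
proof -
  let ?M = "sub_rep (free_rep B \<alpha>) U"
  have M: "linear_model ?M (\<lambda>t. t) U" by (rule linear_model_free_sub_rep[OF U])
  have simps: "carrier ?M = U" "act ?M = \<alpha>" "\<And>x y. x \<oplus>\<^bsub>?M\<^esub> y = x + y" "\<And>c x. c \<odot>\<^bsub>?M\<^esub> x = scale c x"
    by (simp_all add: sub_rep_def free_rep_def)
  have minus: "x \<ominus>\<^bsub>?M\<^esub> y = x - y" if "x \<in> U" "y \<in> U" for x y
    using linear_model_minus[OF M, of x y] that simps(1) by simp
  show ?thesis
    by (intro gl_module.intro gl_module_axioms.intro linear_model_module[OF M])
      (simp_all add: simps minus closed add smult bracket pm_linear_add[OF lin] pm_linear_scale[OF lin])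
qed

section \<open>Orthogonal projections and associated graded representations\<close>

text \<open>The Hermitian form in which the vectors \<open>bvec b\<close> are orthonormal.\<close>

definition pm_inner :: "('b \<Rightarrow>\<^sub>0 complex) \<Rightarrow> ('b \<Rightarrow>\<^sub>0 complex) \<Rightarrow> complex" where
  "pm_inner x y = (\<Sum>b\<in>Poly_Mapping.keys x. Poly_Mapping.lookup x b * cnj (Poly_Mapping.lookup y b))"

lemma pm_inner_superset:
  assumes "finite S" "Poly_Mapping.keys x \<subseteq> S"
  shows "pm_inner x y = (\<Sum>b\<in>S. Poly_Mapping.lookup x b * cnj (Poly_Mapping.lookup y b))"
  unfolding pm_inner_def by (rule sum.mono_neutral_left) (use assms in \<open>auto simp: in_keys_iff\<close>)

lemma pm_inner_add_left: "pm_inner (x + y) z = pm_inner x z + pm_inner y z"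
proof -
  let ?S = "Poly_Mapping.keys x \<union> Poly_Mapping.keys y"
  have "Poly_Mapping.keys (x + y) \<subseteq> ?S" by (rule keys_add)
  then show ?thesis
    by (simp add: pm_inner_superset[where S = ?S] lookup_add distrib_right sum.distrib)
qed

lemma pm_inner_scale_left: "pm_inner (scale c x) z = c * pm_inner x z"
proof -
  have "Poly_Mapping.keys (scale c x) \<subseteq> Poly_Mapping.keys x" by (auto simp: in_keys_iff)
  then show ?thesis
    by (simp add: pm_inner_superset[where S = "Poly_Mapping.keys x"] sum_distrib_left mult.assoc)
qed

lemma pm_inner_commute: "pm_inner y x = cnj (pm_inner x y)"
proof -
  let ?S = "Poly_Mapping.keys x \<union> Poly_Mapping.keys y"
  show ?thesis by (simp add: pm_inner_superset[where S = ?S] mult.commute)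
qed

lemma pm_inner_zero_left [simp]: "pm_inner 0 z = 0"
  by (simp add: pm_inner_def)

lemma pm_inner_zero_right [simp]: "pm_inner z 0 = 0"
  by (subst pm_inner_commute) simp

lemma pm_inner_diff_left: "pm_inner (x - y) z = pm_inner x z - pm_inner y z"
  using pm_inner_add_left[of "x - y" y z] by simp

lemma pm_inner_add_right: "pm_inner z (x + y) = pm_inner z x + pm_inner z y"
  by (subst (1 2 3) pm_inner_commute) (simp add: pm_inner_add_left)

lemma pm_inner_scale_right: "pm_inner z (scale c x) = cnj c * pm_inner z x"
  by (subst (1 2) pm_inner_commute) (simp add: pm_inner_scale_left)

lemma pm_inner_definite: "pm_inner x x = 0 \<Longrightarrow> x = 0"
proof -
  assume "pm_inner x x = 0"
  moreover have "pm_inner x x = of_real (\<Sum>b\<in>Poly_Mapping.keys x. (cmod (Poly_Mapping.lookup x b))\<^sup>2)"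
    by (simp add: pm_inner_def complex_norm_square del: of_real_power)
  ultimately have "(\<Sum>b\<in>Poly_Mapping.keys x. (cmod (Poly_Mapping.lookup x b))\<^sup>2) = 0"
    by (simp only: of_real_eq_0_iff)
  then have "\<forall>b\<in>Poly_Mapping.keys x. (cmod (Poly_Mapping.lookup x b))\<^sup>2 = 0"
    by (subst (asm) sum_nonneg_eq_0_iff) auto
  then have "Poly_Mapping.lookup x b = 0" for b by (cases "b \<in> Poly_Mapping.keys x") (auto simp: in_keys_iff)
  then show "x = 0" by (intro poly_mapping_eqI) simp
qed

text \<open>By induction on \<open>S\<close>: the vectors of \<open>U\<close> that vanish at the new basis element form a subspace \<open>U'\<close> of
  codimension at most one, to which the induction hypothesis applies, and a vector of \<open>U\<close> orthogonal to
  \<open>U'\<close> accounts for the remaining dimension.\<close>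

lemma orthogonal_decomposition:
  assumes "finite S" "pm.subspace U" "U \<subseteq> supported S"
  shows "\<exists>u\<in>U. \<forall>w\<in>U. pm_inner (x - u) w = 0"
  using assms
proof (induction S arbitrary: U x rule: finite_induct)
  case empty
  have "U \<subseteq> {0}" using empty(2) by (auto simp: supported_def)
  then have "U = {0}" using pm.subspace_0[OF empty(1)] by auto
  then show ?case by simp
next
  case (insert b S)
  note U = insert.prems(1)
  define U' where "U' = {u \<in> U. Poly_Mapping.lookup u b = 0}"
  have U': "pm.subspace U'"
    using U unfolding U'_def pm.subspace_def by (auto simp: lookup_add)
  have "U' \<subseteq> supported S"
  proof
    fix u assume "u \<in> U'"
    then have "Poly_Mapping.keys u \<subseteq> insert b S" "b \<notin> Poly_Mapping.keys u"
      using insert.prems(2) by (auto simp: U'_def supported_def in_keys_iff)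
    then show "u \<in> supported S" unfolding supported_def by blast
  qed
  note IH = insert.IH[OF U' this]
  show ?case
  proof (cases "U' = U")
    case True
    then show ?thesis using IH by simp
  next
    case False
    then obtain w0 where w0: "w0 \<in> U" "Poly_Mapping.lookup w0 b \<noteq> 0" by (auto simp: U'_def)
    \<comment> \<open>\<open>w1\<close> spans the orthogonal complement of \<open>U'\<close> in \<open>U\<close>\<close>
    obtain p0 where p0: "p0 \<in> U'" "\<And>w. w \<in> U' \<Longrightarrow> pm_inner (w0 - p0) w = 0" using IH by blast
    define w1 where "w1 = w0 - p0"
    have w1: "w1 \<in> U" "Poly_Mapping.lookup w1 b \<noteq> 0"
      using w0 p0 pm.subspace_diff[OF U] by (auto simp: w1_def U'_def lookup_minus)
    have orth: "pm_inner w1 w = 0" "pm_inner w w1 = 0" if "w \<in> U'" for w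
      using p0(2)[OF that] pm_inner_commute[of w w1] by (auto simp: w1_def)
    have nz: "pm_inner w1 w1 \<noteq> 0" using pm_inner_definite[of w1] w1(2) by auto
    obtain p where p: "p \<in> U'" "\<And>w. w \<in> U' \<Longrightarrow> pm_inner (x - p) w = 0" using IH by blast
    define c where "c = pm_inner x w1 / pm_inner w1 w1"
    have "p + scale c w1 \<in> U"
      using p(1) w1(1) pm.subspace_add[OF U] pm.subspace_scale[OF U] by (auto simp: U'_def)
    moreover have "pm_inner (x - (p + scale c w1)) w = 0" if "w \<in> U" for w
    proof -
      define d where "d = Poly_Mapping.lookup w b / Poly_Mapping.lookup w1 b"
      define w' where "w' = w - scale d w1"
      have w': "w' \<in> U'"
        using that w1 pm.subspace_diff[OF U] pm.subspace_scale[OF U]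
        by (auto simp: w'_def U'_def lookup_minus d_def)
      have w: "w = w' + scale d w1" by (simp add: w'_def)
      show ?thesis
        using orth[OF w'] orth[OF p(1)] p(2)[OF w'] nz
        by (simp add: w pm_inner_add_right pm_inner_scale_right pm_inner_diff_left
            pm_inner_add_left pm_inner_scale_left c_def)
    qed
    ultimately show ?thesis by blast
  qed
qed

definition orth_proj :: "('b \<Rightarrow>\<^sub>0 complex) set \<Rightarrow> ('b \<Rightarrow>\<^sub>0 complex) \<Rightarrow> ('b \<Rightarrow>\<^sub>0 complex)" where
  "orth_proj U x = (SOME u. u \<in> U \<and> (\<forall>w\<in>U. pm_inner (x - u) w = 0))"

context
  fixes S :: "'b set" and U :: "('b \<Rightarrow>\<^sub>0 complex) set"
  assumes S: "finite S" and U: "pm.subspace U" "U \<subseteq> supported S"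
begin

lemma orth_proj_props: "orth_proj U x \<in> U" "w \<in> U \<Longrightarrow> pm_inner (x - orth_proj U x) w = 0"
proof -
  have "\<exists>u. u \<in> U \<and> (\<forall>w\<in>U. pm_inner (x - u) w = 0)"
    using orthogonal_decomposition[OF S U, of x] by blast
  then have "orth_proj U x \<in> U \<and> (\<forall>w\<in>U. pm_inner (x - orth_proj U x) w = 0)"
    unfolding orth_proj_def by (rule someI_ex)
  then show "orth_proj U x \<in> U" "w \<in> U \<Longrightarrow> pm_inner (x - orth_proj U x) w = 0" by auto
qed

lemma orth_proj_unique:
  assumes "u \<in> U" "\<And>w. w \<in> U \<Longrightarrow> pm_inner (x - u) w = 0" shows "orth_proj U x = u"
proof -
  let ?d = "orth_proj U x - u"
  have d: "?d \<in> U" using assms(1) orth_proj_props(1) pm.subspace_diff[OF U(1)] by blast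
  have "pm_inner ?d ?d = pm_inner (x - u) ?d - pm_inner (x - orth_proj U x) ?d"
    by (simp add: pm_inner_diff_left)
  then have "pm_inner ?d ?d = 0" using assms(2)[OF d] orth_proj_props(2)[OF d] by simp
  then show ?thesis using pm_inner_definite by fastforce
qed

lemma orth_proj_id: "x \<in> U \<Longrightarrow> orth_proj U x = x"
  by (rule orth_proj_unique) auto

lemma pm_linear_orth_proj: "pm_linear (orth_proj U)"
proof (rule pm_linearI)
  fix x y
  show "orth_proj U (x + y) = orth_proj U x + orth_proj U y"
  proof (rule orth_proj_unique)
    show "orth_proj U x + orth_proj U y \<in> U" using orth_proj_props(1) pm.subspace_add[OF U(1)] by blast
    fix w assume w: "w \<in> U"
    have "x + y - (orth_proj U x + orth_proj U y) = (x - orth_proj U x) + (y - orth_proj U y)" by simp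
    then show "pm_inner (x + y - (orth_proj U x + orth_proj U y)) w = 0"
      using orth_proj_props(2)[OF w] by (simp only: pm_inner_add_left) simp
  qed
next
  fix c x
  show "orth_proj U (scale c x) = scale c (orth_proj U x)"
  proof (rule orth_proj_unique)
    show "scale c (orth_proj U x) \<in> U" using orth_proj_props(1) pm.subspace_scale[OF U(1)] by blast
    fix w assume w: "w \<in> U"
    show "pm_inner (scale c x - scale c (orth_proj U x)) w = 0"
      using orth_proj_props(2)[OF w, of x]
      by (simp add: pm_inner_scale_left flip: pm.scale_right_diff_distrib)
  qed
qed

text \<open>If \<open>T\<close> and its adjoint preserve \<open>U\<close>, then \<open>T\<close> preserves \<open>U\<close> and its orthogonal complement, and hence
  commutes with the projection. In the application \<open>V\<close> consists of tensors whose factors lie in the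
  truncated module.\<close>

lemma orth_proj_equivariant:
  assumes T: "pm_linear T" "\<And>u. u \<in> U \<Longrightarrow> T u \<in> U" "\<And>u. u \<in> U \<Longrightarrow> T' u \<in> U"
    and adj: "\<And>u w. u \<in> V \<Longrightarrow> w \<in> V \<Longrightarrow> pm_inner (T u) w = pm_inner u (T' w)"
    and V: "pm.subspace V" "U \<subseteq> V" "x \<in> V"
  shows "orth_proj U (T x) = T (orth_proj U x)"
proof (rule orth_proj_unique)
  show "T (orth_proj U x) \<in> U" using T(2) orth_proj_props(1) by blast
  fix w assume w: "w \<in> U"
  have "x - orth_proj U x \<in> V" using V orth_proj_props(1)[of x] pm.subspace_diff by blast
  then have "pm_inner (T (x - orth_proj U x)) w = pm_inner (x - orth_proj U x) (T' w)"
    using adj w V by blast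
  also have "\<dots> = 0" using orth_proj_props(2)[OF T(3)[OF w]] .
  finally show "pm_inner (T x - T (orth_proj U x)) w = 0" by (simp add: pm_linear_diff[OF T(1)])
qed

end

lemma pm_inner_adjoint_basis:
  assumes "pm_linear f" "pm_linear f'"
    and basis: "\<And>b c. b \<in> B \<Longrightarrow> c \<in> B \<Longrightarrow>
      Poly_Mapping.lookup (f (bvec b)) c = cnj (Poly_Mapping.lookup (f' (bvec c)) b)"
    and u: "u \<in> supported B" and w: "w \<in> supported B"
  shows "pm_inner (f u) w = pm_inner u (f' w)"
proof -
  have inner_bvec: "pm_inner (bvec b) y = cnj (Poly_Mapping.lookup y b)" for b and y :: "'a \<Rightarrow>\<^sub>0 complex"
    by (simp add: pm_inner_def)
  have inner_bvec': "pm_inner y (bvec b) = Poly_Mapping.lookup y b" for b and y :: "'a \<Rightarrow>\<^sub>0 complex"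
    using pm_inner_commute[of y "bvec b"] by (simp add: inner_bvec)
  have sub1: "pm.subspace {w. pm_inner (f (bvec b)) w = pm_inner (bvec b) (f' w)}" for b
    using assms(2) by (auto simp: pm.subspace_def pm_inner_add_right pm_inner_scale_right
        pm_linear_add pm_linear_scale pm_linear_zero)
  have 1: "pm_inner (f (bvec b)) w = pm_inner (bvec b) (f' w)" if "b \<in> B" for b
  proof -
    have "bvec ` B \<subseteq> {w. pm_inner (f (bvec b)) w = pm_inner (bvec b) (f' w)}"
      by (auto simp: inner_bvec inner_bvec' basis that)
    then have "supported B \<subseteq> {w. pm_inner (f (bvec b)) w = pm_inner (bvec b) (f' w)}"
      unfolding supported_span using sub1 by (rule pm.span_minimal)
    then show ?thesis using w by blast
  qed
  have "pm.subspace {u. pm_inner (f u) w = pm_inner u (f' w)}"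
    using assms(1) by (auto simp: pm.subspace_def pm_inner_add_left pm_inner_scale_left
        pm_linear_add pm_linear_scale pm_linear_zero)
  moreover have "bvec ` B \<subseteq> {u. pm_inner (f u) w = pm_inner u (f' w)}" using 1 by blast
  ultimately have "supported B \<subseteq> {u. pm_inner (f u) w = pm_inner u (f' w)}"
    unfolding supported_span by (intro pm.span_minimal)
  then show ?thesis using u by blast
qed

text \<open>An associated graded representation is isomorphic to the filtered one under every operator that is
  adjoint to an operator preserving the filtration. The coordinate map on the \<open>m\<close>-th graded piece is
  the projection along \<open>W (m - 1)\<close> onto the orthogonal complement.\<close>

lemma graded_linear_model:
  fixes M :: "('g, 'v) rep" and \<Psi> :: "'v \<Rightarrow> ('k \<Rightarrow>\<^sub>0 complex)"
    and F :: "nat \<Rightarrow> 'v set" and W :: "nat \<Rightarrow> ('k \<Rightarrow>\<^sub>0 complex) set"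
  assumes gr_def: "gr = direct_sum_rep (\<lambda>m. quot_rep (sub_rep M (F m)) (if m = 0 then {\<zero>\<^bsub>M\<^esub>} else F (m - 1)))"
    and M: "linear_model M \<Psi> V"
    and F: "\<And>m. F m \<subseteq> carrier M" "\<And>m. \<Psi> ` F m = W m"
    and W: "\<And>m. pm.subspace (W m)" "\<And>m. W m \<subseteq> W (Suc m)"
    and S: "finite S" "\<And>m. W m \<subseteq> supported S"
  shows "\<exists>\<Theta>. linear_model gr \<Theta> (\<Union>m. W m) \<and>
    (\<forall>g T T'. pm_linear T \<longrightarrow> (\<forall>m. \<forall>u\<in>W m. T u \<in> W m \<and> T' u \<in> W m) \<longrightarrow>
      (\<forall>u\<in>supported S. \<forall>w\<in>supported S. pm_inner (T u) w = pm_inner u (T' w)) \<longrightarrow>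
      intertwines M \<Psi> g T \<longrightarrow> intertwines gr \<Theta> g T)"
proof -
  note D = linear_modelD[OF M]
  \<comment> \<open>the shift by one makes \<open>U\<close> start with the zero space, and \<open>U (Suc m)\<close> is \<open>W m\<close>\<close>
  define U where "U m = (if m = 0 then {0} else W (m - 1))" for m
  define q where "q m x = x - orth_proj (U m) x" for m x
  define FU where "FU m = (if m = 0 then {\<zero>\<^bsub>M\<^esub>} else F (m - 1))" for m
  have USuc: "U (Suc m) = W m" for m by (simp add: U_def)
  have U: "pm.subspace (U m)" for m using W(1) by (simp add: U_def pm.subspace_0 pm.subspace_def)
  have US: "U m \<subseteq> supported S" for m
    using S(2) pm.subspace_0[OF supported_subspace] by (auto simp: U_def)
  have UW: "U m \<subseteq> W m" for m
    using W(2)[of "m - 1"] pm.subspace_0[OF W(1)] by (cases m) (auto simp: U_def)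
  note proj = orth_proj_props[OF S(1) U US] and proj_id = orth_proj_id[OF S(1) U US]
  have q_lin: "pm_linear (q m)" for m
    unfolding q_def by (intro pm_linear_minus_fun pm_linear_id pm_linear_orth_proj[OF S(1) U US])
  have q_zero: "q m x = 0 \<longleftrightarrow> x \<in> U m" for m x
    using proj(1)[of m x] proj_id[of x m] by (auto simp: q_def)
  have FU: "\<Psi> ` FU m = U m" "FU m \<subseteq> F m" for m
  proof -
    show img: "\<Psi> ` FU m = U m" using D(4) F(2) by (simp add: FU_def U_def)
    show "FU m \<subseteq> F m"
    proof
      fix x assume x: "x \<in> FU m"
      then have "x \<in> carrier M" using F(1) D(3) by (auto simp: FU_def split: if_splits)
      moreover have "\<Psi> x \<in> \<Psi> ` F m" using x img UW F(2) by blast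
      ultimately show "x \<in> F m" using D(11) F(1) by blast
    qed
  qed
  have mem_F: "x \<in> F m \<longleftrightarrow> \<Psi> x \<in> W m" if "x \<in> carrier M" for x m
    using that D(11)[of x] F[of m] by blast
  have sub: "linear_model (sub_rep M (F m)) \<Psi> (W m)" for m
    by (rule linear_model_sub_rep[OF M F W(1)])
  have car_sub: "carrier (sub_rep M (F m)) = F m" for m by (simp add: sub_rep_def)
  have ker: "q m (\<Psi> x) = 0 \<longleftrightarrow> x \<in> FU m" if "x \<in> carrier (sub_rep M (F m))" for x m
  proof
    assume "q m (\<Psi> x) = 0"
    then have "\<Psi> x \<in> \<Psi> ` FU m" by (simp add: q_zero FU(1))
    then show "x \<in> FU m" using that D(11) F(1) FU(2) car_sub by blast
  next
    assume "x \<in> FU m"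
    then show "q m (\<Psi> x) = 0" using FU(1) by (auto simp: q_zero)
  qed
  have FU_sub: "FU m \<subseteq> carrier (sub_rep M (F m))" for m using FU(2) car_sub by blast
  let ?Q = "\<lambda>m. quot_rep (sub_rep M (F m)) (FU m)"
  let ?\<Theta> = "\<lambda>x. \<Sum>m | x m \<noteq> \<zero>\<^bsub>?Q m\<^esub>. quot_coord (q m) \<Psi> (x m)"
  have quot: "linear_model (?Q m) (quot_coord (q m) \<Psi>) (q m ` W m)" for m
    by (rule linear_model_quot_rep(1)[OF sub q_lin FU_sub ker])
  have gr: "gr = direct_sum_rep ?Q" by (simp add: gr_def FU_def)
  have "linear_model (direct_sum_rep ?Q) ?\<Theta> (\<Union>m. U m)"
  proof (rule linear_model_direct_sum_rep[OF quot U])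
    show "U 0 = {0}" by (simp add: U_def)
    show "q m ` W m \<subseteq> U (Suc m)" for m
      unfolding USuc q_def using proj(1) UW by (auto intro!: pm.subspace_diff[OF W(1)])
    show "U m \<subseteq> U (Suc m)" for m unfolding USuc by (rule UW)
    show "\<exists>u\<in>U m. \<exists>v\<in>q m ` W m. w = u + v" if "w \<in> U (Suc m)" for m w
    proof (intro bexI)
      show "w = orth_proj (U m) w + q m w" by (simp add: q_def)
      show "q m w \<in> q m ` W m" using that by (simp add: USuc)
      show "orth_proj (U m) w \<in> U m" by (rule proj(1))
    qed
    show "U m \<inter> q m ` W m \<subseteq> {0}" for m
    proof
      fix y assume "y \<in> U m \<inter> q m ` W m"
      then obtain x where y: "y \<in> U m" "y = x - orth_proj (U m) x" by (auto simp: q_def)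
      then have "pm_inner y y = 0" using proj(2)[of y m x] by simp
      then show "y \<in> {0}" using pm_inner_definite by auto
    qed
  qed
  moreover have "(\<Union>m. U m) = (\<Union>m. W m)"
  proof
    show "(\<Union>m. U m) \<subseteq> (\<Union>m. W m)" using UW by blast
    show "(\<Union>m. W m) \<subseteq> (\<Union>m. U m)" using USuc by blast
  qed
  ultimately have model: "linear_model gr ?\<Theta> (\<Union>m. W m)" by (simp add: gr)
  show ?thesis
  proof (intro exI conjI allI impI)
    fix g T T'
    assume T: "pm_linear T" "\<forall>m. \<forall>u\<in>W m. T u \<in> W m \<and> T' u \<in> W m"
      and adj: "\<forall>u\<in>supported S. \<forall>w\<in>supported S. pm_inner (T u) w = pm_inner u (T' w)"
      and int: "intertwines M \<Psi> g T"
    have act: "act M g x \<in> carrier M \<and> \<Psi> (act M g x) = T (\<Psi> x)" if "x \<in> carrier M" for x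
      using int that by (simp add: intertwines_def)
    have T0: "T 0 = 0" by (rule pm_linear_zero[OF T(1)])
    have T'0: "T' 0 = 0"
    proof -
      have "T' 0 \<in> supported S" using T(2) S(2) pm.subspace_0[OF W(1)] by blast
      then have "pm_inner (T (T' 0)) 0 = pm_inner (T' 0) (T' 0)"
        using adj pm.subspace_0[OF supported_subspace] by blast
      then show ?thesis using pm_inner_definite[of "T' 0"] by simp
    qed
    have TU: "T u \<in> U m" "T' u \<in> U m" if "u \<in> U m" for u m
      using that T(2) T0 T'0 by (auto simp: U_def split: if_splits)
    have equiv: "q m (T u) = T (q m u)" if "u \<in> supported S" for m u
      using orth_proj_equivariant[OF S(1) U US T(1) TU _ supported_subspace US that, of m] adj
      by (simp add: q_def pm_linear_diff[OF T(1)])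
    have qact: "act (?Q m) g C \<in> carrier (?Q m) \<and>
        quot_coord (q m) \<Psi> (act (?Q m) g C) = T (quot_coord (q m) \<Psi> C)" if C: "C \<in> carrier (?Q m)" for m C
    proof (rule linear_model_quot_rep(4)[OF sub q_lin FU_sub ker])
      show "C \<in> carrier (?Q m)" by (rule C)
      fix y assume "y \<in> carrier (sub_rep M (F m))"
      then have y: "y \<in> F m" "y \<in> carrier M" using F(1) car_sub by auto
      have yW: "\<Psi> y \<in> W m" using y mem_F by blast
      have "act M g y \<in> F m" using mem_F[of "act M g y" m] act[OF y(2)] T(2) yW by simp
      moreover have "act (sub_rep M (F m)) g y = act M g y" by (simp add: sub_rep_def)
      ultimately show "act (sub_rep M (F m)) g y \<in> carrier (sub_rep M (F m)) \<and>
          q m (\<Psi> (act (sub_rep M (F m)) g y)) = T (q m (\<Psi> y))"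
        using act[OF y(2)] equiv[of "\<Psi> y" m] yW S(2) car_sub by auto
    qed
    have "act (direct_sum_rep ?Q) g x \<in> carrier (direct_sum_rep ?Q)"
        "?\<Theta> (act (direct_sum_rep ?Q) g x) = T (?\<Theta> x)" if x: "x \<in> carrier (direct_sum_rep ?Q)" for x
      by (rule direct_sum_rep_act[OF quot T(1) _ x], rule qact, assumption)+
    then show "intertwines gr ?\<Theta> g T" unfolding intertwines_def gr by blast
  qed (rule model)
qed

section \<open>Operators on tensor powers\<close>

text \<open>The index sets \<open>{1..n}\<close> are to keep this form under simplification.\<close>

declare One_nat_def [simp del]

lemma pm_linear_lin_ext_comp: "pm_linear f \<Longrightarrow> f (lin_ext g x) = lin_ext (\<lambda>b. f (g b)) x"
  by (simp add: lin_ext_def pm_linear_sum pm_linear_scale)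

text \<open>The operator \<open>a\<close> applied to the \<open>i\<close>-th tensor factor. It is defined for every function \<open>a\<close>, whose values
  at basis vectors alone matter.\<close>

definition slot_act :: "nat \<Rightarrow> (('b \<Rightarrow>\<^sub>0 complex) \<Rightarrow> ('b \<Rightarrow>\<^sub>0 complex)) \<Rightarrow>
    ((nat \<Rightarrow> 'b) \<Rightarrow>\<^sub>0 complex) \<Rightarrow> ((nat \<Rightarrow> 'b) \<Rightarrow>\<^sub>0 complex)" where
  "slot_act i a = lin_ext (\<lambda>w. lin_ext (\<lambda>b. bvec (w(i := b))) (a (bvec (w i))))"

lemma pm_linear_slot_act [simp]: "pm_linear (slot_act i a)"
  by (simp add: slot_act_def)

lemma slot_act_bvec: "slot_act i a (bvec w) = lin_ext (\<lambda>b. bvec (w(i := b))) (a (bvec (w i)))"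
  by (simp add: slot_act_def)

lemma pm_linear_tensor_act [simp]: "pm_linear (tensor_act n \<alpha> g)"
  by (simp add: tensor_act_def)

lemma tensor_act_eq_slots: "tensor_act n \<alpha> g t = (\<Sum>i\<in>{1..n}. slot_act i (\<alpha> g) t)"
  by (rule pm_linear_eqI[where B = UNIV])
    (auto intro!: pm_linear_sum_fun simp: tensor_act_def slot_act_bvec)

text \<open>Precomposition makes this a right action of the symmetric group.\<close>

definition perm_op :: "(nat \<Rightarrow> nat) \<Rightarrow> ((nat \<Rightarrow> 'b) \<Rightarrow>\<^sub>0 complex) \<Rightarrow> ((nat \<Rightarrow> 'b) \<Rightarrow>\<^sub>0 complex)" where
  "perm_op \<sigma> = lin_ext (\<lambda>w. bvec (w \<circ> \<sigma>))"

lemma pm_linear_perm_op [simp]: "pm_linear (perm_op \<sigma>)"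
  by (simp add: perm_op_def)

lemma perm_op_bvec [simp]: "perm_op \<sigma> (bvec w) = bvec (w \<circ> \<sigma>)"
  by (simp add: perm_op_def)

lemma perm_op_comp: "perm_op \<sigma> (perm_op \<tau> t) = perm_op (\<tau> \<circ> \<sigma>) t"
  by (rule pm_linear_eqI[where B = UNIV and f = "\<lambda>t. perm_op \<sigma> (perm_op \<tau> t)" and g = "perm_op (\<tau> \<circ> \<sigma>)"])
    (auto intro!: pm_linear_compose[of "perm_op \<sigma>" "perm_op \<tau>"] simp: comp_assoc)

lemma lookup_perm_op:
  assumes "bij \<sigma>"
  shows "Poly_Mapping.lookup (perm_op \<sigma> t) w = Poly_Mapping.lookup t (w \<circ> inv_into UNIV \<sigma>)"
proof (induction t rule: poly_mapping_bvec_induct)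
  case (single v c)
  have "v \<circ> \<sigma> = w \<longleftrightarrow> v = w \<circ> inv_into UNIV \<sigma>"
    using assms by (metis bij_is_inj bij_is_surj comp_assoc comp_id inv_o_cancel surj_iff)
  then show ?case
    by (simp only: perm_op_def lin_ext_single scale_single lookup_single when_def mult_1_right)
qed (simp add: lookup_add pm_linear_add)

lemma PiE_comp_permutes:
  assumes "\<sigma> permutes {1..n}" "w \<in> {1..n} \<rightarrow>\<^sub>E B"
  shows "w \<circ> \<sigma> \<in> {1..n} \<rightarrow>\<^sub>E B"
proof (rule PiE_I)
  fix i assume "i \<in> {1..n}"
  then have "\<sigma> i \<in> {1..n}" using permutes_in_image[OF assms(1)] by blast
  then show "(w \<circ> \<sigma>) i \<in> B" using assms(2) by auto
next
  fix i assume "i \<notin> {1..n}"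
  then show "(w \<circ> \<sigma>) i = undefined"
    using permutes_not_in[OF assms(1), of i] PiE_arb[OF assms(2), of i] by simp
qed

lemma tensor_act_perm_op:
  assumes \<sigma>: "\<sigma> permutes {1..n}"
  shows "tensor_act n \<alpha> g (perm_op \<sigma> t) = perm_op \<sigma> (tensor_act n \<alpha> g t)"
proof (rule pm_linear_eqI[where B = UNIV and f = "\<lambda>t. tensor_act n \<alpha> g (perm_op \<sigma> t)"
      and g = "\<lambda>t. perm_op \<sigma> (tensor_act n \<alpha> g t)"])
  fix w :: "nat \<Rightarrow> 'a"
  have upd: "(w \<circ> \<sigma>)(i := b) = w(\<sigma> i := b) \<circ> \<sigma>" for i b
    using permutes_inj[OF \<sigma>] by (auto simp: fun_eq_iff inj_def)
  have "tensor_act n \<alpha> g (perm_op \<sigma> (bvec w)) =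
      (\<Sum>i\<in>{1..n}. lin_ext (\<lambda>b. bvec (w(\<sigma> i := b) \<circ> \<sigma>)) (\<alpha> g (bvec (w (\<sigma> i)))))"
    by (simp add: tensor_act_eq_slots slot_act_bvec upd)
  also have "\<dots> = (\<Sum>i\<in>{1..n}. lin_ext (\<lambda>b. bvec (w(i := b) \<circ> \<sigma>)) (\<alpha> g (bvec (w i))))"
    using sum.permute[OF \<sigma>, of "\<lambda>i. lin_ext (\<lambda>b. bvec (w(i := b) \<circ> \<sigma>)) (\<alpha> g (bvec (w i)))"]
    by (simp add: comp_def)
  also have "\<dots> = perm_op \<sigma> (tensor_act n \<alpha> g (bvec w))"
    by (simp add: tensor_act_eq_slots slot_act_bvec pm_linear_sum pm_linear_lin_ext_comp[of "perm_op \<sigma>"])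
  finally show "tensor_act n \<alpha> g (perm_op \<sigma> (bvec w)) = perm_op \<sigma> (tensor_act n \<alpha> g (bvec w))" .
qed (rule pm_linear_compose[OF pm_linear_tensor_act pm_linear_perm_op],
    rule pm_linear_compose[OF pm_linear_perm_op pm_linear_tensor_act], simp)

lemma tensor_act_supported:
  assumes "\<And>b. b \<in> B \<Longrightarrow> \<alpha> g (bvec b) \<in> supported B" and t: "t \<in> supported ({1..n} \<rightarrow>\<^sub>E B)"
  shows "tensor_act n \<alpha> g t \<in> supported ({1..n} \<rightarrow>\<^sub>E B)"
proof (rule pm_linear_span[OF pm_linear_tensor_act supported_subspace])
  show "t \<in> pm.span (bvec ` ({1..n} \<rightarrow>\<^sub>E B))" using t by (simp add: supported_span)
  fix y :: "(nat \<Rightarrow> 'a) \<Rightarrow>\<^sub>0 complex" assume "y \<in> bvec ` ({1..n} \<rightarrow>\<^sub>E B)"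
  then obtain w where w: "w \<in> {1..n} \<rightarrow>\<^sub>E B" "y = bvec w" by auto
  have "lin_ext (\<lambda>b. bvec (w(i := b))) (\<alpha> g (bvec (w i))) \<in> supported ({1..n} \<rightarrow>\<^sub>E B)" if "i \<in> {1..n}" for i
  proof (rule lin_ext_in_subspace[OF supported_subspace])
    fix b assume "b \<in> Poly_Mapping.keys (\<alpha> g (bvec (w i)))"
    moreover have "w i \<in> B" using w that by auto
    ultimately have "b \<in> B" using assms(1)[of "w i"] by (auto simp: supported_def)
    then have "w(i := b) \<in> {1..n} \<rightarrow>\<^sub>E B" using w that by (auto simp: PiE_def extensional_def)
    then show "bvec (w(i := b)) \<in> supported ({1..n} \<rightarrow>\<^sub>E B)" by simp
  qed
  then show "tensor_act n \<alpha> g y \<in> supported ({1..n} \<rightarrow>\<^sub>E B)"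
    using w by (auto simp: tensor_act_eq_slots slot_act_bvec intro!: pm.subspace_sum[OF supported_subspace])
qed

section \<open>Antisymmetric tensors and exterior powers\<close>

definition Alt :: "nat \<Rightarrow> ((nat \<Rightarrow> 'b) \<Rightarrow>\<^sub>0 complex) \<Rightarrow> ((nat \<Rightarrow> 'b) \<Rightarrow>\<^sub>0 complex)" where
  "Alt n t = (\<Sum>\<sigma> | \<sigma> permutes {1..n}. scale (of_int (sign \<sigma>)) (perm_op \<sigma> t))"

lemma pm_linear_Alt [simp]: "pm_linear (Alt n)"
proof -
  have eq: "Alt n = (\<lambda>t :: (nat \<Rightarrow> 'b) \<Rightarrow>\<^sub>0 complex. \<Sum>\<sigma> | \<sigma> permutes {1..n}. scale (of_int (sign \<sigma>)) (perm_op \<sigma> t))"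
    by (rule ext) (simp add: Alt_def)
  show ?thesis
    unfolding eq by (intro pm_linear_sum_fun pm_linear_scale_fun pm_linear_perm_op)
qed

lemma sign_comp_permutes:
  assumes "\<sigma> permutes {1..n}" "\<tau> permutes {1..n::nat}"
  shows "sign (\<sigma> \<circ> \<tau>) = sign \<sigma> * sign \<tau>"
  using assms permutation_permutes by (intro sign_compose) blast+

lemma sign_sq: "(of_int (sign \<tau>) :: complex) * (of_int (sign \<tau>) * c) = c"
  by (metis mult.assoc mult_1 of_int_1 of_int_mult sign_idempotent)

lemma Alt_perm_op:
  assumes "\<tau> permutes {1..n}"
  shows "Alt n (perm_op \<tau> t) = scale (of_int (sign \<tau>)) (Alt n t)"
proof -
  have "Alt n t = (\<Sum>\<sigma> | \<sigma> permutes {1..n}. scale (of_int (sign (\<tau> \<circ> \<sigma>))) (perm_op (\<tau> \<circ> \<sigma>) t))"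
    unfolding Alt_def by (rule setum_permutations_compose_left[OF assms])
  also have "\<dots> = (\<Sum>\<sigma> | \<sigma> permutes {1..n}. scale (of_int (sign \<tau>)) (scale (of_int (sign \<sigma>)) (perm_op \<sigma> (perm_op \<tau> t))))"
    by (rule sum.cong) (simp_all add: sign_comp_permutes[OF assms] scale_scale perm_op_comp)
  finally have "Alt n t = scale (of_int (sign \<tau>)) (Alt n (perm_op \<tau> t))"
    by (simp only: Alt_def scale_sum)
  then show ?thesis by (simp add: scale_scale sign_sq[of \<tau> 1, simplified])
qed

lemma perm_op_Alt:
  assumes "\<tau> permutes {1..n}"
  shows "perm_op \<tau> (Alt n t) = scale (of_int (sign \<tau>)) (Alt n t)"
proof -
  have "Alt n t = (\<Sum>\<sigma> | \<sigma> permutes {1..n}. scale (of_int (sign (\<sigma> \<circ> \<tau>))) (perm_op (\<sigma> \<circ> \<tau>) t))"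
    unfolding Alt_def by (rule sum_permutations_compose_right[OF assms])
  also have "\<dots> = (\<Sum>\<sigma> | \<sigma> permutes {1..n}. scale (of_int (sign \<tau>)) (perm_op \<tau> (scale (of_int (sign \<sigma>)) (perm_op \<sigma> t))))"
    by (rule sum.cong)
      (simp_all add: sign_comp_permutes[OF _ assms] scale_scale perm_op_comp pm_linear_scale mult.commute)
  also have "\<dots> = scale (of_int (sign \<tau>)) (perm_op \<tau> (Alt n t))"
    by (simp only: Alt_def scale_sum pm_linear_sum[OF pm_linear_perm_op])
  finally have "Alt n t = scale (of_int (sign \<tau>)) (perm_op \<tau> (Alt n t))" .
  then have "scale (of_int (sign \<tau>)) (Alt n t) = scale (of_int (sign \<tau>)) (scale (of_int (sign \<tau>)) (perm_op \<tau> (Alt n t)))"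
    by (rule arg_cong)
  then show ?thesis by (simp add: scale_scale sign_sq[of \<tau> 1, simplified])
qed

lemma tensor_act_Alt: "tensor_act n \<alpha> g (Alt n t) = Alt n (tensor_act n \<alpha> g t)"
  unfolding Alt_def by (auto simp: pm_linear_sum pm_linear_scale tensor_act_perm_op intro: sum.cong)

lemma sum_const_permutations: "(\<Sum>\<sigma> | \<sigma> permutes {1..n}. t) = scale (fact n) t"
  by (simp only: pm.sum_constant_scale card_permutations[of "{1..n}" n] card_atLeastAtMost
      finite_atLeastAtMost diff_add_inverse2 diff_Suc_1 Suc_eq_plus1 of_nat_fact)

text \<open>Up to the factor \<open>n!\<close>, the antisymmetriser is a projection onto the antisymmetric tensors.\<close>

lemma Alt_antisymmetric:
  assumes "\<And>\<sigma>. \<sigma> permutes {1..n} \<Longrightarrow> perm_op \<sigma> t = scale (of_int (sign \<sigma>)) t"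
  shows "Alt n t = scale (fact n) t"
proof -
  have "Alt n t = (\<Sum>\<sigma> | \<sigma> permutes {1..n}. t)"
    unfolding Alt_def
    by (rule sum.cong) (simp_all add: assms scale_scale sign_sq[of _ 1, simplified])
  then show ?thesis by (simp only: sum_const_permutations)
qed

lemma Alt_swap_zero:
  assumes "i \<in> {1..n}" "j \<in> {1..n}" "i \<noteq> j" "perm_op (Transposition.transpose i j) t = t"
  shows "Alt n t = 0"
proof -
  \<comment> \<open>the transposition fixes \<open>t\<close> and has sign \<open>-1\<close>\<close>
  have "Alt n t = scale (-1) (Alt n t)"
    using Alt_perm_op[OF permutes_swap_id[OF assms(1,2)], of t] assms(3,4) by (simp add: sign_swap_id)
  then have "scale 2 (Alt n t) = 0"
    by (metis (no_types) add.right_inverse one_add_one pm.scale_left_distrib pm.scale_minus_left pm.scale_one)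
  then show ?thesis by (simp add: pm.scale_eq_0_iff)
qed

lemma Alt_bvec_not_inj:
  assumes "\<not> inj_on w {1..n}" shows "Alt n (bvec w) = 0"
proof -
  obtain i j where ij: "i \<in> {1..n}" "j \<in> {1..n}" "i \<noteq> j" "w i = w j"
    using assms by (auto simp: inj_on_def)
  then have "w \<circ> Transposition.transpose i j = w" by (auto simp: fun_eq_iff Transposition.transpose_def)
  then show ?thesis using Alt_swap_zero[OF ij(1-3), of "bvec w"] by simp
qed

text \<open>Outside of the product of the supports one of the factors vanishes, so the product formula extends to
  all indices; multilinearity and the behaviour under permutations can be read off from it.\<close>

lemma lookup_pure_tensor:
  "Poly_Mapping.lookup (pure_tensor n v) w =
    (if w \<in> extensional {1..n} then \<Prod>i\<in>{1..n}. Poly_Mapping.lookup (v i) (w i) else 0)"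
proof -
  let ?P = "\<Pi>\<^sub>E i\<in>{1..n}. Poly_Mapping.keys (v i)"
  have fin: "finite ?P" by (intro finite_PiE) auto
  have "Poly_Mapping.lookup (pure_tensor n v) w =
      (if w \<in> ?P then \<Prod>i\<in>{1..n}. Poly_Mapping.lookup (v i) (w i) else 0)"
    using fin by (simp add: pure_tensor_def lookup_sum lookup_single when_def)
  also have "\<dots> = (if w \<in> extensional {1..n} then \<Prod>i\<in>{1..n}. Poly_Mapping.lookup (v i) (w i) else 0)"
    by (auto simp: PiE_def Pi_def in_keys_iff)
  finally show ?thesis .
qed

lemma keys_pure_tensor: "Poly_Mapping.keys (pure_tensor n v) = (\<Pi>\<^sub>E i\<in>{1..n}. Poly_Mapping.keys (v i))"
  by (auto simp: in_keys_iff lookup_pure_tensor PiE_def Pi_def split: if_splits)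

lemma pure_tensor_bvec:
  assumes "w \<in> extensional {1..n}"
  shows "pure_tensor n (\<lambda>i. bvec (w i)) = bvec w"
proof (rule poly_mapping_eqI)
  fix u
  show "Poly_Mapping.lookup (pure_tensor n (\<lambda>i. bvec (w i))) u = Poly_Mapping.lookup (bvec w) u"
    using assms extensionalityI[of w "{1..n}" u]
    by (auto simp: lookup_pure_tensor lookup_single when_def)
qed

lemma pure_tensor_cong: "(\<And>i. i \<in> {1..n} \<Longrightarrow> v i = v' i) \<Longrightarrow> pure_tensor n v = pure_tensor n v'"
  by (rule poly_mapping_eqI) (simp add: lookup_pure_tensor)

lemma pure_tensor_add:
  assumes "i \<in> {1..n}"
  shows "pure_tensor n (v(i := x + y)) = pure_tensor n (v(i := x)) + pure_tensor n (v(i := y))"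
proof (rule poly_mapping_eqI)
  fix w
  have "(\<Prod>k\<in>{1..n}. Poly_Mapping.lookup ((v(i := z)) k) (w k)) =
      Poly_Mapping.lookup z (w i) * (\<Prod>k\<in>{1..n} - {i}. Poly_Mapping.lookup (v k) (w k))" for z
    using assms by (subst prod.remove[of _ i]) auto
  then show "Poly_Mapping.lookup (pure_tensor n (v(i := x + y))) w =
      Poly_Mapping.lookup (pure_tensor n (v(i := x)) + pure_tensor n (v(i := y))) w"
    by (simp add: lookup_pure_tensor lookup_add distrib_right del: fun_upd_apply)
qed

lemma perm_op_pure_tensor:
  fixes v :: "nat \<Rightarrow> ('b \<Rightarrow>\<^sub>0 complex)"
  assumes \<tau>: "\<tau> permutes {1..n}"
  shows "perm_op \<tau> (pure_tensor n v) = pure_tensor n (v \<circ> \<tau>)"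
proof (rule poly_mapping_eqI)
  fix w :: "nat \<Rightarrow> 'b"
  have inv: "inv_into UNIV \<tau> permutes {1..n}" using permutes_inv[OF \<tau>] .
  have ext: "w \<circ> inv_into UNIV \<tau> \<in> extensional {1..n} \<longleftrightarrow> w \<in> extensional {1..n}"
  proof -
    have *: "u \<circ> \<rho> \<in> extensional {1..n}" if "\<rho> permutes {1..n}" "u \<in> extensional {1..n}" for \<rho> and u :: "nat \<Rightarrow> 'b"
      using PiE_comp_permutes[OF that(1), of u UNIV] that(2) by (auto simp: PiE_def)
    have "w \<circ> inv_into UNIV \<tau> \<circ> \<tau> = w" using permutes_inv_o(2)[OF \<tau>] by (simp add: comp_assoc)
    then show ?thesis using *[OF inv, of w] *[OF \<tau>, of "w \<circ> inv_into UNIV \<tau>"] by auto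
  qed
  have "(\<Prod>i\<in>{1..n}. Poly_Mapping.lookup (v i) (w (inv_into UNIV \<tau> i))) =
      (\<Prod>i\<in>{1..n}. Poly_Mapping.lookup (v (\<tau> i)) (w i))"
    using prod.permute[OF \<tau>, of "\<lambda>i. Poly_Mapping.lookup (v i) (w (inv_into UNIV \<tau> i))"]
    by (simp add: comp_def permutes_inverses[OF \<tau>])
  then show "Poly_Mapping.lookup (perm_op \<tau> (pure_tensor n v)) w = Poly_Mapping.lookup (pure_tensor n (v \<circ> \<tau>)) w"
    using ext by (simp add: lookup_perm_op[OF permutes_bij[OF \<tau>]] lookup_pure_tensor)
qed

definition alt_generators :: "nat \<Rightarrow> 'b set \<Rightarrow> ((nat \<Rightarrow> 'b) \<Rightarrow>\<^sub>0 complex) set" where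
  "alt_generators n B = {pure_tensor n v |v. (\<forall>i\<in>{1..n}. Poly_Mapping.keys (v i) \<subseteq> B) \<and>
      (\<exists>i\<in>{1..n}. \<exists>j\<in>{1..n}. i \<noteq> j \<and> v i = v j)}"

lemma alt_relations_span:
  fixes B :: "'b set" and \<alpha> :: "'g \<Rightarrow> ('b \<Rightarrow>\<^sub>0 complex) \<Rightarrow> ('b \<Rightarrow>\<^sub>0 complex)"
  shows
  "alt_relations n B \<alpha> \<subseteq> supported ({1..n} \<rightarrow>\<^sub>E B)"
  "alt_relations n B \<alpha> = pm.span (alt_generators n B)"
proof -
  have "x \<in> carrier (tensor_power n B \<alpha>)" if x: "x \<in> alt_generators n B" for x
  proof -
    obtain v where v: "x = pure_tensor n v" "\<forall>i\<in>{1..n}. Poly_Mapping.keys (v i) \<subseteq> B"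
      using x unfolding alt_generators_def by blast
    then have "Poly_Mapping.keys x \<subseteq> {1..n} \<rightarrow>\<^sub>E B"
      by (simp only: keys_pure_tensor) (intro PiE_mono, blast)
    then show ?thesis by (simp add: tensor_power_def free_rep_def)
  qed
  then have "alt_generators n B \<subseteq> carrier (tensor_power n B \<alpha>)" by blast
  moreover have "linear_model (tensor_power n B \<alpha>) (\<lambda>t. t) (supported ({1..n} \<rightarrow>\<^sub>E B))"
    unfolding tensor_power_def by (rule linear_model_free_rep)
  ultimately show "alt_relations n B \<alpha> = pm.span (alt_generators n B)"
      "alt_relations n B \<alpha> \<subseteq> supported ({1..n} \<rightarrow>\<^sub>E B)"
    using linear_model_span[of "tensor_power n B \<alpha>" "\<lambda>t. t"]
    by (auto simp: alt_relations_def alt_generators_def tensor_power_def free_rep_def supported_def)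
qed

lemma Alt_alt_generators: "x \<in> alt_generators n B \<Longrightarrow> Alt n x = 0"
proof -
  assume "x \<in> alt_generators n B"
  then obtain v i j where x: "x = pure_tensor n v" "i \<in> {1..n}" "j \<in> {1..n}" "i \<noteq> j" "v i = v j"
    by (auto simp: alt_generators_def)
  have "v \<circ> Transposition.transpose i j = v" using x(5) by (auto simp: fun_eq_iff Transposition.transpose_def)
  then show ?thesis
    using x Alt_swap_zero[OF x(2-4)] perm_op_pure_tensor[OF permutes_swap_id[OF x(2,3)], of v] by simp
qed

text \<open>The polarisation of the alternating relations: expand the pure tensor with the sum of the \<open>i\<close>-th and
  the \<open>j\<close>-th factor of \<open>w\<close> in both of these slots.\<close>

lemma swap_in_alt_span:
  assumes w: "w \<in> {1..n} \<rightarrow>\<^sub>E B" and ij: "i \<in> {1..n}" "j \<in> {1..n}" "i \<noteq> j"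
  shows "bvec w + bvec (w \<circ> Transposition.transpose i j) \<in> pm.span (alt_generators n B)"
proof -
  define v where "v x y = (\<lambda>k. bvec (w k))(i := x, j := y)" for x y
  let ?a = "bvec (w i)" and ?b = "bvec (w j)"
  have gen: "pure_tensor n (v x x) \<in> alt_generators n B" if "Poly_Mapping.keys x \<subseteq> B" for x
  proof -
    have "v x x i = v x x j" using ij(3) by (simp add: v_def)
    moreover have "\<forall>k\<in>{1..n}. Poly_Mapping.keys (v x x k) \<subseteq> B" using that w by (auto simp: v_def)
    ultimately show ?thesis unfolding alt_generators_def using ij by blast
  qed
  have B: "w i \<in> B" "w j \<in> B" using w ij by auto
  have keys: "Poly_Mapping.keys (?a + ?b) \<subseteq> B" using keys_add[of ?a ?b] B by auto
  have addr: "pure_tensor n (v x (y + z)) = pure_tensor n (v x y) + pure_tensor n (v x z)" for x y z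
    unfolding v_def by (rule pure_tensor_add[OF ij(2)])
  have addl: "pure_tensor n (v (y + z) x) = pure_tensor n (v y x) + pure_tensor n (v z x)" for x y z
    using pure_tensor_add[OF ij(1), of "(\<lambda>k. bvec (w k))(j := x)" y z] ij(3)
    by (simp add: v_def fun_upd_twist)
  have ext: "w \<in> extensional {1..n}" "w \<circ> Transposition.transpose i j \<in> extensional {1..n}"
    using w PiE_comp_permutes[OF permutes_swap_id[OF ij(1,2)] w] by (auto simp: PiE_def)
  have "v ?a ?b = (\<lambda>k. bvec (w k))" by (auto simp: v_def)
  then have ab: "pure_tensor n (v ?a ?b) = bvec w" using pure_tensor_bvec[OF ext(1)] by simp
  have "v ?b ?a = (\<lambda>k. bvec ((w \<circ> Transposition.transpose i j) k))"
    by (auto simp: v_def Transposition.transpose_def fun_eq_iff)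
  then have ba: "pure_tensor n (v ?b ?a) = bvec (w \<circ> Transposition.transpose i j)"
    using pure_tensor_bvec[OF ext(2)] by simp
  have "bvec w + bvec (w \<circ> Transposition.transpose i j) =
      pure_tensor n (v (?a + ?b) (?a + ?b)) - pure_tensor n (v ?a ?a) - pure_tensor n (v ?b ?b)"
    by (simp add: addr addl ab ba)
  also have "\<dots> \<in> pm.span (alt_generators n B)"
    using keys B by (intro pm.span_diff pm.span_base gen) auto
  finally show ?thesis .
qed

lemma perm_in_alt_span:
  assumes "\<sigma> permutes {1..n}" "w \<in> {1..n} \<rightarrow>\<^sub>E B"
  shows "bvec (w \<circ> \<sigma>) - scale (of_int (sign \<sigma>)) (bvec w) \<in> pm.span (alt_generators n B)"
  using finite_atLeastAtMost assms
proof (induction \<sigma> arbitrary: w rule: permutes_rev_induct)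
  case id
  show ?case by (simp add: sign_id pm.span_zero)
next
  case (swap a b p)
  let ?t = "Transposition.transpose a b"
  have "sign (p \<circ> ?t) = - sign p"
    using sign_comp_permutes[OF swap.hyps(4) permutes_swap_id[OF swap.hyps(1,2)]] swap.hyps(3)
    by (simp add: sign_swap_id)
  then have "bvec (w \<circ> (p \<circ> ?t)) - scale (of_int (sign (p \<circ> ?t))) (bvec w) =
      (bvec (w \<circ> p) + bvec (w \<circ> p \<circ> ?t)) - (bvec (w \<circ> p) - scale (of_int (sign p)) (bvec w))"
    by (simp add: comp_assoc)
  also have "\<dots> \<in> pm.span (alt_generators n B)"
  proof (rule pm.span_diff)
    show "bvec (w \<circ> p) + bvec (w \<circ> p \<circ> ?t) \<in> pm.span (alt_generators n B)"
      by (rule swap_in_alt_span[OF PiE_comp_permutes[OF swap.hyps(4) swap.prems] swap.hyps(1-3)])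
    show "bvec (w \<circ> p) - scale (of_int (sign p)) (bvec w) \<in> pm.span (alt_generators n B)"
      using swap.IH[OF swap.prems] by (simp add: comp_def)
  qed
  finally show ?case .
qed

text \<open>Modulo the alternating relations a permutation acts by its sign, so \<open>Alt n x\<close> is congruent to \<open>n! x\<close>.
  Therefore \<open>x\<close> is a relation as soon as \<open>Alt n x\<close> vanishes.\<close>

lemma Alt_eq_zero_iff:
  assumes "x \<in> supported ({1..n} \<rightarrow>\<^sub>E B)"
  shows "Alt n x = 0 \<longleftrightarrow> x \<in> alt_relations n B \<alpha>"
proof
  assume "x \<in> alt_relations n B \<alpha>"
  then have x: "x \<in> pm.span (alt_generators n B)" by (simp add: alt_relations_span)
  have "Alt n x \<in> {0}"
    by (rule pm_linear_span[OF pm_linear_Alt _ _ x]) (auto simp: Alt_alt_generators pm.subspace_def)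
  then show "Alt n x = 0" by simp
next
  assume 0: "Alt n x = 0"
  let ?f = "\<lambda>x. Alt n x - scale (fact n) x"
  have "?f x \<in> pm.span (alt_generators n B)"
  proof (rule pm_linear_span[of ?f])
    show "pm_linear ?f"
      by (intro pm_linear_minus_fun pm_linear_Alt pm_linear_scale_fun pm_linear_id)
    show "x \<in> pm.span (bvec ` ({1..n} \<rightarrow>\<^sub>E B))" using assms by (simp add: supported_span)
    fix y :: "(nat \<Rightarrow> 'a) \<Rightarrow>\<^sub>0 complex" assume "y \<in> bvec ` ({1..n} \<rightarrow>\<^sub>E B)"
    then obtain w where w: "w \<in> {1..n} \<rightarrow>\<^sub>E B" "y = bvec w" by auto
    have "?f y = (\<Sum>\<sigma> | \<sigma> permutes {1..n}. scale (of_int (sign \<sigma>)) (perm_op \<sigma> y) - y)"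
      by (simp only: Alt_def sum_subtractf sum_const_permutations)
    also have "\<dots> = (\<Sum>\<sigma> | \<sigma> permutes {1..n}.
        scale (of_int (sign \<sigma>)) (bvec (w \<circ> \<sigma>) - scale (of_int (sign \<sigma>)) (bvec w)))"
      by (rule sum.cong)
        (simp_all add: w pm.scale_right_diff_distrib scale_scale sign_sq[of _ 1, simplified])
    also have "\<dots> \<in> pm.span (alt_generators n B)"
      by (intro pm.span_sum pm.span_scale perm_in_alt_span w) auto
    finally show "?f y \<in> pm.span (alt_generators n B)" .
  qed (rule pm.subspace_span)
  then have "scale (- 1 / fact n) (?f x) \<in> pm.span (alt_generators n B)" by (rule pm.span_scale)
  then show "x \<in> alt_relations n B \<alpha>"
    using 0 by (simp add: alt_relations_span scale_scale flip: pm.scale_minus_left)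
qed

lemma linear_model_exterior_power:
  fixes n :: nat and \<alpha> :: "'g \<Rightarrow> ('b \<Rightarrow>\<^sub>0 complex) \<Rightarrow> ('b \<Rightarrow>\<^sub>0 complex)"
    and v :: "nat \<Rightarrow> ('b \<Rightarrow>\<^sub>0 complex)"
  defines "\<Psi> \<equiv> quot_coord (Alt n) (\<lambda>t. t)"
  shows "linear_model (exterior_power n B \<alpha>) \<Psi> (Alt n ` supported ({1..n} \<rightarrow>\<^sub>E B))"
    and "(\<And>i. i \<in> {1..n} \<Longrightarrow> Poly_Mapping.keys (v i) \<subseteq> B) \<Longrightarrow>
      wedge n B \<alpha> v \<in> carrier (exterior_power n B \<alpha>) \<and> \<Psi> (wedge n B \<alpha> v) = Alt n (pure_tensor n v)"
    and "\<lbrakk>\<And>b. b \<in> B \<Longrightarrow> \<alpha> g (bvec b) \<in> supported B; x \<in> carrier (exterior_power n B \<alpha>)\<rbrakk> \<Longrightarrow>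
      act (exterior_power n B \<alpha>) g x \<in> carrier (exterior_power n B \<alpha>) \<and>
      \<Psi> (act (exterior_power n B \<alpha>) g x) = tensor_act n \<alpha> g (\<Psi> x)"
proof -
  let ?T = "tensor_power n B \<alpha>"
  have M: "linear_model ?T (\<lambda>t. t) (supported ({1..n} \<rightarrow>\<^sub>E B))"
    unfolding tensor_power_def by (rule linear_model_free_rep)
  have car: "carrier ?T = supported ({1..n} \<rightarrow>\<^sub>E B)"
    by (simp add: tensor_power_def free_rep_def supported_def)
  have U: "alt_relations n B \<alpha> \<subseteq> carrier ?T" using alt_relations_span(1) car by blast
  have ker: "Alt n x = 0 \<longleftrightarrow> x \<in> alt_relations n B \<alpha>" if "x \<in> carrier ?T" for x
    using Alt_eq_zero_iff that car by blast
  note Q = linear_model_quot_rep[OF M pm_linear_Alt U ker]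
  show "linear_model (exterior_power n B \<alpha>) \<Psi> (Alt n ` supported ({1..n} \<rightarrow>\<^sub>E B))"
    unfolding exterior_power_def \<Psi>_def by (rule Q(1))
  show "wedge n B \<alpha> v \<in> carrier (exterior_power n B \<alpha>) \<and> \<Psi> (wedge n B \<alpha> v) = Alt n (pure_tensor n v)"
    if "\<And>i. i \<in> {1..n} \<Longrightarrow> Poly_Mapping.keys (v i) \<subseteq> B"
  proof -
    have "pure_tensor n v \<in> carrier ?T"
      using that by (auto simp: car supported_def keys_pure_tensor PiE_def Pi_def)
    then show ?thesis
      unfolding wedge_def exterior_power_def \<Psi>_def using Q(2,3) by blast
  qed
  show "act (exterior_power n B \<alpha>) g x \<in> carrier (exterior_power n B \<alpha>) \<and>
      \<Psi> (act (exterior_power n B \<alpha>) g x) = tensor_act n \<alpha> g (\<Psi> x)"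
    if B: "\<And>b. b \<in> B \<Longrightarrow> \<alpha> g (bvec b) \<in> supported B" and x: "x \<in> carrier (exterior_power n B \<alpha>)"
    unfolding exterior_power_def \<Psi>_def
  proof (rule Q(4))
    show "x \<in> carrier (quot_rep ?T (alt_relations n B \<alpha>))" using x by (simp add: exterior_power_def)
    fix y assume "y \<in> carrier ?T"
    moreover have "act ?T g y = tensor_act n \<alpha> g y" by (simp add: tensor_power_def free_rep_def)
    ultimately show "act ?T g y \<in> carrier ?T \<and> Alt n (act ?T g y) = tensor_act n \<alpha> g (Alt n y)"
      using tensor_act_supported[of B \<alpha> g y n] B by (simp add: car tensor_act_Alt)
  qed
qed

section \<open>The action on the tensor powers of the truncated Laurent module\<close>

lemma pm_linear_letter_act: "pm_linear (letter_act l)"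
  by (intro pm_linearI letter_act_add letter_act_scale)

text \<open>Multiplication by \<open>x\<close> raises the degree, and \<open>x \<partial>/\<partial>x\<close> multiplies each power of \<open>x\<close> by a scalar.\<close>

lemma xy_act_raises_degree: "xy_act a (bvec i) \<in> supported {i..}"
proof -
  have letter: "letter_act l f \<in> supported {i..}" if "f \<in> supported {i..}" for l f and i :: int
  proof (rule pm_linear_span[OF pm_linear_letter_act supported_subspace])
    show "f \<in> pm.span (bvec ` {i..})" using that by (simp add: supported_span)
    fix x assume "x \<in> bvec ` {i..}"
    then obtain j where "i \<le> j" "x = bvec j" by auto
    then show "letter_act l x \<in> supported {i..}"
      by (cases l) (auto simp: mult_single laurent_deriv_def supported_def)
  qed
  have word: "word_act w (bvec i) \<in> supported {i..}" for w and i :: int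
  proof (cases w)
    case (Word ls)
    have "foldr letter_act ls (bvec i) \<in> supported {i..}" by (induction ls) (simp_all add: letter)
    then show ?thesis using Word by simp
  qed
  show ?thesis
  proof (induction a rule: xy_alg.abs_induct)
    case (1 p)
    show ?case
      unfolding xy_act.abs_eq free_act_def by (intro lin_ext_in_subspace supported_subspace word)
  qed
qed

lemma xy_act_const_mult: "xy_act (xy_const c * a) f = scale c (xy_act a f)"
proof -
  have "xy_act (xy_const c) g = scale c g" for g
    by transfer (simp add: free_act_single zero_word_def)
  then show ?thesis by (simp add: xy_act_mult)
qed

lemma xy_act_one: "xy_act 1 f = f"
  by transfer (simp add: free_act_single zero_word_def flip: single_one)

lemma xy_act_monomial:
  "xy_act (xy_X ^ p * xy_Y ^ q) (bvec i) = Poly_Mapping.single (i + int p) (of_int i ^ q)"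
proof -
  have lin: "xy_act a (scale c f) = scale c (xy_act a f)" for a c f
    by transfer (rule free_act_scale_right)
  have Y: "xy_act (xy_Y ^ q) (bvec i) = scale (of_int i ^ q) (bvec i)"
  proof (induction q)
    case (Suc q)
    have "xy_act xy_Y (bvec i) = scale (of_int i) (bvec i)"
      by (simp add: xy_act_Y laurent_deriv_def mult_single scale_single)
    then show ?case using Suc by (simp add: xy_act_mult lin scale_scale mult.commute)
  qed (simp add: xy_act_one)
  have X: "xy_act (xy_X ^ p) (bvec i) = bvec (i + int p)"
  proof (induction p)
    case (Suc p)
    then show ?case by (simp add: xy_act_mult xy_act_X mult_single algebra_simps)
  qed (simp add: xy_act_one)
  show ?thesis by (simp only: xy_act_mult Y lin X) (simp add: scale_single)
qed

lemma pm_linear_laurent_trunc [simp]: "pm_linear (laurent_trunc N k)"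
  by (simp add: laurent_trunc_def)

lemma VN_act_bvec:
  "VN_act r N A (bvec (j, i)) = (\<Sum>k<r. laurent_trunc N k (xy_act (A $$ (k, j)) (bvec i)))"
  by (simp add: VN_act_def)

lemma VN_act_raises_degree:
  "VN_act r N A (bvec (j, i)) \<in> supported {b \<in> VN_basis r N. i \<le> snd b}"
  unfolding VN_act_bvec
proof (rule pm.subspace_sum[OF supported_subspace])
  fix k assume k: "k \<in> {..<r}"
  show "laurent_trunc N k (xy_act (A $$ (k, j)) (bvec i)) \<in> supported {b \<in> VN_basis r N. i \<le> snd b}"
    unfolding laurent_trunc_def
  proof (rule lin_ext_in_subspace[OF supported_subspace])
    fix i' assume "i' \<in> Poly_Mapping.keys (xy_act (A $$ (k, j)) (bvec i))"
    then have "i \<le> i'" using xy_act_raises_degree[of "A $$ (k, j)" i] by (auto simp: supported_def)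
    then show "(if i' < N then bvec (k, i') else 0) \<in> supported {b \<in> VN_basis r N. i \<le> snd b}"
      using k by (auto simp: VN_basis_def pm.subspace_0[OF supported_subspace])
  qed
qed

lemma VN_act_gl_tensor:
  assumes "g \<in> carrier_mat r r" "j < r"
  shows "VN_act r N (gl_tensor g a) (bvec (j, i)) =
    (\<Sum>k<r. scale (g $$ (k, j)) (laurent_trunc N k (xy_act a (bvec i))))"
  unfolding VN_act_bvec
  by (rule sum.cong) (use assms in \<open>auto simp: gl_tensor_def xy_act_const_mult pm_linear_scale\<close>)

lemma VN_act_gl_tensor_one:
  assumes "g \<in> carrier_mat r r" "j < r" "i < N"
  shows "VN_act r N (gl_tensor g 1) (bvec (j, i)) = (\<Sum>k<r. scale (g $$ (k, j)) (bvec (k, i)))"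
  using assms by (simp add: VN_act_gl_tensor xy_act_one laurent_trunc_def)

definition unit_mat :: "nat \<Rightarrow> nat \<Rightarrow> nat \<Rightarrow> complex mat" where
  "unit_mat r k j = mat r r (\<lambda>(a, b). if a = k \<and> b = j then 1 else 0)"

lemma unit_mat_carrier [simp]: "unit_mat r k j \<in> carrier_mat r r"
  by (simp add: unit_mat_def)

lemma VN_act_unit_mat:
  assumes "k < r" "j < r" "j' < r"
  shows "VN_act r N (gl_tensor (unit_mat r k j) (xy_X ^ p * xy_Y ^ q)) (bvec (j', i)) =
    (if j' = j then scale (of_int i ^ q) (if i + int p < N then bvec (k, i + int p) else 0) else 0)"
proof -
  have "VN_act r N (gl_tensor (unit_mat r k j) (xy_X ^ p * xy_Y ^ q)) (bvec (j', i)) =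
      (\<Sum>l<r. if l = k then (if j' = j then scale (of_int i ^ q) (if i + int p < N then bvec (k, i + int p) else 0) else 0) else 0)"
    unfolding VN_act_gl_tensor[OF unit_mat_carrier assms(3)]
    by (rule sum.cong) (use assms in \<open>auto simp: unit_mat_def xy_act_monomial laurent_trunc_def\<close>)
  then show ?thesis using assms by simp
qed

lemma G_filt_monomial:
  assumes "g \<in> carrier_mat r r"
  shows "gl_tensor g (xy_X ^ p * xy_Y ^ q) \<in> G_filt r q"
proof -
  have "gl_tensor g (xy_X ^ p * xy_Y ^ q) \<in> carrier_mat r r"
    using assms by (simp add: gl_tensor_def)
  then show ?thesis
    using G_filt.add[OF G_filt.zero assms, of q q p] by simp
qed

lemma gl_tensor_one_G_filt: "g \<in> carrier_mat r r \<Longrightarrow> gl_tensor g 1 \<in> G_filt r 0"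
  using G_filt_monomial[of g r 0 0] by simp

lemma tensor_act_gl_one_bvec:
  assumes g: "g \<in> carrier_mat r r" and w: "w \<in> {1..n} \<rightarrow>\<^sub>E VN_basis r N"
  shows "tensor_act n (VN_act r N) (gl_tensor g 1) (bvec w) =
    (\<Sum>i\<in>{1..n}. \<Sum>k<r. scale (g $$ (k, fst (w i))) (bvec (w(i := (k, snd (w i))))))"
proof -
  have "slot_act i (VN_act r N (gl_tensor g 1)) (bvec w) =
      (\<Sum>k<r. scale (g $$ (k, fst (w i))) (bvec (w(i := (k, snd (w i))))))" if "i \<in> {1..n}" for i
  proof -
    have "w i \<in> VN_basis r N" using w that by (rule PiE_mem)
    then have "VN_act r N (gl_tensor g 1) (bvec (fst (w i), snd (w i))) =
        (\<Sum>k<r. scale (g $$ (k, fst (w i))) (bvec (k, snd (w i))))"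
      by (intro VN_act_gl_tensor_one[OF g]) (auto simp: VN_basis_def)
    then show ?thesis by (simp add: slot_act_bvec pm_linear_sum lin_ext_scale)
  qed
  then show ?thesis by (simp add: tensor_act_eq_slots)
qed

definition adjoint_mat :: "nat \<Rightarrow> complex mat \<Rightarrow> complex mat" where
  "adjoint_mat r g = mat r r (\<lambda>(a, b). cnj (g $$ (b, a)))"

lemma adjoint_mat_carrier [simp]: "adjoint_mat r g \<in> carrier_mat r r"
  by (simp add: adjoint_mat_def)

text \<open>The adjoint of a sum of one-factor operators is the sum of their adjoints, and on a single factor the
  matrix \<open>g\<close> has its conjugate transpose as adjoint, in the orthonormal basis of the \<open>u\<^sub>j \<otimes> x\<^sup>i\<close>.\<close>

lemma tensor_act_adjoint:
  assumes g: "g \<in> carrier_mat r r"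
    and u: "u \<in> supported ({1..n} \<rightarrow>\<^sub>E VN_basis r N)" and w: "w \<in> supported ({1..n} \<rightarrow>\<^sub>E VN_basis r N)"
  shows "pm_inner (tensor_act n (VN_act r N) (gl_tensor g 1) u) w =
    pm_inner u (tensor_act n (VN_act r N) (gl_tensor (adjoint_mat r g) 1) w)"
proof (rule pm_inner_adjoint_basis[OF pm_linear_tensor_act pm_linear_tensor_act _ u w])
  \<comment> \<open>the matrix entry at \<open>(b, c)\<close> is a sum over the slots outside of which \<open>b\<close> and \<open>c\<close> agree\<close>
  have entry: "Poly_Mapping.lookup (tensor_act n (VN_act r N) (gl_tensor g 1) (bvec b)) c =
      (\<Sum>i\<in>{1..n}. if b(i := c i) = c \<and> snd (b i) = snd (c i) then g $$ (fst (c i), fst (b i)) else 0)"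
    if g: "g \<in> carrier_mat r r" and b: "b \<in> {1..n} \<rightarrow>\<^sub>E VN_basis r N" and c: "c \<in> {1..n} \<rightarrow>\<^sub>E VN_basis r N"
    for g b c
  proof -
    have "(\<Sum>k<r. g $$ (k, fst (b i)) * Poly_Mapping.lookup (bvec (b(i := (k, snd (b i))))) c) =
        (if b(i := c i) = c \<and> snd (b i) = snd (c i) then g $$ (fst (c i), fst (b i)) else 0)"
      if "i \<in> {1..n}" for i
    proof -
      have "b(i := (k, snd (b i))) = c \<longleftrightarrow> k = fst (c i) \<and> b(i := c i) = c \<and> snd (b i) = snd (c i)" for k
        by (metis fst_conv snd_conv fun_upd_same prod.collapse)
      then have "(\<Sum>k<r. g $$ (k, fst (b i)) * Poly_Mapping.lookup (bvec (b(i := (k, snd (b i))))) c) =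
          (\<Sum>k<r. if k = fst (c i) then
            (if b(i := c i) = c \<and> snd (b i) = snd (c i) then g $$ (fst (c i), fst (b i)) else 0) else 0)"
        by (intro sum.cong) (auto simp: lookup_single when_def)
      moreover have "fst (c i) < r" using PiE_mem[OF c that] by (auto simp: VN_basis_def)
      ultimately show ?thesis by simp
    qed
    then show ?thesis by (simp add: tensor_act_gl_one_bvec[OF g b] lookup_sum)
  qed
  fix b c assume b: "b \<in> {1..n} \<rightarrow>\<^sub>E VN_basis r N" and c: "c \<in> {1..n} \<rightarrow>\<^sub>E VN_basis r N"
  have "(if b(i := c i) = c \<and> snd (b i) = snd (c i) then g $$ (fst (c i), fst (b i)) else 0) =
      cnj (if c(i := b i) = b \<and> snd (c i) = snd (b i) then adjoint_mat r g $$ (fst (b i), fst (c i)) else 0)"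
    if "i \<in> {1..n}" for i
  proof -
    have "fst (b i) < r" "fst (c i) < r"
      using PiE_mem[OF b that] PiE_mem[OF c that] by (auto simp: VN_basis_def)
    moreover have "b(i := c i) = c \<longleftrightarrow> c(i := b i) = b" by (metis fun_upd_triv fun_upd_upd)
    ultimately show ?thesis by (auto simp: adjoint_mat_def)
  qed
  then show "Poly_Mapping.lookup (tensor_act n (VN_act r N) (gl_tensor g 1) (bvec b)) c =
      cnj (Poly_Mapping.lookup (tensor_act n (VN_act r N) (gl_tensor (adjoint_mat r g) 1) (bvec c)) b)"
    unfolding entry[OF g b c] entry[OF adjoint_mat_carrier c b] cnj_sum by (intro sum.cong refl)
qed

section \<open>The submodule generated by a wedge of basis vectors\<close>

text \<open>The Vandermonde argument: a subspace that contains all the power moments of the vectors \<open>z i\<close> at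
  distinct nodes \<open>c i\<close> contains the vectors themselves.\<close>

lemma power_moments_in_subspace:
  fixes c :: "'i \<Rightarrow> complex" and z :: "'i \<Rightarrow> ('b \<Rightarrow>\<^sub>0 complex)"
  assumes "finite I" "inj_on c I" and W: "pm.subspace W"
    and "\<And>b. (\<Sum>i\<in>I. scale (c i ^ b) (z i)) \<in> W" and "i \<in> I"
  shows "z i \<in> W"
  using assms(1,2,4,5)
proof (induction I arbitrary: z i rule: finite_induct)
  case (insert j I)
  have sum: "scale (c j ^ b) (z j) + (\<Sum>i\<in>I. scale (c i ^ b) (z i)) \<in> W" for b
    using insert.prems(2)[of b] insert.hyps by simp
  have ne: "c i - c j \<noteq> 0" if "i \<in> I" for i
    using insert.prems(1) insert.hyps that by (auto simp: inj_on_def)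
  have rest: "z i \<in> W" if "i \<in> I" for i
  proof -
    \<comment> \<open>multiplying the weights by \<open>c i - c j\<close> removes the index \<open>j\<close>\<close>
    have "(\<Sum>i\<in>I. scale (c i ^ b) (scale (c i - c j) (z i))) \<in> W" for b
    proof -
      have "(\<Sum>i\<in>I. scale (c i ^ b) (scale (c i - c j) (z i))) =
          (scale (c j ^ Suc b) (z j) + (\<Sum>i\<in>I. scale (c i ^ Suc b) (z i)))
          - scale (c j) (scale (c j ^ b) (z j) + (\<Sum>i\<in>I. scale (c i ^ b) (z i)))"
      proof -
        have "scale (c i ^ b) (scale (c i - c j) (z i)) =
            scale (c i ^ Suc b) (z i) - scale (c j) (scale (c i ^ b) (z i))" for i
          by (simp only: scale_scale flip: pm.scale_left_diff_distrib) (simp add: algebra_simps)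
        then show ?thesis
          by (simp only: sum_subtractf scale_add_right flip: scale_sum) (simp add: scale_scale)
      qed
      then show ?thesis using pm.subspace_diff[OF W sum[of "Suc b"] pm.subspace_scale[OF W sum[of b]]] by simp
    qed
    then have "scale (c i - c j) (z i) \<in> W"
      using insert.IH[of "\<lambda>i. scale (c i - c j) (z i)"] insert.prems(1) that by simp
    then have "scale (1 / (c i - c j)) (scale (c i - c j) (z i)) \<in> W" by (rule pm.subspace_scale[OF W])
    then show ?thesis using ne[OF that] by (simp add: scale_scale)
  qed
  have "z j = (scale (c j ^ 0) (z j) + (\<Sum>i\<in>I. scale (c i ^ 0) (z i))) - (\<Sum>i\<in>I. z i)" by simp
  also have "\<dots> \<in> W" using rest by (intro pm.subspace_diff[OF W sum] pm.subspace_sum[OF W]) auto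
  finally show ?case using rest insert.prems(3) by auto
qed simp

text \<open>Any finite set \<open>T\<close> that dominates \<open>S\<close> level by level is reached from \<open>S\<close> by exchanging one element at a
  time for an element of \<open>T\<close> of at least the same level. In each step an element of \<open>S - T\<close> of maximal
  level is removed: maximality ensures that the new set is again dominated by \<open>T\<close>.\<close>

lemma exchange_induct:
  fixes lev :: "'a \<Rightarrow> int"
  assumes fin: "finite S" "finite T" and "card S = card T"
    and "\<And>s. card {a \<in> S. s \<le> lev a} \<le> card {b \<in> T. s \<le> lev b}"
    and step: "\<And>S a b. \<lbrakk>P S; a \<in> S; b \<in> T; b \<notin> S; lev a \<le> lev b\<rbrakk> \<Longrightarrow> P (insert b (S - {a}))"
    and "P S"
  shows "P T"
  using assms(1,3,4,6)
proof (induction "card (S - T)" arbitrary: S rule: less_induct)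
  case less
  note finS = \<open>finite S\<close> and dom = less.prems(3)
  show ?case
  proof (cases "S - T = {}")
    case True
    then have "S = T" using card_subset_eq[OF fin(2), of S] less.prems(2) by auto
    then show ?thesis using less.prems(4) by simp
  next
    case False
    define A where "A = S - T"
    have "finite A" "A \<noteq> {}" using False finS by (auto simp: A_def)
    then obtain a where a: "a \<in> A" "\<And>a'. a' \<in> A \<Longrightarrow> lev a' \<le> lev a"
      using Max_in[of "lev ` A"] Max_ge[of "lev ` A"] by fastforce
    have split: "card {x \<in> X. s \<le> lev x} = card {x \<in> X - Y. s \<le> lev x} + card {x \<in> X \<inter> Y. s \<le> lev x}"
      if "finite X" for X Y s
      using that by (subst card_Un_disjoint[symmetric]) (auto intro: arg_cong[where f = card])
    have "card {x \<in> S - T. lev a \<le> lev x} \<le> card {x \<in> T - S. lev a \<le> lev x}"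
      using dom[of "lev a"] split[OF finS, of "lev a" T] split[OF fin(2), of "lev a" S]
      by (simp add: Int_commute)
    moreover have "card {x \<in> S - T. lev a \<le> lev x} > 0"
      using a finS by (auto simp: card_gt_0_iff A_def)
    ultimately have "{x \<in> T - S. lev a \<le> lev x} \<noteq> {}" by (metis card.empty leD)
    then obtain b where b: "b \<in> T" "b \<notin> S" "lev a \<le> lev b" by blast
    define S' where "S' = insert b (S - {a})"
    have aS: "a \<in> S" "a \<notin> T" using a by (auto simp: A_def)
    have P': "P S'" unfolding S'_def using step[OF less.prems(4) aS(1) b] .
    have finS': "finite S'" using finS by (simp add: S'_def)
    have card': "card S' = card T"
      using less.prems(2) b aS finS card_Suc_Diff1[OF finS aS(1)] by (simp add: S'_def)
    have dom': "card {x \<in> S'. s \<le> lev x} \<le> card {x \<in> T. s \<le> lev x}" for s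
    proof (cases "s \<le> lev a")
      case True
      have "{x \<in> S'. s \<le> lev x} = insert b ({x \<in> S. s \<le> lev x} - {a})"
        using True b by (auto simp: S'_def)
      then have "card {x \<in> S'. s \<le> lev x} = card {x \<in> S. s \<le> lev x}"
        using True b aS finS card_Suc_Diff1[of "{x \<in> S. s \<le> lev x}" a] by simp
      then show ?thesis using dom[of s] by simp
    next
      case False
      then have "{x \<in> S'. s \<le> lev x} \<subseteq> {x \<in> T. s \<le> lev x}"
        using a(2) b by (fastforce simp: S'_def A_def)
      then show ?thesis by (intro card_mono) (use fin in auto)
    qed
    have "S' - T \<subset> S - T" using aS b by (auto simp: S'_def)
    then have "card (S' - T) < card (S - T)" using finS by (intro psubset_card_mono) auto
    then show ?thesis using less.hyps finS' card' dom' P' by blast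
  qed
qed

lemma ex_permutes_same_image:
  assumes "inj_on u {1..n::nat}" "inj_on w {1..n}" "u ` {1..n} = w ` {1..n}"
    and "u \<in> extensional {1..n}" "w \<in> extensional {1..n}"
  obtains \<sigma> where "\<sigma> permutes {1..n}" "u = w \<circ> \<sigma>"
proof
  define \<sigma> where "\<sigma> i = (if i \<in> {1..n} then inv_into {1..n} w (u i) else i)" for i
  have mem: "inv_into {1..n} w (u i) \<in> {1..n}" "w (inv_into {1..n} w (u i)) = u i" if "i \<in> {1..n}" for i
  proof -
    have "u i \<in> w ` {1..n}" using that assms(3) by blast
    then show "inv_into {1..n} w (u i) \<in> {1..n}" "w (inv_into {1..n} w (u i)) = u i"
      by (rule inv_into_into, rule f_inv_into_f)
  qed
  have "inj_on \<sigma> {1..n}"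
    by (rule inj_onI) (metis \<sigma>_def mem(2) assms(1) inj_on_def)
  moreover have "\<sigma> ` {1..n} \<subseteq> {1..n}" using mem by (auto simp: \<sigma>_def)
  ultimately have "bij_betw \<sigma> {1..n} {1..n}"
    by (simp add: bij_betw_def endo_inj_surj)
  then show "\<sigma> permutes {1..n}" by (rule bij_imp_permutes) (auto simp: \<sigma>_def)
  show "u = w \<circ> \<sigma>"
  proof
    fix i
    show "u i = (w \<circ> \<sigma>) i"
      using mem[of i] assms(4,5) by (cases "i \<in> {1..n}") (auto simp: \<sigma>_def extensional_def)
  qed
qed

context
  fixes r n :: nat and N :: int
begin

abbreviation (input) VN_op where "VN_op \<equiv> tensor_act n (VN_act r N)"
abbreviation (input) VN_tensors where "VN_tensors \<equiv> {1..n} \<rightarrow>\<^sub>E VN_basis r N"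

text \<open>If \<open>v\<close> is the antisymmetric tensor that corresponds to \<open>v\<^sub>\<xi>\<close>, this is the image of \<open>F\<^sup>m\<V>(\<xi>,N)\<close> in the
  antisymmetric tensors.\<close>

definition filt_span :: "((nat \<Rightarrow> nat \<times> int) \<Rightarrow>\<^sub>0 complex) \<Rightarrow> nat \<Rightarrow> ((nat \<Rightarrow> nat \<times> int) \<Rightarrow>\<^sub>0 complex) set" where
  "filt_span v m = pm.span {foldr VN_op as v |as ms.
    list_all2 (\<lambda>a k. a \<in> G_filt r k) as ms \<and> sum_list ms \<le> m}"

lemma filt_span_mono: "m \<le> m' \<Longrightarrow> filt_span v m \<subseteq> filt_span v m'"
  unfolding filt_span_def by (rule pm.span_mono) (blast intro: order_trans)

lemma filt_span_start: "v \<in> filt_span v m"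
  unfolding filt_span_def by (rule pm.span_base) (auto intro!: exI[of _ "[]"])

lemma filt_span_subspace: "pm.subspace (filt_span v m)"
  by (simp add: filt_span_def)

lemma filt_span_act:
  assumes "A \<in> G_filt r k" "x \<in> filt_span v m"
  shows "VN_op A x \<in> filt_span v (k + m)"
proof (rule pm_linear_span[OF pm_linear_tensor_act filt_span_subspace])
  show "x \<in> pm.span {foldr VN_op as v |as ms. list_all2 (\<lambda>a k. a \<in> G_filt r k) as ms \<and> sum_list ms \<le> m}"
    using assms(2) by (simp add: filt_span_def)
  fix y assume "y \<in> {foldr VN_op as v |as ms. list_all2 (\<lambda>a k. a \<in> G_filt r k) as ms \<and> sum_list ms \<le> m}"
  then obtain as ms where as: "y = foldr VN_op as v" "list_all2 (\<lambda>a k. a \<in> G_filt r k) as ms" "sum_list ms \<le> m"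
    by blast
  have "VN_op A y = foldr VN_op (A # as) v" "list_all2 (\<lambda>a k. a \<in> G_filt r k) (A # as) (k # ms)"
      "sum_list (k # ms) \<le> k + m"
    using as assms(1) by auto
  then show "VN_op A y \<in> filt_span v (k + m)"
    unfolding filt_span_def by (intro pm.span_base) blast
qed

lemma filt_span_minimal:
  assumes "pm.subspace V" "v \<in> V" "\<And>A x. x \<in> V \<Longrightarrow> VN_op A x \<in> V"
  shows "filt_span v m \<subseteq> V"
  unfolding filt_span_def
proof (rule pm.span_minimal[OF _ assms(1)])
  have "foldr VN_op as v \<in> V" for as by (induction as) (simp_all add: assms)
  then show "{foldr VN_op as v |as ms. list_all2 (\<lambda>a k. a \<in> G_filt r k) as ms \<and> sum_list ms \<le> m} \<subseteq> V"
    by blast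
qed

lemma filt_span_Union_subspace: "pm.subspace (\<Union>m. filt_span v m)"
  by (rule subspace_chain_Union) (rule filt_span_subspace, rule filt_span_mono, simp)

text \<open>Let the \<open>i0\<close>-th factor of \<open>u\<close> be \<open>u\<^sub>j \<otimes> x\<^sup>c\<close> and let \<open>b\<close> stand for \<open>u\<^sub>k \<otimes> x\<^sup>c\<^sup>+\<^sup>p\<close>. The operator
  \<open>E\<^sub>k\<^sub>j \<otimes> \<X>\<^sup>p\<Y>\<^sup>q\<close> changes each factor of the form \<open>u\<^sub>j \<otimes> x\<^sup>d\<close>, with weight \<open>d\<^sup>q\<close>. As the factors are distinct,
  these degrees \<open>d\<close> are distinct, and letting \<open>q\<close> vary isolates the change of the \<open>i0\<close>-th factor.\<close>

lemma move_one_factor: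
  assumes W: "pm.subspace W"
    and stable: "\<And>g p q x. g \<in> carrier_mat r r \<Longrightarrow> x \<in> W \<Longrightarrow> VN_op (gl_tensor g (xy_X ^ p * xy_Y ^ q)) x \<in> W"
    and u: "u \<in> VN_tensors" "inj_on u {1..n}" and uW: "Alt n (bvec u) \<in> W"
    and i0: "i0 \<in> {1..n}" and b: "b \<in> VN_basis r N" "snd (u i0) \<le> snd b"
  shows "Alt n (bvec (u(i0 := b))) \<in> W"
proof -
  define j where "j = fst (u i0)"
  define k where "k = fst b"
  define p where "p = nat (snd b - snd (u i0))"
  define I where "I = {i \<in> {1..n}. fst (u i) = j}"
  define z where "z i = (if snd (u i) + int p < N then Alt n (bvec (u(i := (k, snd (u i) + int p)))) else 0)" for i
  have uB: "u i \<in> VN_basis r N" if "i \<in> {1..n}" for i using u(1) that by auto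
  have kj: "k < r" "j < r" using b(1) uB[OF i0] by (auto simp: k_def j_def VN_basis_def)
  have "(\<Sum>i\<in>I. scale (of_int (snd (u i)) ^ q) (z i)) \<in> W" for q
  proof -
    let ?A = "gl_tensor (unit_mat r k j) (xy_X ^ p * xy_Y ^ q)"
    have slot: "Alt n (slot_act i (VN_act r N ?A) (bvec u)) =
        (if fst (u i) = j then scale (of_int (snd (u i)) ^ q) (z i) else 0)" if "i \<in> {1..n}" for i
    proof -
      have "fst (u i) < r" using uB[OF that] by (auto simp: VN_basis_def)
      then have "VN_act r N ?A (bvec (u i)) = (if fst (u i) = j then scale (of_int (snd (u i)) ^ q)
          (if snd (u i) + int p < N then bvec (k, snd (u i) + int p) else 0) else 0)"
        using VN_act_unit_mat[OF kj, of "fst (u i)" N p q "snd (u i)"] by simp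
      then show ?thesis
        by (simp add: slot_act_bvec z_def lin_ext_scale pm_linear_scale pm_linear_zero)
    qed
    have "VN_op ?A (Alt n (bvec u)) = Alt n (\<Sum>i\<in>{1..n}. slot_act i (VN_act r N ?A) (bvec u))"
      by (subst tensor_act_Alt) (simp add: tensor_act_eq_slots)
    also have "\<dots> = (\<Sum>i\<in>{1..n}. if fst (u i) = j then scale (of_int (snd (u i)) ^ q) (z i) else 0)"
      by (simp add: pm_linear_sum slot)
    also have "\<dots> = (\<Sum>i\<in>I. scale (of_int (snd (u i)) ^ q) (z i))"
      by (simp add: I_def sum.If_cases Int_def)
    finally show ?thesis using stable[OF unit_mat_carrier[of r k j] uW, of p q] by (simp only:)
  qed
  moreover have "inj_on (\<lambda>i. of_int (snd (u i)) :: complex) I"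
  proof (rule inj_onI)
    fix i i' assume i: "i \<in> I" "i' \<in> I" "(of_int (snd (u i)) :: complex) = of_int (snd (u i'))"
    then have "u i = u i'" by (simp add: I_def prod_eq_iff)
    then show "i = i'" using i(1,2) inj_onD[OF u(2)] by (simp add: I_def)
  qed
  moreover have "i0 \<in> I" using i0 by (simp add: I_def j_def)
  ultimately have "z i0 \<in> W"
    using power_moments_in_subspace[of I "\<lambda>i. of_int (snd (u i))" W z i0] W by (simp add: I_def)
  moreover have "(k, snd (u i0) + int p) = b" "snd b < N"
    using b by (auto simp: k_def p_def VN_basis_def)
  ultimately show ?thesis by (auto simp: z_def prod_eq_iff)
qed

text \<open>Up to sign, the antisymmetrisation of a basis tensor without repeated factors depends only on the set
  of its factors. So the exchange argument for sets applies, with degrees as levels and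
  \<open>move_one_factor\<close> as exchange step.\<close>

lemma dominating_wedges_reached:
  assumes W: "pm.subspace W"
    and stable: "\<And>g p q x. g \<in> carrier_mat r r \<Longrightarrow> x \<in> W \<Longrightarrow> VN_op (gl_tensor g (xy_X ^ p * xy_Y ^ q)) x \<in> W"
    and u: "u \<in> VN_tensors" "inj_on u {1..n}" and uW: "Alt n (bvec u) \<in> W"
    and w: "w \<in> VN_tensors"
    and dom: "\<And>s. card {i \<in> {1..n}. s \<le> snd (u i)} \<le> card {i \<in> {1..n}. s \<le> snd (w i)}"
  shows "Alt n (bvec w) \<in> W"
proof (cases "inj_on w {1..n}")
  case False
  then show ?thesis using Alt_bvec_not_inj pm.subspace_0[OF W] by metis
next
  case w_inj: True
  \<comment> \<open>all enumerations of \<open>S\<close> are included, so that the exchanged element may stand at any position\<close>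
  define P where "P S \<longleftrightarrow> S \<subseteq> VN_basis r N \<and> (\<forall>x. x \<in> VN_tensors \<longrightarrow> inj_on x {1..n} \<longrightarrow> x ` {1..n} = S \<longrightarrow> Alt n (bvec x) \<in> W)" for S
  have cards: "card {a \<in> x ` {1..n}. s \<le> snd a} = card {i \<in> {1..n}. s \<le> snd (x i)}"
    if "inj_on x {1..n}" for x :: "nat \<Rightarrow> nat \<times> int" and s
  proof -
    have "{a \<in> x ` {1..n}. s \<le> snd a} = x ` {i \<in> {1..n}. s \<le> snd (x i)}" by auto
    moreover have "inj_on x {i \<in> {1..n}. s \<le> snd (x i)}" using that by (rule inj_on_subset) blast
    ultimately show ?thesis by (simp only: card_image)
  qed
  have "P (w ` {1..n})"
  proof (rule exchange_induct[where lev = snd and S = "u ` {1..n}"])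
    show "card (u ` {1..n}) = card (w ` {1..n})" using u(2) w_inj by (simp add: card_image)
    show "card {a \<in> u ` {1..n}. s \<le> snd a} \<le> card {b \<in> w ` {1..n}. s \<le> snd b}" for s
      using dom[of s] by (simp add: cards u(2) w_inj)
    show "P (u ` {1..n})"
      unfolding P_def
    proof (intro conjI allI impI)
      show "u ` {1..n} \<subseteq> VN_basis r N" using u(1) by auto
      fix x assume x: "x \<in> VN_tensors" "inj_on x {1..n}" "x ` {1..n} = u ` {1..n}"
      obtain \<sigma> where "\<sigma> permutes {1..n}" "x = u \<circ> \<sigma>"
        using ex_permutes_same_image[OF x(2) u(2) x(3)] x(1) u(1) by (metis PiE_ext PiE_iff)
      then show "Alt n (bvec x) \<in> W"
        using Alt_perm_op[of \<sigma> n "bvec u"] pm.subspace_scale[OF W uW] by simp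
    qed
    fix S a b
    assume PS: "P S" and a: "a \<in> S" and b: "b \<in> w ` {1..n}" "b \<notin> S" and le: "snd a \<le> snd b"
    show "P (insert b (S - {a}))"
      unfolding P_def
    proof (intro conjI allI impI)
      have SB: "S \<subseteq> VN_basis r N" using PS by (simp add: P_def)
      have bB: "b \<in> VN_basis r N" using b(1) w by auto
      show "insert b (S - {a}) \<subseteq> VN_basis r N" using SB bB by blast
      fix x assume x: "x \<in> VN_tensors" "inj_on x {1..n}" "x ` {1..n} = insert b (S - {a})"
      have "b \<in> x ` {1..n}" by (simp only: x(3) insertI1)
      then obtain i0 where i0: "i0 \<in> {1..n}" "x i0 = b" by (metis imageE)
      let ?J = "{1..n} - {i0}"
      have J: "{1..n} = insert i0 ?J" using i0(1) by blast
      have "b \<notin> x ` ?J"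
      proof
        assume "b \<in> x ` ?J"
        then obtain i where "i \<in> ?J" "x i = b" by (metis imageE)
        then show False using inj_onD[OF x(2), of i i0] i0 by simp
      qed
      moreover have "insert b (x ` ?J) = insert b (S - {a})"
      proof -
        have "x ` insert i0 ?J = insert b (S - {a})" by (simp only: J[symmetric] x(3))
        then show ?thesis by (simp only: image_insert i0(2))
      qed
      ultimately have rest: "x ` ?J = S - {a}" using b(2) by (metis insert_ident DiffD1)
      let ?x' = "x(i0 := a)"
      have img: "?x' ` ?J = S - {a}" using rest by (simp add: image_def)
      have inj: "inj_on ?x' (insert i0 ?J)"
      proof -
        have "inj_on ?x' ?J"
          by (rule inj_on_fun_updI[OF inj_on_subset[OF x(2) Diff_subset]]) (simp only: rest, simp)
        moreover have "?x' i0 \<notin> ?x' ` (?J - {i0})"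
          by (simp only: Diff_idemp img) simp
        ultimately show ?thesis unfolding inj_on_insert ..
      qed
      have "?x' ` (insert i0 ?J) = S" by (simp only: image_insert img fun_upd_same insert_Diff[OF a])
      then have img': "?x' ` {1..n} = S" by (simp only: J[symmetric])
      have inj': "inj_on ?x' {1..n}" using inj by (simp only: J[symmetric])
      have x'B: "?x' \<in> VN_tensors" using x(1) i0(1) a SB by (auto simp: PiE_iff extensional_def)
      have x'W: "Alt n (bvec ?x') \<in> W" using PS x'B inj' img' unfolding P_def by blast
      have le': "snd (?x' i0) \<le> snd b" using le by simp
      have "Alt n (bvec (?x'(i0 := b))) \<in> W"
        by (rule move_one_factor[OF W _ x'B inj' x'W i0(1) bB le']) (rule stable)
      then show "Alt n (bvec x) \<in> W" using i0(2) by (simp add: fun_upd_idem)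
    qed
  qed auto
  then show ?thesis using w w_inj by (simp add: P_def)
qed

end

section \<open>Tensors dominating a partition\<close>

lemma sum_transposed_part: "(\<Sum>t=1..s. transposed_part \<xi> t) = (\<Sum>j<length \<xi>. min (\<xi> ! j) s)"
proof (induction s)
  case (Suc s)
  have "transposed_part \<xi> (Suc s) = (\<Sum>j<length \<xi>. if Suc s \<le> \<xi> ! j then 1 else 0)"
    by (simp add: transposed_part_def sum.If_cases Int_def)
  then have "(\<Sum>t=1..Suc s. transposed_part \<xi> t) =
      (\<Sum>j<length \<xi>. min (\<xi> ! j) s + (if Suc s \<le> \<xi> ! j then 1 else 0))"
    using Suc by (simp add: sum.distrib)
  also have "\<dots> = (\<Sum>j<length \<xi>. min (\<xi> ! j) (Suc s))" by (rule sum.cong) auto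
  finally show ?case .
qed simp

lemma sum_min_large:
  fixes \<xi> :: "nat list"
  assumes "sum_list \<xi> \<le> s" shows "(\<Sum>j<length \<xi>. min (\<xi> ! j) s) = sum_list \<xi>"
proof -
  have "\<xi> ! j \<le> s" if "j < length \<xi>" for j
    using elem_le_sum_list[OF that] assms by simp
  then have "(\<Sum>j<length \<xi>. min (\<xi> ! j) s) = (\<Sum>j<length \<xi>. \<xi> ! j)"
    by (intro sum.cong) auto
  then show ?thesis by (simp add: sum_list_sum_nth atLeast0LessThan)
qed

lemma set_v_factors: "set (v_factors \<xi> N) = (SIGMA j:{..<length \<xi>}. {N - int (\<xi> ! j)..<N})"
  by (auto simp: v_factors_def)

lemma length_v_factors: "length (v_factors \<xi> N) = sum_list \<xi>"
proof -
  have "length (v_factors \<xi> N) = sum_list (map (\<lambda>j. \<xi> ! j) [0..<length \<xi>])"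
    by (simp add: v_factors_def length_concat comp_def)
  then show ?thesis by (simp add: map_nth)
qed

lemma card_v_factors_level:
  "card {b \<in> set (v_factors \<xi> N). N - int s \<le> snd b} = (\<Sum>j<length \<xi>. min (\<xi> ! j) s)"
proof -
  have "{b \<in> set (v_factors \<xi> N). N - int s \<le> snd b} =
      (SIGMA j:{..<length \<xi>}. {N - int (min (\<xi> ! j) s)..<N})"
    by (auto simp: set_v_factors min_def split: if_splits)
  then show ?thesis by (simp add: card_SigmaI)
qed

lemma distinct_v_factors: "distinct (v_factors \<xi> N)"
proof (rule card_distinct)
  have "card (set (v_factors \<xi> N)) = (\<Sum>j<length \<xi>. \<xi> ! j)"
    by (simp add: set_v_factors card_SigmaI)
  then show "card (set (v_factors \<xi> N)) = length (v_factors \<xi> N)"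
    by (simp add: length_v_factors sum_list_sum_nth atLeast0LessThan)
qed

text \<open>The basis tensor whose factors are listed in \<open>v_factors\<close>, numbered from \<open>1\<close>.\<close>

definition v_fun :: "nat list \<Rightarrow> int \<Rightarrow> nat \<Rightarrow> nat \<times> int" where
  "v_fun \<xi> N = restrict (\<lambda>i. v_factors \<xi> N ! (i - 1)) {1..sum_list \<xi>}"

lemma bij_betw_v_fun: "bij_betw (v_fun \<xi> N) {1..sum_list \<xi>} (set (v_factors \<xi> N))"
proof -
  let ?n = "sum_list \<xi>"
  have "bij_betw (\<lambda>i. i - 1) {1..?n} {..<?n}"
    by (rule bij_betw_byWitness[where f' = Suc]) auto
  moreover have "bij_betw ((!) (v_factors \<xi> N)) {..<?n} (set (v_factors \<xi> N))"
    using distinct_v_factors by (intro bij_betw_nth) (auto simp: length_v_factors)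
  ultimately have "bij_betw ((!) (v_factors \<xi> N) \<circ> (\<lambda>i. i - 1)) {1..?n} (set (v_factors \<xi> N))"
    by (rule bij_betw_trans)
  then show ?thesis
    by (rule bij_betw_cong[THEN iffD1, rotated]) (simp add: v_fun_def)
qed

text \<open>The bound \<open>\<Sum>\<^sub>j min \<xi>\<^sub>j s\<close> is the number of factors of \<open>v\<^sub>\<xi>\<close> of \<open>x\<close>-degree at least \<open>N - s\<close>
  (\<open>card_v_fun_level\<close>).\<close>

definition dominating :: "nat list \<Rightarrow> int \<Rightarrow> (nat \<Rightarrow> nat \<times> int) set" where
  "dominating \<xi> N = {w \<in> {1..sum_list \<xi>} \<rightarrow>\<^sub>E VN_basis (length \<xi>) N.
    \<forall>s. (\<Sum>j<length \<xi>. min (\<xi> ! j) s) \<le> card {i \<in> {1..sum_list \<xi>}. N - int s \<le> snd (w i)}}"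

lemma card_v_fun_level:
  "card {i \<in> {1..sum_list \<xi>}. N - int s \<le> snd (v_fun \<xi> N i)} = (\<Sum>j<length \<xi>. min (\<xi> ! j) s)"
proof -
  let ?I = "{i \<in> {1..sum_list \<xi>}. N - int s \<le> snd (v_fun \<xi> N i)}"
  have "inj_on (v_fun \<xi> N) {1..sum_list \<xi>}" using bij_betw_v_fun by (auto simp: bij_betw_def)
  then have "card (v_fun \<xi> N ` ?I) = card ?I" by (intro card_image) (rule inj_on_subset, auto)
  moreover have "v_fun \<xi> N ` ?I = {b \<in> v_fun \<xi> N ` {1..sum_list \<xi>}. N - int s \<le> snd b}" by blast
  then have "v_fun \<xi> N ` ?I = {b \<in> set (v_factors \<xi> N). N - int s \<le> snd b}"
    by (simp only: bij_betw_imp_surj_on[OF bij_betw_v_fun])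
  ultimately show ?thesis by (simp add: card_v_factors_level)
qed

lemma v_fun_in_PiE: "v_fun \<xi> N \<in> {1..sum_list \<xi>} \<rightarrow>\<^sub>E VN_basis (length \<xi>) N"
proof (rule PiE_I)
  fix i assume "i \<in> {1..sum_list \<xi>}"
  then have "v_fun \<xi> N i \<in> set (v_factors \<xi> N)" using bij_betwE[OF bij_betw_v_fun] by blast
  then show "v_fun \<xi> N i \<in> VN_basis (length \<xi>) N" by (auto simp: set_v_factors VN_basis_def)
qed (auto simp: v_fun_def)

lemma v_fun_dominating: "v_fun \<xi> N \<in> dominating \<xi> N"
  by (simp only: dominating_def mem_Collect_eq v_fun_in_PiE card_v_fun_level order_refl simp_thms)

lemma dominating_perm:
  assumes "\<sigma> permutes {1..sum_list \<xi>}" "w \<in> dominating \<xi> N"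
  shows "w \<circ> \<sigma> \<in> dominating \<xi> N"
proof -
  have "card {i \<in> {1..sum_list \<xi>}. s \<le> snd ((w \<circ> \<sigma>) i)} = card {i \<in> {1..sum_list \<xi>}. s \<le> snd (w i)}" for s
  proof -
    have "{i \<in> {1..sum_list \<xi>}. s \<le> snd (w i)} = \<sigma> ` {i \<in> {1..sum_list \<xi>}. s \<le> snd ((w \<circ> \<sigma>) i)}"
      using permutes_in_image[OF assms(1)] permutes_surj[OF assms(1)]
      by (auto simp: image_iff simp del: atLeastAtMost_iff) (metis surj_def)
    then show ?thesis
      using permutes_inj_on[OF assms(1)] by (simp add: card_image)
  qed
  moreover have "w \<circ> \<sigma> \<in> {1..sum_list \<xi>} \<rightarrow>\<^sub>E VN_basis (length \<xi>) N"
    using assms(2) by (intro PiE_comp_permutes[OF assms(1)]) (simp add: dominating_def)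
  ultimately show ?thesis using assms(2) by (simp only: dominating_def mem_Collect_eq simp_thms)
qed

text \<open>For \<open>s = n\<close> the bound is \<open>n\<close>, the number of all factors. In particular only finitely many basis tensors
  are dominating.\<close>

lemma dominating_bounded:
  fixes \<xi> :: "nat list"
  assumes "w \<in> dominating \<xi> N" "i \<in> {1..sum_list \<xi>}"
  shows "N - int (sum_list \<xi>) \<le> snd (w i)"
proof -
  let ?n = "sum_list \<xi>"
  have "(\<Sum>j<length \<xi>. min (\<xi> ! j) ?n) \<le> card {i \<in> {1..?n}. N - int ?n \<le> snd (w i)}"
    using assms(1) unfolding dominating_def by blast
  then have "?n \<le> card {i \<in> {1..?n}. N - int ?n \<le> snd (w i)}"
    by (simp only: sum_min_large[OF order_refl])
  then have "{i \<in> {1..?n}. N - int ?n \<le> snd (w i)} = {1..?n}" by (intro card_seteq) auto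
  then show ?thesis using assms(2) by blast
qed

lemma finite_dominating: "finite (dominating \<xi> N)"
proof -
  let ?n = "sum_list \<xi>"
  have "dominating \<xi> N \<subseteq> {1..?n} \<rightarrow>\<^sub>E {..<length \<xi>} \<times> {N - int ?n..<N}"
  proof
    fix w assume w: "w \<in> dominating \<xi> N"
    then have wB: "w \<in> {1..?n} \<rightarrow>\<^sub>E VN_basis (length \<xi>) N" by (simp add: dominating_def)
    show "w \<in> {1..?n} \<rightarrow>\<^sub>E {..<length \<xi>} \<times> {N - int ?n..<N}"
    proof (rule PiE_I)
      fix i assume "i \<in> {1..?n}"
      then show "w i \<in> {..<length \<xi>} \<times> {N - int ?n..<N}"
        using PiE_mem[OF wB] dominating_bounded[OF w] by (auto simp: VN_basis_def mem_Times_iff)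
    qed (rule PiE_arb[OF wB])
  qed
  then show ?thesis by (rule finite_subset) (intro finite_PiE, auto)
qed

lemma Alt_supported_dominating:
  assumes "t \<in> supported (dominating \<xi> N)"
  shows "Alt (sum_list \<xi>) t \<in> supported (dominating \<xi> N)"
proof (rule pm_linear_span[OF pm_linear_Alt supported_subspace])
  show "t \<in> pm.span (bvec ` dominating \<xi> N)" using assms by (simp add: supported_span)
  fix z assume "z \<in> bvec ` dominating \<xi> N"
  then show "Alt (sum_list \<xi>) z \<in> supported (dominating \<xi> N)"
    using dominating_perm[of _ \<xi> _ N]
    by (auto simp: Alt_def intro!: pm.subspace_sum[OF supported_subspace]
        pm.subspace_scale[OF supported_subspace])
qed

lemma dominating_raise:
  assumes "w \<in> dominating \<xi> N" "i \<in> {1..sum_list \<xi>}" "b \<in> VN_basis (length \<xi>) N" "snd (w i) \<le> snd b"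
  shows "w(i := b) \<in> dominating \<xi> N"
proof -
  have "card {k \<in> {1..sum_list \<xi>}. N - int s \<le> snd (w k)} \<le>
      card {k \<in> {1..sum_list \<xi>}. N - int s \<le> snd ((w(i := b)) k)}" for s
    using assms(4) by (intro card_mono) auto
  moreover have "w(i := b) \<in> {1..sum_list \<xi>} \<rightarrow>\<^sub>E VN_basis (length \<xi>) N"
    using assms by (auto simp: dominating_def PiE_iff extensional_def)
  ultimately show ?thesis using assms(1) order_trans unfolding dominating_def by blast
qed

lemma tensor_act_supported_dominating:
  assumes "x \<in> supported (dominating \<xi> N)"
  shows "tensor_act (sum_list \<xi>) (VN_act (length \<xi>) N) A x \<in> supported (dominating \<xi> N)"
proof (rule pm_linear_span[OF pm_linear_tensor_act supported_subspace])
  show "x \<in> pm.span (bvec ` dominating \<xi> N)" using assms by (simp add: supported_span)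
  fix y assume "y \<in> bvec ` dominating \<xi> N"
  then obtain w where w: "w \<in> dominating \<xi> N" "y = bvec w" by auto
  have "lin_ext (\<lambda>b. bvec (w(i := b))) (VN_act (length \<xi>) N A (bvec (w i))) \<in> supported (dominating \<xi> N)"
    if i: "i \<in> {1..sum_list \<xi>}" for i
  proof (rule lin_ext_in_subspace[OF supported_subspace])
    fix b assume "b \<in> Poly_Mapping.keys (VN_act (length \<xi>) N A (bvec (w i)))"
    then have "b \<in> VN_basis (length \<xi>) N" "snd (w i) \<le> snd b"
      using VN_act_raises_degree[of "length \<xi>" N A "fst (w i)" "snd (w i)"] by (auto simp: supported_def)
    then show "bvec (w(i := b)) \<in> supported (dominating \<xi> N)"
      using dominating_raise[OF w(1) i] by simp
  qed
  then show "tensor_act (sum_list \<xi>) (VN_act (length \<xi>) N) A y \<in> supported (dominating \<xi> N)"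
    using w by (auto simp: tensor_act_eq_slots slot_act_bvec intro!: pm.subspace_sum[OF supported_subspace])
qed

text \<open>The inclusion from left to right holds because the operators never lower a degree, so that they
  preserve the dominating tensors; the other one is the exchange argument.\<close>

lemma filt_span_Union:
  fixes \<xi> :: "nat list" and N :: int
  defines "n \<equiv> sum_list \<xi>" and "r \<equiv> length \<xi>"
  shows "(\<Union>m. filt_span r n N (Alt n (bvec (v_fun \<xi> N))) m) = Alt n ` supported (dominating \<xi> N)"
proof
  let ?v = "Alt n (bvec (v_fun \<xi> N))"
  show "(\<Union>m. filt_span r n N ?v m) \<subseteq> Alt n ` supported (dominating \<xi> N)"
  proof (rule UN_least, rule filt_span_minimal)
    show "pm.subspace (Alt n ` supported (dominating \<xi> N))"
      by (rule pm_linear_image_subspace[OF pm_linear_Alt supported_subspace])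
    show "?v \<in> Alt n ` supported (dominating \<xi> N)" using v_fun_dominating by simp
    fix A x assume "x \<in> Alt n ` supported (dominating \<xi> N)"
    then show "tensor_act n (VN_act r N) A x \<in> Alt n ` supported (dominating \<xi> N)"
      using tensor_act_supported_dominating[of _ \<xi> N A]
      by (auto simp: tensor_act_Alt n_def r_def)
  qed
  let ?W = "\<Union>m. filt_span r n N ?v m"
  have W: "pm.subspace ?W" by (rule filt_span_Union_subspace)
  have "Alt n (bvec w) \<in> ?W" if w: "w \<in> dominating \<xi> N" for w
  proof (rule dominating_wedges_reached[OF W])
    show "tensor_act n (VN_act r N) (gl_tensor g (xy_X ^ p * xy_Y ^ q)) x \<in> ?W"
      if g: "g \<in> carrier_mat r r" and x: "x \<in> ?W" for g p q x
    proof -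
      obtain m where "x \<in> filt_span r n N ?v m" using x by (rule UN_E)
      then have "tensor_act n (VN_act r N) (gl_tensor g (xy_X ^ p * xy_Y ^ q)) x \<in> filt_span r n N ?v (q + m)"
        by (rule filt_span_act[OF G_filt_monomial[OF g]])
      then show ?thesis by (rule UN_I[OF UNIV_I])
    qed
    show "v_fun \<xi> N \<in> {1..n} \<rightarrow>\<^sub>E VN_basis r N" unfolding n_def r_def by (rule v_fun_in_PiE)
    show "inj_on (v_fun \<xi> N) {1..n}" unfolding n_def using bij_betw_v_fun by (auto simp: bij_betw_def)
    show "?v \<in> ?W" by (rule UN_I[of 0]) (simp, rule filt_span_start)
    show wB: "w \<in> {1..n} \<rightarrow>\<^sub>E VN_basis r N" using w by (simp add: dominating_def n_def r_def)
    show "card {i \<in> {1..n}. s \<le> snd (v_fun \<xi> N i)} \<le> card {i \<in> {1..n}. s \<le> snd (w i)}" for s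
    proof (cases "s \<le> N")
      case True
      then have s: "s = N - int (nat (N - s))" by simp
      show ?thesis
        using w by (subst (1 2) s) (simp only: dominating_def n_def card_v_fun_level mem_Collect_eq)
    next
      case False
      have "snd (v_fun \<xi> N i) < N" if "i \<in> {1..n}" for i
        using PiE_mem[OF v_fun_in_PiE[of \<xi> N], of i] that by (auto simp: VN_basis_def n_def)
      then have "{i \<in> {1..n}. s \<le> snd (v_fun \<xi> N i)} = {}" using False by force
      then show ?thesis by (simp only: card.empty le0)
    qed
  qed
  then show "Alt n ` supported (dominating \<xi> N) \<subseteq> ?W"
    unfolding supported_span pm_linear_image_span[OF pm_linear_Alt]
    by (intro pm.span_minimal[OF _ W]) auto
qed

section \<open>Coordinates on the associated graded module\<close>

text \<open>Combines the coordinates on the exterior power given by the antisymmetriser with those on the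
  associated graded module given by the orthogonal projections.\<close>

lemma linear_model_V_mod:
  fixes \<xi> :: "nat list" and N :: int
  defines "n \<equiv> sum_list \<xi>" and "r \<equiv> length \<xi>"
  obtains \<Theta> where "linear_model (V_mod \<xi> N) \<Theta> (Alt n ` supported (dominating \<xi> N))"
    and "\<And>g. g \<in> carrier_mat r r \<Longrightarrow>
      intertwines (V_mod \<xi> N) \<Theta> g (tensor_act n (VN_act r N) (gl_tensor g 1))"
proof -
  let ?L = "Lambda_VN r N n" and ?B = "VN_basis r N" and ?act = "tensor_act n (VN_act r N)"
  let ?\<Psi> = "quot_coord (Alt n) (\<lambda>t. t)" and ?v = "v_vec \<xi> N" and ?vt = "Alt n (bvec (v_fun \<xi> N))"
  have VB: "VN_act r N A (bvec b) \<in> supported ?B" if "b \<in> ?B" for A b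
    using VN_act_raises_degree[of r N A "fst b" "snd b"] by (auto simp: supported_def)
  have L: "linear_model ?L ?\<Psi> (Alt n ` supported ({1..n} \<rightarrow>\<^sub>E ?B))"
    unfolding Lambda_VN_def by (rule linear_model_exterior_power(1))
  have L_act: "act ?L A x \<in> carrier ?L \<and> ?\<Psi> (act ?L A x) = ?act A (?\<Psi> x)" if "x \<in> carrier ?L" for A x
    using that VB unfolding Lambda_VN_def by (intro linear_model_exterior_power(3))
  have v: "?v \<in> carrier ?L \<and> ?\<Psi> ?v = ?vt"
  proof -
    have "pure_tensor n (\<lambda>i. bvec (v_factors \<xi> N ! (i - 1))) = pure_tensor n (\<lambda>i. bvec (v_fun \<xi> N i))"
      by (rule pure_tensor_cong) (simp add: v_fun_def n_def)
    also have "\<dots> = bvec (v_fun \<xi> N)"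
      by (rule pure_tensor_bvec) (use v_fun_in_PiE[of \<xi> N] in \<open>simp add: PiE_def n_def\<close>)
    finally have pure: "pure_tensor n (\<lambda>i. bvec (v_factors \<xi> N ! (i - 1))) = bvec (v_fun \<xi> N)" .
    have "Poly_Mapping.keys (bvec (v_factors \<xi> N ! (i - 1)) :: nat \<times> int \<Rightarrow>\<^sub>0 complex) \<subseteq> ?B" if "i \<in> {1..n}" for i
      using PiE_mem[OF v_fun_in_PiE, of i \<xi> N] that by (simp add: v_fun_def n_def r_def)
    then show ?thesis
      using linear_model_exterior_power(2)[of n "\<lambda>i. bvec (v_factors \<xi> N ! (i - 1))" ?B "VN_act r N"]
      unfolding v_vec_def Lambda_VN_def n_def[symmetric] r_def[symmetric] pure by blast
  qed
  define F where "F = F_span r ?L ?v"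
  define W where "W = filt_span r n N ?vt"
  have foldr: "foldr (act ?L) as ?v \<in> carrier ?L \<and> ?\<Psi> (foldr (act ?L) as ?v) = foldr ?act as ?vt" for as
    by (induction as) (use v L_act in auto)
  have FW: "F m \<subseteq> carrier ?L" "?\<Psi> ` F m = W m" for m
  proof -
    let ?G = "{foldr (act ?L) as ?v |as ms. list_all2 (\<lambda>a k. a \<in> G_filt r k) as ms \<and> sum_list ms \<le> m}"
    have G: "?G \<subseteq> carrier ?L" using foldr by blast
    have "?\<Psi> ` ?G = {foldr ?act as ?vt |as ms. list_all2 (\<lambda>a k. a \<in> G_filt r k) as ms \<and> sum_list ms \<le> m}"
      using foldr by (auto simp: image_def) metis+
    then show "F m \<subseteq> carrier ?L" "?\<Psi> ` F m = W m"
      using linear_model_span[OF L G] by (simp_all add: F_def F_span_def W_def filt_span_def)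
  qed
  have WU: "(\<Union>m. W m) = Alt n ` supported (dominating \<xi> N)"
    unfolding W_def n_def r_def by (rule filt_span_Union)
  have Alt_sup: "Alt n ` supported (dominating \<xi> N) \<subseteq> supported (dominating \<xi> N)"
    using Alt_supported_dominating unfolding n_def by blast
  have gr: "assoc_graded r ?L ?v =
      direct_sum_rep (\<lambda>m. quot_rep (sub_rep ?L (F m)) (if m = 0 then {\<zero>\<^bsub>?L\<^esub>} else F (m - 1)))"
    unfolding assoc_graded_def F_def ..
  have "\<exists>\<Theta>. linear_model (assoc_graded r ?L ?v) \<Theta> (\<Union>m. W m) \<and>
    (\<forall>g T T'. pm_linear T \<longrightarrow> (\<forall>m. \<forall>u\<in>W m. T u \<in> W m \<and> T' u \<in> W m) \<longrightarrow>
      (\<forall>u\<in>supported (dominating \<xi> N). \<forall>w\<in>supported (dominating \<xi> N). pm_inner (T u) w = pm_inner u (T' w)) \<longrightarrow>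
      intertwines ?L ?\<Psi> g T \<longrightarrow> intertwines (assoc_graded r ?L ?v) \<Theta> g T)"
  proof (rule graded_linear_model[OF gr L FW _ _ finite_dominating])
    show "pm.subspace (W m)" for m unfolding W_def by (rule filt_span_subspace)
    show "W m \<subseteq> W (Suc m)" for m unfolding W_def by (rule filt_span_mono) simp
    show "W m \<subseteq> supported (dominating \<xi> N)" for m using WU Alt_sup by blast
  qed
  then obtain \<Theta> where \<Theta>: "linear_model (assoc_graded r ?L ?v) \<Theta> (\<Union>m. W m)"
    and \<Theta>_act: "\<And>g T T'. pm_linear T \<Longrightarrow> \<forall>m. \<forall>u\<in>W m. T u \<in> W m \<and> T' u \<in> W m \<Longrightarrow>
      \<forall>u\<in>supported (dominating \<xi> N). \<forall>w\<in>supported (dominating \<xi> N). pm_inner (T u) w = pm_inner u (T' w) \<Longrightarrow>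
      intertwines ?L ?\<Psi> g T \<Longrightarrow> intertwines (assoc_graded r ?L ?v) \<Theta> g T" by blast
  have stable: "?act (gl_tensor g 1) u \<in> W m" if "g \<in> carrier_mat r r" "u \<in> W m" for g :: "complex mat" and u m
    using filt_span_act[OF gl_tensor_one_G_filt[OF that(1)], of u n N ?vt m] that(2) by (simp add: W_def)
  have carV: "carrier (V_mod \<xi> N) = carrier (assoc_graded r ?L ?v)"
    and actV: "act (V_mod \<xi> N) g = act (assoc_graded r ?L ?v) (gl_tensor g 1)" for g
    by (simp_all add: V_mod_def pullback_rep_def n_def r_def)
  show ?thesis
  proof (rule that)
    show "linear_model (V_mod \<xi> N) \<Theta> (Alt n ` supported (dominating \<xi> N))"
      using \<Theta> unfolding WU by (simp add: linear_model_def V_mod_def pullback_rep_def n_def r_def)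
    fix g :: "complex mat" assume g: "g \<in> carrier_mat r r"
    have "supported (dominating \<xi> N) \<subseteq> supported ({1..n} \<rightarrow>\<^sub>E ?B)"
      by (auto simp: supported_def dominating_def n_def r_def)
    then have adj: "\<forall>u\<in>supported (dominating \<xi> N). \<forall>w\<in>supported (dominating \<xi> N).
        pm_inner (?act (gl_tensor g 1) u) w = pm_inner u (?act (gl_tensor (adjoint_mat r g) 1) w)"
      by (intro ballI tensor_act_adjoint[OF g]) blast+
    have "intertwines (assoc_graded r ?L ?v) \<Theta> (gl_tensor g 1) (?act (gl_tensor g 1))"
    proof (rule \<Theta>_act[OF pm_linear_tensor_act _ adj])
      show "\<forall>m. \<forall>u\<in>W m. ?act (gl_tensor g 1) u \<in> W m \<and> ?act (gl_tensor (adjoint_mat r g) 1) u \<in> W m"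
        using stable[OF g] stable[OF adjoint_mat_carrier[of r g]] by blast
    qed (use L_act in \<open>auto simp: intertwines_def\<close>)
    then show "intertwines (V_mod \<xi> N) \<Theta> g (?act (gl_tensor g 1))"
      by (simp add: intertwines_def carV actV)
  qed
qed

section \<open>Parking functions\<close>

text \<open>For \<open>s\<close> from \<open>1\<close> to the length of \<open>\<rho>\<close>, the entry \<open>\<rho> ! (length \<rho> - s)\<close> is the \<open>s\<close>-th smallest part. The
  left-hand side bounds \<open>c\<close> at the values of the parts only, where the number of parts up to that value
  jumps; this suffices because \<open>c\<close> is monotone.\<close>

lemma parking_condition_iff:
  fixes \<rho> :: "nat list" and c :: "nat \<Rightarrow> nat"
  assumes sorted: "sorted_wrt (\<ge>) \<rho>" and "mono c"
  shows "(\<forall>s\<in>{1..length \<rho>}. s \<le> c (\<rho> ! (length \<rho> - s))) \<longleftrightarrow> (\<forall>t. length (filter (\<lambda>x. x \<le> t) \<rho>) \<le> c t)"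
proof -
  let ?l = "length \<rho>"
  have dec: "\<rho> ! j \<le> \<rho> ! i" if "i \<le> j" "j < ?l" for i j
    using sorted_wrt_nth_less[OF sorted, of i j] that by (cases "i = j") auto
  have len: "length (filter (\<lambda>x. x \<le> t) \<rho>) = card {i. i < ?l \<and> \<rho> ! i \<le> t}" for t
    by (rule length_filter_conv_card)
  show ?thesis
  proof (intro iffI allI ballI)
    fix t assume park: "\<forall>s\<in>{1..?l}. s \<le> c (\<rho> ! (?l - s))"
    let ?k = "length (filter (\<lambda>x. x \<le> t) \<rho>)"
    show "?k \<le> c t"
    proof (cases "?k = 0")
      case False
      have "1 \<le> ?k" using False by linarith
      then have k: "?k \<in> {1..?l}" using length_filter_le[of "\<lambda>x. x \<le> t" \<rho>] by (simp only: atLeastAtMost_iff simp_thms)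
      have "\<rho> ! (?l - ?k) \<le> t"
      proof (rule ccontr)
        assume "\<not> \<rho> ! (?l - ?k) \<le> t"
        then have "{i. i < ?l \<and> \<rho> ! i \<le> t} \<subseteq> {?l - ?k<..<?l}"
          using dec[of _ "?l - ?k"] k by (force simp: not_le)
        then have "card {i. i < ?l \<and> \<rho> ! i \<le> t} \<le> card {?l - ?k<..<?l}" by (intro card_mono) auto
        then show False using k len[of t] by auto
      qed
      then show ?thesis using park k \<open>mono c\<close> by (meson monoD order_trans)
    qed simp
  next
    fix s assume all: "\<forall>t. length (filter (\<lambda>x. x \<le> t) \<rho>) \<le> c t" and s: "s \<in> {1..?l}"
    let ?t = "\<rho> ! (?l - s)"
    have "card {?l - s..<?l} \<le> card {i. i < ?l \<and> \<rho> ! i \<le> ?t}"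
      using dec s by (intro card_mono) auto
    then show "s \<le> c ?t" using all[rule_format, of ?t] len[of ?t] s by simp
  qed
qed

lemma length_filter_le_sum_count:
  fixes t :: nat
  assumes "0 \<notin> set \<rho>"
  shows "length (filter (\<lambda>x. x \<le> t) \<rho>) = (\<Sum>j=1..t. count_list \<rho> j)"
proof (induction t)
  case 0
  then show ?case using assms by (auto simp: filter_empty_conv intro!: gr0I)
next
  case (Suc t)
  have "length (filter (\<lambda>x. x \<le> Suc t) xs) = length (filter (\<lambda>x. x \<le> t) xs) + count_list xs (Suc t)" for xs :: "nat list"
    by (induction xs) auto
  then show ?case using Suc by simp
qed

text \<open>The number of parts of \<open>\<rho>\<close> that are at most \<open>s\<close> is \<open>\<xi>\<^sup>t\<^sub>1 + \<dots> + \<xi>\<^sup>t\<^sub>s = \<Sum>\<^sub>j min \<xi>\<^sub>j s\<close>.\<close>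

lemma parking_functions_iff:
  assumes "sorted_wrt (\<ge>) \<rho>" "0 \<notin> set \<rho>"
    and "\<And>j. 1 \<le> j \<Longrightarrow> count_list \<rho> j = transposed_part \<xi> j"
    and f: "f \<in> {1..n} \<rightarrow>\<^sub>E {1..n}"
  shows "f \<in> parking_functions n \<rho> \<longleftrightarrow>
    (\<forall>s. (\<Sum>j<length \<xi>. min (\<xi> ! j) s) \<le> card {i \<in> {1..n}. f i \<le> s})"
proof -
  let ?c = "\<lambda>s. card {i \<in> {1..n}. f i \<le> s}"
  have "mono ?c" by (rule monoI) (intro card_mono, auto)
  have c: "card {i \<in> {1..n}. f i \<in> {1..s}} = ?c s" for s
    using f by (intro arg_cong[where f = card]) (auto simp: PiE_iff)
  have "length (filter (\<lambda>x. x \<le> t) \<rho>) = (\<Sum>j<length \<xi>. min (\<xi> ! j) t)" for t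
    using length_filter_le_sum_count[OF assms(2), of t] assms(3) sum_transposed_part[of \<xi> t] by simp
  then show ?thesis
    using parking_condition_iff[OF assms(1) \<open>mono ?c\<close>] f by (simp only: parking_functions_def c mem_Collect_eq simp_thms)
qed

section \<open>The Lie algebra action on the invariants\<close>

lemma lin_ext_swap:
  "lin_ext (\<lambda>y. lin_ext (\<lambda>x. h x y) s) t = lin_ext (\<lambda>x. lin_ext (\<lambda>y. h x y) t) s"
  unfolding lin_ext_def scale_sum scale_scale by (subst sum.swap) (simp add: mult.commute)

lemma slot_act_comp_same:
  assumes "pm_linear a"
  shows "slot_act i a (slot_act i b (bvec w)) = lin_ext (\<lambda>x. bvec (w(i := x))) (a (b (bvec (w i))))"
proof -
  have "slot_act i a (slot_act i b (bvec w)) =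
      lin_ext (\<lambda>y. lin_ext (\<lambda>x. bvec (w(i := x))) (a (bvec y))) (b (bvec (w i)))"
    by (simp add: slot_act_bvec pm_linear_lin_ext_comp[of "slot_act i a"])
  also have "\<dots> = lin_ext (\<lambda>x. bvec (w(i := x))) (lin_ext (\<lambda>y. a (bvec y)) (b (bvec (w i))))"
    by (simp add: pm_linear_lin_ext_comp[of "lin_ext _"])
  finally show ?thesis by (simp add: pm_linear_lin_ext_eq[OF assms, symmetric])
qed

lemma slot_act_comp_commute:
  assumes "i \<noteq> j"
  shows "slot_act i a (slot_act j b (bvec w)) = slot_act j b (slot_act i a (bvec w))"
  using assms
  by (simp add: slot_act_bvec pm_linear_lin_ext_comp[of "slot_act _ _"] fun_upd_twist
      lin_ext_swap[of "\<lambda>x y. bvec (w(i := x, j := y))"])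

text \<open>In the commutator of two sums of one-factor operators, the terms with different factors cancel.\<close>

lemma tensor_act_bracket:
  assumes lin: "pm_linear (\<alpha> A)" "pm_linear (\<alpha> B)"
    and C: "\<And>b. b \<in> Bs \<Longrightarrow> \<alpha> C (bvec b) = \<alpha> A (\<alpha> B (bvec b)) - \<alpha> B (\<alpha> A (bvec b))"
    and w: "w \<in> {1..n} \<rightarrow>\<^sub>E Bs"
  shows "tensor_act n \<alpha> C (bvec w) =
    tensor_act n \<alpha> A (tensor_act n \<alpha> B (bvec w)) - tensor_act n \<alpha> B (tensor_act n \<alpha> A (bvec w))"
proof -
  let ?a = "\<lambda>i. slot_act i (\<alpha> A)" and ?b = "\<lambda>i. slot_act i (\<alpha> B)"
  have "tensor_act n \<alpha> A (tensor_act n \<alpha> B (bvec w)) - tensor_act n \<alpha> B (tensor_act n \<alpha> A (bvec w)) =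
      (\<Sum>i\<in>{1..n}. \<Sum>j\<in>{1..n}. ?a i (?b j (bvec w))) - (\<Sum>j\<in>{1..n}. \<Sum>i\<in>{1..n}. ?b j (?a i (bvec w)))"
    by (simp add: tensor_act_eq_slots pm_linear_sum)
  also have "\<dots> = (\<Sum>i\<in>{1..n}. \<Sum>j\<in>{1..n}. ?a i (?b j (bvec w)) - ?b j (?a i (bvec w)))"
    by (subst (2) sum.swap) (simp add: sum_subtractf)
  also have "\<dots> = (\<Sum>i\<in>{1..n}. \<Sum>j\<in>{1..n}. if i = j then ?a i (?b i (bvec w)) - ?b i (?a i (bvec w)) else 0)"
    by (intro sum.cong refl) (auto simp: slot_act_comp_commute)
  also have "\<dots> = (\<Sum>i\<in>{1..n}. ?a i (?b i (bvec w)) - ?b i (?a i (bvec w)))"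
    by (simp add: sum.delta)
  also have "\<dots> = (\<Sum>i\<in>{1..n}. slot_act i (\<alpha> C) (bvec w))"
    by (intro sum.cong refl)
      (simp add: slot_act_comp_same lin C[OF PiE_mem[OF w]] lin_ext_diff slot_act_bvec[of _ "\<alpha> C"])
  finally show ?thesis by (simp add: tensor_act_eq_slots)
qed

lemma gl_act_bvec: "gl_act r A (bvec j) = (\<Sum>k<r. Poly_Mapping.single k (A $$ (k, j)))"
  by (simp add: gl_act_def)

lemma pm_linear_gl_act [simp]: "pm_linear (gl_act r A)"
  by (simp add: gl_act_def)

lemma gl_act_add:
  assumes "A \<in> carrier_mat r r" "B \<in> carrier_mat r r" "j < r"
  shows "gl_act r (A + B) (bvec j) = gl_act r A (bvec j) + gl_act r B (bvec j)"
  using assms by (simp add: gl_act_bvec single_add sum.distrib)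

lemma gl_act_smult:
  assumes "A \<in> carrier_mat r r" "j < r"
  shows "gl_act r (c \<cdot>\<^sub>m A) (bvec j) = scale c (gl_act r A (bvec j))"
  using assms by (simp add: gl_act_bvec scale_sum scale_single)

lemma single_sum: "Poly_Mapping.single k (\<Sum>a\<in>A. f a) = (\<Sum>a\<in>A. Poly_Mapping.single k (f a))"
  by (induction A rule: infinite_finite_induct) (simp_all add: single_add)

lemma gl_act_mult:
  assumes A: "A \<in> carrier_mat r r" and B: "B \<in> carrier_mat r r" and "j < r"
  shows "gl_act r (A * B) (bvec j) = gl_act r A (gl_act r B (bvec j))"
proof -
  have entry: "(A * B) $$ (k, j) = (\<Sum>l<r. A $$ (k, l) * B $$ (l, j))" if "k < r" for k
    using assms that by (simp add: scalar_prod_def atLeast0LessThan)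
  have "gl_act r A (gl_act r B (bvec j)) = (\<Sum>l<r. \<Sum>k<r. Poly_Mapping.single k (B $$ (l, j) * A $$ (k, l)))"
    by (simp add: gl_act_def pm_linear_sum[OF pm_linear_lin_ext] scale_sum scale_single)
  also have "\<dots> = (\<Sum>k<r. Poly_Mapping.single k (\<Sum>l<r. A $$ (k, l) * B $$ (l, j)))"
    by (subst sum.swap) (rule sum.cong, simp_all add: single_sum mult.commute)
  also have "\<dots> = gl_act r (A * B) (bvec j)"
    by (simp add: gl_act_bvec entry)
  finally show ?thesis ..
qed

lemma gl_act_bracket:
  assumes A: "A \<in> carrier_mat r r" and B: "B \<in> carrier_mat r r" and j: "j < r"
  shows "gl_act r (A * B - B * A) (bvec j) = gl_act r A (gl_act r B (bvec j)) - gl_act r B (gl_act r A (bvec j))"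
proof -
  have "gl_act r (A * B - B * A) (bvec j) = gl_act r (A * B) (bvec j) - gl_act r (B * A) (bvec j)"
    using assms by (simp add: gl_act_bvec single_diff sum_subtractf)
  then show ?thesis using gl_act_mult assms by simp
qed

text \<open>The embedding \<open>t \<mapsto> t \<otimes> f\<close>. It reduces the action on \<open>V\<^sub>r\<^sup>\<otimes>\<^sup>n \<otimes> \<complex>PF\<^sub>n(\<rho>)\<close> to the one on \<open>V\<^sub>r\<^sup>\<otimes>\<^sup>n\<close>.\<close>

definition with_function :: "'f \<Rightarrow> ('w \<Rightarrow>\<^sub>0 complex) \<Rightarrow> ('w \<times> 'f \<Rightarrow>\<^sub>0 complex)" where
  "with_function f = lin_ext (\<lambda>w. bvec (w, f))"

lemma pm_linear_with_function [simp]: "pm_linear (with_function f)"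
  by (simp add: with_function_def)

lemma pm_linear_tensor_PF_gl_act [simp]: "pm_linear (tensor_PF_gl_act r n A)"
  by (simp add: tensor_PF_gl_act_def)

lemma tensor_PF_gl_act_bvec:
  "tensor_PF_gl_act r n A (bvec (w, f)) = with_function f (tensor_act n (gl_act r) A (bvec w))"
  by (simp add: tensor_PF_gl_act_def with_function_def)

lemma tensor_PF_gl_act_with_function:
  "tensor_PF_gl_act r n A (with_function f t) = with_function f (tensor_act n (gl_act r) A t)"
proof (rule pm_linear_eqI[where B = UNIV and f = "\<lambda>t. tensor_PF_gl_act r n A (with_function f t)"
      and g = "\<lambda>t. with_function f (tensor_act n (gl_act r) A t)"])
  fix w
  show "tensor_PF_gl_act r n A (with_function f (bvec w)) =
      with_function f (tensor_act n (gl_act r) A (bvec w))"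
    by (simp add: tensor_PF_gl_act_bvec[symmetric]) (simp add: with_function_def)
qed (rule pm_linear_compose[OF pm_linear_tensor_PF_gl_act pm_linear_with_function],
    rule pm_linear_compose[OF pm_linear_with_function pm_linear_tensor_act], simp)

lemma tensor_PF_gl_act_laws:
  assumes A: "A \<in> carrier_mat r r" and B: "B \<in> carrier_mat r r"
    and t: "t \<in> supported (({1..n} \<rightarrow>\<^sub>E {..<r}) \<times> P)"
  shows "tensor_PF_gl_act r n (A + B) t = tensor_PF_gl_act r n A t + tensor_PF_gl_act r n B t"
    and "tensor_PF_gl_act r n (c \<cdot>\<^sub>m A) t = scale c (tensor_PF_gl_act r n A t)"
    and "tensor_PF_gl_act r n (A * B - B * A) t =
      tensor_PF_gl_act r n A (tensor_PF_gl_act r n B t) - tensor_PF_gl_act r n B (tensor_PF_gl_act r n A t)"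
proof -
  let ?\<alpha> = "tensor_PF_gl_act r n" and ?t = "tensor_act n (gl_act r)"
  have keys: "Poly_Mapping.keys t \<subseteq> ({1..n} \<rightarrow>\<^sub>E {..<r}) \<times> P" using t by (simp add: supported_def)
  have r: "w i < r" if "w \<in> {1..n} \<rightarrow>\<^sub>E {..<r}" "i \<in> {1..n}" for w i using PiE_mem[OF that] by simp
  have comp: "pm_linear (\<lambda>t. ?\<alpha> A (?\<alpha> B t))" for A B
    by (rule pm_linear_compose[OF pm_linear_tensor_PF_gl_act pm_linear_tensor_PF_gl_act])
  show "?\<alpha> (A + B) t = ?\<alpha> A t + ?\<alpha> B t"
  proof (rule pm_linear_eqI[OF _ _ _ keys, where f = "?\<alpha> (A + B)" and g = "\<lambda>t. ?\<alpha> A t + ?\<alpha> B t"])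
    show "pm_linear (\<lambda>t. ?\<alpha> A t + ?\<alpha> B t)"
      by (rule pm_linearI) (simp_all add: pm_linear_add pm_linear_scale scale_add_right)
    fix b assume "b \<in> ({1..n} \<rightarrow>\<^sub>E {..<r}) \<times> P"
    then obtain w f where b: "b = (w, f)" "w \<in> {1..n} \<rightarrow>\<^sub>E {..<r}" by blast
    have "?t (A + B) (bvec w) = ?t A (bvec w) + ?t B (bvec w)"
      using gl_act_add[OF A B r[OF b(2)]]
      by (simp add: tensor_act_eq_slots slot_act_bvec lin_ext_add sum.distrib)
    then show "?\<alpha> (A + B) (bvec b) = ?\<alpha> A (bvec b) + ?\<alpha> B (bvec b)"
      by (simp add: b(1) tensor_PF_gl_act_bvec pm_linear_add)
  qed simp
  show "?\<alpha> (c \<cdot>\<^sub>m A) t = scale c (?\<alpha> A t)"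
  proof (rule pm_linear_eqI[OF _ _ _ keys, where f = "?\<alpha> (c \<cdot>\<^sub>m A)" and g = "\<lambda>t. scale c (?\<alpha> A t)"])
    show "pm_linear (\<lambda>t. scale c (?\<alpha> A t))" by (intro pm_linear_scale_fun pm_linear_tensor_PF_gl_act)
    fix b assume "b \<in> ({1..n} \<rightarrow>\<^sub>E {..<r}) \<times> P"
    then obtain w f where b: "b = (w, f)" "w \<in> {1..n} \<rightarrow>\<^sub>E {..<r}" by blast
    have "?t (c \<cdot>\<^sub>m A) (bvec w) = scale c (?t A (bvec w))"
      using gl_act_smult[OF A r[OF b(2)]]
      by (simp add: tensor_act_eq_slots slot_act_bvec lin_ext_scale scale_sum)
    then show "?\<alpha> (c \<cdot>\<^sub>m A) (bvec b) = scale c (?\<alpha> A (bvec b))"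
      by (simp add: b(1) tensor_PF_gl_act_bvec pm_linear_scale)
  qed simp
  show "?\<alpha> (A * B - B * A) t = ?\<alpha> A (?\<alpha> B t) - ?\<alpha> B (?\<alpha> A t)"
  proof (rule pm_linear_eqI[OF _ _ _ keys, where f = "?\<alpha> (A * B - B * A)"
        and g = "\<lambda>t. ?\<alpha> A (?\<alpha> B t) - ?\<alpha> B (?\<alpha> A t)"])
    show "pm_linear (\<lambda>t. ?\<alpha> A (?\<alpha> B t) - ?\<alpha> B (?\<alpha> A t))" by (intro pm_linear_minus_fun comp)
    fix b assume "b \<in> ({1..n} \<rightarrow>\<^sub>E {..<r}) \<times> P"
    then obtain w f where b: "b = (w, f)" "w \<in> {1..n} \<rightarrow>\<^sub>E {..<r}" by blast
    have "?t (A * B - B * A) (bvec w) = ?t A (?t B (bvec w)) - ?t B (?t A (bvec w))"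
      by (rule tensor_act_bracket[OF pm_linear_gl_act pm_linear_gl_act _ b(2)])
        (simp add: gl_act_bracket[OF A B])
    then show "?\<alpha> (A * B - B * A) (bvec b) = ?\<alpha> A (?\<alpha> B (bvec b)) - ?\<alpha> B (?\<alpha> A (bvec b))"
      by (simp add: b(1) tensor_PF_gl_act_bvec tensor_PF_gl_act_with_function pm_linear_diff)
  qed simp
qed

section \<open>Parking functions as levels of tensors\<close>

text \<open>A factor \<open>u\<^sub>j \<otimes> x\<^bsup>N - s\<^esup>\<close> is encoded by \<open>j\<close> and the value \<open>s\<close> of the parking function. Degrees in the
  truncated module are less than \<open>N\<close>, so \<open>s \<ge> 1\<close>.\<close>

definition split_levels :: "nat \<Rightarrow> int \<Rightarrow> (nat \<Rightarrow> nat \<times> int) \<Rightarrow> (nat \<Rightarrow> nat) \<times> (nat \<Rightarrow> nat)" where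
  "split_levels n N w = (restrict (\<lambda>i. fst (w i)) {1..n}, restrict (\<lambda>i. nat (N - snd (w i))) {1..n})"

definition join_levels :: "nat \<Rightarrow> int \<Rightarrow> (nat \<Rightarrow> nat) \<times> (nat \<Rightarrow> nat) \<Rightarrow> nat \<Rightarrow> nat \<times> int" where
  "join_levels n N = (\<lambda>(u, f). restrict (\<lambda>i. (u i, N - int (f i))) {1..n})"

lemma join_split_levels:
  assumes "w \<in> {1..n} \<rightarrow>\<^sub>E VN_basis r N"
  shows "join_levels n N (split_levels n N w) = w"
proof
  fix i
  show "join_levels n N (split_levels n N w) i = w i"
    using PiE_mem[OF assms, of i] PiE_arb[OF assms, of i]
    by (cases "i \<in> {1..n}") (auto simp: join_levels_def split_levels_def VN_basis_def)
qed

lemma split_join_levels: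
  assumes "u \<in> extensional {1..n}" "f \<in> extensional {1..n}"
  shows "split_levels n N (join_levels n N (u, f)) = (u, f)"
  using assms by (auto simp: split_levels_def join_levels_def fun_eq_iff extensional_def)

lemma split_levels_perm:
  assumes "\<sigma> permutes {1..n}"
  shows "split_levels n N (w \<circ> \<sigma>) = (fst (split_levels n N w) \<circ> \<sigma>, snd (split_levels n N w) \<circ> \<sigma>)"
  using permutes_in_image[OF assms] by (simp add: split_levels_def fun_eq_iff restrict_def)

lemma split_levels_upd:
  assumes "i \<in> {1..n}"
  shows "split_levels n N (w(i := (k, snd (w i)))) = ((fst (split_levels n N w))(i := k), snd (split_levels n N w))"
  using assms by (auto simp: split_levels_def fun_eq_iff)

context
  fixes r n :: nat and \<xi> \<rho> :: "nat list" and N :: int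
  assumes r: "length \<xi> = r" and n: "n = sum_list \<xi>"
    and \<rho>: "sorted_wrt (\<ge>) \<rho>" "0 \<notin> set \<rho>" "\<And>j. 1 \<le> j \<Longrightarrow> count_list \<rho> j = transposed_part \<xi> j"
begin

lemma dominating_PiE: "w \<in> dominating \<xi> N \<Longrightarrow> w \<in> {1..n} \<rightarrow>\<^sub>E VN_basis r N"
  by (simp add: dominating_def r n)

lemma split_levels_dominating:
  assumes w: "w \<in> dominating \<xi> N"
  shows "split_levels n N w \<in> ({1..n} \<rightarrow>\<^sub>E {..<r}) \<times> parking_functions n \<rho>"
proof -
  let ?f = "restrict (\<lambda>i. nat (N - snd (w i))) {1..n}"
  have basis: "fst (w i) < r \<and> snd (w i) < N" if "i \<in> {1..n}" for i
    using PiE_mem[OF dominating_PiE[OF w] that] by (auto simp: VN_basis_def)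
  have f: "?f \<in> {1..n} \<rightarrow>\<^sub>E {1..n}"
  proof (rule PiE_I)
    fix i assume i: "i \<in> {1..n}"
    have "1 \<le> nat (N - snd (w i))" using basis[OF i] by arith
    moreover have "nat (N - snd (w i)) \<le> n"
      using dominating_bounded[OF w, of i] i by (simp add: n nat_le_iff)
    ultimately show "?f i \<in> {1..n}" using i by simp
  qed auto
  have "{i \<in> {1..n}. ?f i \<le> s} = {i \<in> {1..n}. N - int s \<le> snd (w i)}" for s
    by (auto simp: nat_le_iff)
  then have "?f \<in> parking_functions n \<rho>"
    using w by (simp only: parking_functions_iff[OF \<rho> f]) (simp only: dominating_def n mem_Collect_eq simp_thms)
  then show ?thesis using basis by (auto simp: split_levels_def)
qed

lemma join_levels_dominating:
  assumes "(u, f) \<in> ({1..n} \<rightarrow>\<^sub>E {..<r}) \<times> parking_functions n \<rho>"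
  shows "join_levels n N (u, f) \<in> dominating \<xi> N" "split_levels n N (join_levels n N (u, f)) = (u, f)"
proof -
  have u: "u \<in> {1..n} \<rightarrow>\<^sub>E {..<r}" and f: "f \<in> {1..n} \<rightarrow>\<^sub>E {1..n}" and park: "f \<in> parking_functions n \<rho>"
    using assms by (auto simp: parking_functions_def)
  show "split_levels n N (join_levels n N (u, f)) = (u, f)"
    using u f by (intro split_join_levels) (auto simp: PiE_def)
  let ?w = "join_levels n N (u, f)"
  have "{i \<in> {1..n}. N - int s \<le> snd (?w i)} = {i \<in> {1..n}. f i \<le> s}" for s
    by (auto simp: join_levels_def)
  moreover have "?w \<in> {1..n} \<rightarrow>\<^sub>E VN_basis r N"
  proof (rule PiE_I)
    fix i assume i: "i \<in> {1..n}"
    have "u i < r" "1 \<le> f i" using PiE_mem[OF u i] PiE_mem[OF f i] by auto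
    then show "?w i \<in> VN_basis r N" using i by (simp add: join_levels_def VN_basis_def)
  qed (auto simp: join_levels_def)
  moreover have "\<forall>s. (\<Sum>j<length \<xi>. min (\<xi> ! j) s) \<le> card {i \<in> {1..n}. f i \<le> s}"
    using park parking_functions_iff[OF \<rho> f] by blast
  ultimately show "?w \<in> dominating \<xi> N" by (simp only: dominating_def r n mem_Collect_eq simp_thms)
qed

definition relabel :: "((nat \<Rightarrow> nat \<times> int) \<Rightarrow>\<^sub>0 complex) \<Rightarrow> ((nat \<Rightarrow> nat) \<times> (nat \<Rightarrow> nat) \<Rightarrow>\<^sub>0 complex)" where
  "relabel = lin_ext (\<lambda>w. bvec (split_levels n N w))"

lemma pm_linear_relabel [simp]: "pm_linear relabel"
  by (simp add: relabel_def)

lemma relabel_bvec: "relabel (bvec w) = bvec (split_levels n N w)"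
  by (simp add: relabel_def)

lemma relabel_perm:
  assumes \<sigma>: "\<sigma> permutes {1..n}"
  shows "tensor_PF_perm_act \<sigma> (relabel t) = scale (of_int (sign \<sigma>)) (relabel (perm_op (inv_into UNIV \<sigma>) t))"
proof (rule pm_linear_eqI[where B = UNIV and f = "\<lambda>t. tensor_PF_perm_act \<sigma> (relabel t)"
      and g = "\<lambda>t. scale (of_int (sign \<sigma>)) (relabel (perm_op (inv_into UNIV \<sigma>) t))"])
  show "pm_linear (\<lambda>t. tensor_PF_perm_act \<sigma> (relabel t))"
    unfolding tensor_PF_perm_act_def by (rule pm_linear_compose[OF pm_linear_lin_ext pm_linear_relabel])
  show "pm_linear (\<lambda>t. scale (of_int (sign \<sigma>)) (relabel (perm_op (inv_into UNIV \<sigma>) t)))"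
    by (rule pm_linear_scale_fun[OF pm_linear_compose[OF pm_linear_relabel pm_linear_perm_op]])
  fix w
  show "tensor_PF_perm_act \<sigma> (relabel (bvec w)) =
      scale (of_int (sign \<sigma>)) (relabel (perm_op (inv_into UNIV \<sigma>) (bvec w)))"
    unfolding perm_op_bvec relabel_bvec split_levels_perm[OF permutes_inv[OF \<sigma>]]
    by (simp add: tensor_PF_perm_act_def split_beta scale_single)
qed simp

lemma relabel_gl_act:
  assumes A: "A \<in> carrier_mat r r" and t: "t \<in> supported (dominating \<xi> N)"
  shows "tensor_PF_gl_act r n A (relabel t) = relabel (tensor_act n (VN_act r N) (gl_tensor A 1) t)"
proof (rule pm_linear_eqI[where B = "dominating \<xi> N" and f = "\<lambda>t. tensor_PF_gl_act r n A (relabel t)"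
      and g = "\<lambda>t. relabel (tensor_act n (VN_act r N) (gl_tensor A 1) t)"])
  show "Poly_Mapping.keys t \<subseteq> dominating \<xi> N" using t by (simp add: supported_def)
  fix w assume w: "w \<in> dominating \<xi> N"
  obtain u f where uf: "split_levels n N w = (u, f)" by fastforce
  have u: "u i = fst (w i)" if "i \<in> {1..n}" for i using uf that by (auto simp: split_levels_def)
  have "tensor_PF_gl_act r n A (relabel (bvec w)) =
      (\<Sum>i\<in>{1..n}. with_function f (slot_act i (gl_act r A) (bvec u)))"
    by (simp add: relabel_bvec uf tensor_PF_gl_act_bvec tensor_act_eq_slots pm_linear_sum)
  also have "\<dots> = (\<Sum>i\<in>{1..n}. \<Sum>k<r. scale (A $$ (k, fst (w i))) (bvec (u(i := k), f)))"
    by (intro sum.cong refl)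
      (simp add: slot_act_bvec gl_act_bvec pm_linear_sum pm_linear_scale u with_function_def)
  also have "\<dots> = (\<Sum>i\<in>{1..n}. \<Sum>k<r. scale (A $$ (k, fst (w i))) (relabel (bvec (w(i := (k, snd (w i)))))))"
    by (intro sum.cong refl) (simp add: relabel_bvec split_levels_upd uf)
  also have "\<dots> = relabel (tensor_act n (VN_act r N) (gl_tensor A 1) (bvec w))"
    by (simp add: tensor_act_gl_one_bvec[OF A dominating_PiE[OF w]] pm_linear_sum pm_linear_scale)
  finally show "tensor_PF_gl_act r n A (relabel (bvec w)) =
      relabel (tensor_act n (VN_act r N) (gl_tensor A 1) (bvec w))" .
qed (rule pm_linear_compose[OF pm_linear_tensor_PF_gl_act pm_linear_relabel],
    rule pm_linear_compose[OF pm_linear_relabel pm_linear_tensor_act])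

text \<open>As dominance does not depend on the order of the factors, the antisymmetrisations of dominating tensors
  are the antisymmetric tensors supported on dominating ones.\<close>

lemma Alt_image_iff:
  "t \<in> Alt n ` supported (dominating \<xi> N) \<longleftrightarrow> t \<in> supported (dominating \<xi> N) \<and>
    (\<forall>\<sigma>. \<sigma> permutes {1..n} \<longrightarrow> perm_op \<sigma> t = scale (of_int (sign \<sigma>)) t)"
proof
  assume "t \<in> Alt n ` supported (dominating \<xi> N)"
  then obtain s where s: "s \<in> supported (dominating \<xi> N)" "t = Alt n s" by auto
  then have "Alt n s \<in> supported (dominating \<xi> N)" using Alt_supported_dominating n by blast
  then show "t \<in> supported (dominating \<xi> N) \<and>
      (\<forall>\<sigma>. \<sigma> permutes {1..n} \<longrightarrow> perm_op \<sigma> t = scale (of_int (sign \<sigma>)) t)"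
    using perm_op_Alt s(2) by blast
next
  assume t: "t \<in> supported (dominating \<xi> N) \<and>
    (\<forall>\<sigma>. \<sigma> permutes {1..n} \<longrightarrow> perm_op \<sigma> t = scale (of_int (sign \<sigma>)) t)"
  then have "Alt n t = scale (fact n) t" by (intro Alt_antisymmetric) blast
  then have "t = Alt n (scale (1 / fact n) t)" by (simp add: pm_linear_scale scale_scale)
  then show "t \<in> Alt n ` supported (dominating \<xi> N)"
    using t pm.subspace_scale[OF supported_subspace] by blast
qed

text \<open>A permutation acts on an antisymmetric tensor by its sign, which cancels the sign of the twist by
  \<open>Sign\<close>.\<close>

lemma bij_betw_relabel:
  "bij_betw relabel (Alt n ` supported (dominating \<xi> N)) (carrier (tensor_PF_invariants r n \<rho>))"
proof -
  let ?A = "Alt n ` supported (dominating \<xi> N)" and ?S = "({1..n} \<rightarrow>\<^sub>E {..<r}) \<times> parking_functions n \<rho>"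
  let ?R = "{t \<in> supported ?S. \<forall>\<sigma>. \<sigma> permutes {1..n} \<longrightarrow> tensor_PF_perm_act \<sigma> t = t}"
  have R: "carrier (tensor_PF_invariants r n \<rho>) = ?R"
    by (simp add: tensor_PF_invariants_def sub_rep_def tensor_PF_def free_rep_def supported_def)
  define join where "join = lin_ext (\<lambda>p. bvec (join_levels n N p) :: (nat \<Rightarrow> nat \<times> int) \<Rightarrow>\<^sub>0 complex)"
  have join_lin: "pm_linear join" by (simp add: join_def)
  have supp: "relabel t \<in> supported ?S" if "t \<in> supported (dominating \<xi> N)" for t
    by (rule pm_linear_span[OF pm_linear_relabel supported_subspace _ that[unfolded supported_span]])
      (use split_levels_dominating in \<open>auto simp: relabel_bvec\<close>)
  have join_supp: "join t \<in> supported (dominating \<xi> N)" if "t \<in> supported ?S" for t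
    by (rule pm_linear_span[OF join_lin supported_subspace _ that[unfolded supported_span]])
      (use join_levels_dominating(1) in \<open>auto simp: join_def\<close>)
  have join_relabel: "join (relabel t) = t" if "t \<in> supported (dominating \<xi> N)" for t
  proof (rule pm_linear_eqI[where B = "dominating \<xi> N" and f = "\<lambda>t. join (relabel t)" and g = "\<lambda>t. t"])
    show "join (relabel (bvec w)) = bvec w" if "w \<in> dominating \<xi> N" for w
      using join_split_levels[OF dominating_PiE[OF that]] by (simp add: relabel_bvec join_def)
  qed (use that in \<open>simp_all add: supported_def pm_linear_id pm_linear_compose[OF join_lin pm_linear_relabel]\<close>)
  have relabel_join: "relabel (join t) = t" if "t \<in> supported ?S" for t
  proof (rule pm_linear_eqI[where B = ?S and f = "\<lambda>t. relabel (join t)" and g = "\<lambda>t. t"])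
    show "relabel (join (bvec p)) = bvec p" if "p \<in> ?S" for p
      using join_levels_dominating(2)[of "fst p" "snd p"] that by (simp add: relabel_bvec join_def)
  qed (use that in \<open>simp_all add: supported_def pm_linear_id pm_linear_compose[OF pm_linear_relabel join_lin]\<close>)
  have sgn: "sign (inv_into UNIV \<sigma>) = sign \<sigma>" if "\<sigma> permutes {1..n}" for \<sigma>
    using that permutation_permutes by (intro sign_inverse) blast
  have "bij_betw relabel ?A ?R"
  proof (rule bij_betw_byWitness[where f' = join])
    show "\<forall>t\<in>?A. join (relabel t) = t" using join_relabel Alt_image_iff by blast
    show "\<forall>t\<in>?R. relabel (join t) = t" using relabel_join by blast
    show "relabel ` ?A \<subseteq> ?R"
    proof
      fix y assume "y \<in> relabel ` ?A"
      then obtain t where y: "y = relabel t" and t: "t \<in> ?A" by blast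
      have "tensor_PF_perm_act \<sigma> (relabel t) = relabel t" if \<sigma>: "\<sigma> permutes {1..n}" for \<sigma>
      proof -
        have "perm_op (inv_into UNIV \<sigma>) t = scale (of_int (sign \<sigma>)) t"
          using t permutes_inv[OF \<sigma>] sgn[OF \<sigma>] by (simp only: Alt_image_iff)
        then show ?thesis
          using sign_sq[of \<sigma> 1] by (simp add: relabel_perm[OF \<sigma>] pm_linear_scale scale_scale)
      qed
      then show "y \<in> ?R" using supp t Alt_image_iff by (simp add: y)
    qed
    show "join ` ?R \<subseteq> ?A"
    proof
      fix y assume "y \<in> join ` ?R"
      then obtain t where y: "y = join t" and t: "t \<in> ?R" by blast
      have ys: "y \<in> supported (dominating \<xi> N)" and ty: "relabel y = t"
        using t join_supp relabel_join by (simp_all add: y)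
      have "perm_op \<sigma> y = scale (of_int (sign \<sigma>)) y" if \<sigma>: "\<sigma> permutes {1..n}" for \<sigma>
      proof -
        let ?\<tau> = "inv_into UNIV \<sigma>"
        have \<tau>: "?\<tau> permutes {1..n}" by (rule permutes_inv[OF \<sigma>])
        have perm_supp: "perm_op \<sigma> y \<in> supported (dominating \<xi> N)"
          by (rule pm_linear_span[OF pm_linear_perm_op supported_subspace _ ys[unfolded supported_span]])
            (use dominating_perm[of \<sigma> \<xi> _ N] \<sigma> n in auto)
        have "tensor_PF_perm_act ?\<tau> t = t" using t \<tau> by blast
        then have "scale (of_int (sign \<sigma>)) (relabel (perm_op \<sigma> y)) = relabel y"
          using relabel_perm[OF \<tau>, of y] by (simp add: ty sgn[OF \<sigma>] permutes_inv_inv[OF \<sigma>])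
        then have "relabel (scale (of_int (sign \<sigma>)) (perm_op \<sigma> y)) = relabel y"
          by (simp add: pm_linear_scale)
        then have "scale (of_int (sign \<sigma>)) (perm_op \<sigma> y) = y"
          using join_relabel[OF ys] join_relabel[OF pm.subspace_scale[OF supported_subspace perm_supp]] by metis
        then have "scale (of_int (sign \<sigma>)) (scale (of_int (sign \<sigma>)) (perm_op \<sigma> y)) = scale (of_int (sign \<sigma>)) y"
          by simp
        then show ?thesis using sign_sq[of \<sigma> 1] by (simp add: scale_scale)
      qed
      then show "y \<in> ?A" using ys Alt_image_iff by blast
    qed
  qed
  then show ?thesis by (simp only: R)
qed

lemma V_mod_isomorphic_tensor_PF_invariants: "gl_isomorphic r (V_mod \<xi> N) (tensor_PF_invariants r n \<rho>)"
proof -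
  let ?A = "Alt n ` supported (dominating \<xi> N)" and ?R = "carrier (tensor_PF_invariants r n \<rho>)"
  let ?T = "\<lambda>g. tensor_act n (VN_act r N) (gl_tensor g 1)"
  obtain \<Theta> where \<Theta>: "linear_model (V_mod \<xi> N) \<Theta> ?A"
    and act: "\<And>g. g \<in> carrier_mat r r \<Longrightarrow> intertwines (V_mod \<xi> N) \<Theta> g (?T g)"
    using linear_model_V_mod[of \<xi> N] unfolding r n[symmetric] by metis
  have model: "linear_model (V_mod \<xi> N) (\<lambda>x. relabel (\<Theta> x)) ?R"
    by (rule linear_model_compose[OF \<Theta> pm_linear_relabel bij_betw_relabel])
  have R: "tensor_PF_invariants r n \<rho> =
      sub_rep (free_rep (({1..n} \<rightarrow>\<^sub>E {..<r}) \<times> parking_functions n \<rho>) (tensor_PF_gl_act r n)) ?R"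
    by (simp add: tensor_PF_invariants_def sub_rep_def tensor_PF_def)
  have subR: "pm.subspace ?R" by (rule linear_modelD(1)[OF model])
  have RS: "?R \<subseteq> supported (({1..n} \<rightarrow>\<^sub>E {..<r}) \<times> parking_functions n \<rho>)"
    by (auto simp: tensor_PF_invariants_def sub_rep_def tensor_PF_def free_rep_def supported_def)
  have closed: "tensor_PF_gl_act r n A x \<in> ?R" if A: "A \<in> carrier_mat r r" and x: "x \<in> ?R" for A x
  proof -
    obtain t where t: "t \<in> ?A" "x = relabel t" using x bij_betw_imp_surj_on[OF bij_betw_relabel] by blast
    have "?T A t \<in> ?A"
      using t(1) tensor_act_supported_dominating[of _ \<xi> N] by (auto simp: tensor_act_Alt n r)
    moreover have "tensor_PF_gl_act r n A x = relabel (?T A t)"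
      using relabel_gl_act[OF A] t Alt_image_iff by blast
    ultimately show ?thesis using bij_betw_imp_surj_on[OF bij_betw_relabel] by blast
  qed
  have "gl_module r (sub_rep (free_rep (({1..n} \<rightarrow>\<^sub>E {..<r}) \<times> parking_functions n \<rho>) (tensor_PF_gl_act r n)) ?R)"
    using RS by (intro gl_module_free_sub_rep subR pm_linear_tensor_PF_gl_act closed tensor_PF_gl_act_laws) auto
  then have gl: "gl_module r (tensor_PF_invariants r n \<rho>)" by (simp only: R[symmetric])
  have model': "linear_model (tensor_PF_invariants r n \<rho>) (\<lambda>t. t) ?R"
    by (subst R) (rule linear_model_free_sub_rep[OF subR])
  have actR: "act (tensor_PF_invariants r n \<rho>) = tensor_PF_gl_act r n"
    by (simp add: tensor_PF_invariants_def sub_rep_def tensor_PF_def free_rep_def)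
  show ?thesis
  proof (rule gl_isomorphicI[OF model model' gl], unfold intertwines_def, rule ballI)
    fix A :: "complex mat" and x assume A: "A \<in> carrier_mat r r" and x: "x \<in> carrier (V_mod \<xi> N)"
    have "\<Theta> x \<in> supported (dominating \<xi> N)" using linear_modelD(9)[OF \<Theta> x] Alt_image_iff by blast
    then show "act (V_mod \<xi> N) A x \<in> carrier (V_mod \<xi> N) \<and>
        relabel (\<Theta> (act (V_mod \<xi> N) A x)) = act (tensor_PF_invariants r n \<rho>) A (relabel (\<Theta> x))"
      using act[OF A] x relabel_gl_act[OF A] by (simp add: intertwines_def actR)
  qed
qed

end

theorem proposition8:
  fixes r n :: nat and \<xi> \<rho> :: "nat list" and N :: int
  assumes "length \<xi> = r" and "sorted_wrt (\<ge>) \<xi>" and "n = sum_list \<xi>"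
    and "sorted_wrt (\<ge>) \<rho>" and "0 \<notin> set \<rho>"
    and "\<And>j. 1 \<le> j \<Longrightarrow> count_list \<rho> j = transposed_part \<xi> j"
  shows "gl_isomorphic r (V_mod \<xi> N) (tensor_PF_invariants r n \<rho>)"
  using V_mod_isomorphic_tensor_PF_invariants[OF assms(1,3,4,5,6)] .

end
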